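(* For every constant $c>0$ there is a constant $C>0$ depending only on $c$ such that the following holds. Let $p$ be a prime, let $P\subseteq\mathbb{F}_{p^4}\times\mathbb{F}_{p^4}$ with $|P|=n$ and $p^{\frac{6419}{2560}}\leq c\,n$, and let $A=\{x:(x,y)\in P\}$. Let $t$ be a defining element of $\mathbb{F}_{p^4}$ over $\mathbb{F}_{p^2}$, so that $\mathbb{F}_{p^4}=\mathbb{F}_{p^2}+t\mathbb{F}_{p^2}$. Suppose that $|A|\leq c\,p^2$ and that $A=\bigcup_{j\in J}A_j$, where $J\subseteq\mathbb{F}_{p^2}$ satisfies $|J|\leq c\max\left\{p,n^{\frac{2560}{6419}}\right\}$, and, for each $j\in J$, $A_j\subseteq\mathbb{F}_{p^2}+jt$ with $|A_j|\leq c\max\left\{p,n^{\frac{2560}{6419}}\right\}$. Then $$I(P,L)\leq C\,n^{\frac32-\frac{1}{12838}}$$ for all sets of lines $L$ in $\mathbb{F}_{p^4}\times\mathbb{F}_{p^4}$ with $|L|=n$.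
   Context: For sets $P$ of points and $L$ of lines in the plane $F\times F$ over a field $F$, $I(P,L)=|\{(p,l)\in P\times L: p\in l\}|$ is the number of incidences. For $j\in\mathbb{F}_{p^2}$, $\mathbb{F}_{p^2}+jt=\{x+jt:x\in\mathbb{F}_{p^2}\}$. *)

theory Defs
  imports Complex_Main "HOL-Algebra.Generated_Fields" "HOL-Computational_Algebra.Primes"
begin

(* Finite fields are field records F :: 'a ring with a finite carrier, not types of class field:
   a constant that must not depend on the field can then be chosen before F is quantified.
   Every finite field has an isomorphic copy with carrier in nat, so the instance 'a = nat already
   provides one constant for all finite fields. *)

definition is_line :: "('a, 'm) ring_scheme \<Rightarrow> ('a \<times> 'a) set \<Rightarrow> bool" where
  "is_line F l \<longleftrightarrow>
     (\<exists>a\<in>carrier F. \<exists>b\<in>carrier F. \<exists>c\<in>carrier F. (a, b) \<noteq> (\<zero>\<^bsub>F\<^esub>, \<zero>\<^bsub>F\<^esub>) \<and>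
        l = {(x, y) \<in> carrier F \<times> carrier F. a \<otimes>\<^bsub>F\<^esub> x \<oplus>\<^bsub>F\<^esub> b \<otimes>\<^bsub>F\<^esub> y = c})"

definition incidences :: "('a \<times> 'a) set \<Rightarrow> ('a \<times> 'a) set set \<Rightarrow> nat" where
  "incidences P L = card {(q, l) \<in> P \<times> L. q \<in> l}"

definition defining_element :: "('a, 'm) ring_scheme \<Rightarrow> 'a set \<Rightarrow> 'a \<Rightarrow> bool" where
  "defining_element F K t \<longleftrightarrow> t \<in> carrier F \<and> generate_field F (insert t K) = carrier F"

end

(* Suppose I > C n^(3/2 - eps). Pigeonholing gives two points p1, p2 whose pencils of about n^(1/2) lines each
   meet in a positive proportion (up to powers of M = n^eps / theta) of P. A projective map sends p1 and p2 to infinity,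
   so that this part of P becomes a dense subset of a grid X x Y that is still rich for n non-constant affine
   maps. Counting lines that are rich on three rows and applying Balog-Szemeredi-Gowers yields a pencil of slopes S,
   with S - S small, such that S has large intersection with r S for all r in an affine image Lambda of a
   large set of rows. By Ruzsa covering and Petridis' form of the Pluennecke inequality, S is then almost
   invariant under every dilation by an element (a-b)/(c-d), so the set of these quotients is too small not to be a
   subfield G, and Lambda is contained in G. The sizes force |G| = p^2, hence G = K. Undoing the projective map
   turns Lambda into a large part of the abscissa set A that lies on a Moebius image of K, which meets each coset
   of K in at most two points unless it lies in a single coset. This contradicts the structure of A. *)

theory Submission
  imports Defs "HOL-Algebra.Multiplicative_Group" "HOL-Library.Disjoint_Sets"
begin

section \<open>Sumsets in rings\<close>

text \<open>The obstacle is the subfield itself: the points of \<open>K\<close> x \<open>K\<close>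
  and the lines with slope and intercept in \<open>K\<close> reach n^(3/2) incidences, so no
  argument inside the grid can be contradictory by itself. It can only identify a subfield G that
  carries the incidences, and the hypotheses on p and A then exclude each possible order of G.
  Lagrange leaves |G| <= p, |G| = p^2 or |G| = p^4. In the first case the lower bound on n makes p
  at most a constant times n^(2560/6419), which is below |Lambda|. In the last case |A| <= c p^2
  gives n <= c p^6, while p^4 = |G| exceeds n^(1/2) only by a power of M. The middle case is the one
  that needs the cosets. With nu = n^(1/12838) one has n^(1/2) = nu^6419 and n^(2560/6419) =
  nu^5120, so the exponent 1/12838 measures everything in integral powers of nu. Every loss is a
  power of M = nu / theta. The exponents leave spare powers of theta, and these absorb all factors
  that depend on c. If nu is bounded in terms of c, the trivial bound of order n^(3/2) is already
  good enough.\<close>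

context ring
begin

definition sumset :: "'a set \<Rightarrow> 'a set \<Rightarrow> 'a set" where
  "sumset A B = {a \<oplus> b | a b. a \<in> A \<and> b \<in> B}"

definition diffset :: "'a set \<Rightarrow> 'a set \<Rightarrow> 'a set" where
  "diffset A B = {a \<ominus> b | a b. a \<in> A \<and> b \<in> B}"

lemma sumsetI: "a \<in> A \<Longrightarrow> b \<in> B \<Longrightarrow> a \<oplus> b \<in> sumset A B"
  and diffsetI: "a \<in> A \<Longrightarrow> b \<in> B \<Longrightarrow> a \<ominus> b \<in> diffset A B"
  unfolding sumset_def diffset_def by auto

lemma sumset_image: "sumset A B = (\<lambda>(a, b). a \<oplus> b) ` (A \<times> B)"
  unfolding sumset_def by auto

lemma diffset_image: "diffset A B = (\<lambda>(a, b). a \<ominus> b) ` (A \<times> B)"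
  unfolding diffset_def by auto

lemma finite_sumset [simp]: "finite A \<Longrightarrow> finite B \<Longrightarrow> finite (sumset A B)"
  and finite_diffset [simp]: "finite A \<Longrightarrow> finite B \<Longrightarrow> finite (diffset A B)"
  unfolding sumset_image diffset_image by auto

lemma sumset_closed [simp]: "A \<subseteq> carrier R \<Longrightarrow> B \<subseteq> carrier R \<Longrightarrow> sumset A B \<subseteq> carrier R"
  and diffset_closed [simp]: "A \<subseteq> carrier R \<Longrightarrow> B \<subseteq> carrier R \<Longrightarrow> diffset A B \<subseteq> carrier R"
  unfolding sumset_def diffset_def by auto

lemma card_sumset_le: "finite A \<Longrightarrow> finite B \<Longrightarrow> card (sumset A B) \<le> card A * card B"
  unfolding sumset_image by (metis card_cartesian_product card_image_le finite_cartesian_product)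

lemma card_diffset_le: "finite A \<Longrightarrow> finite B \<Longrightarrow> card (diffset A B) \<le> card A * card B"
  unfolding diffset_image by (metis card_cartesian_product card_image_le finite_cartesian_product)

lemma sumset_mono: "A \<subseteq> A' \<Longrightarrow> B \<subseteq> B' \<Longrightarrow> sumset A B \<subseteq> sumset A' B'"
  unfolding sumset_def by blast

lemma sumset_assoc:
  assumes "A \<subseteq> carrier R" "B \<subseteq> carrier R" "C \<subseteq> carrier R"
  shows "sumset (sumset A B) C = sumset A (sumset B C)"
proof -
  have *: "x \<oplus> y \<oplus> z = x \<oplus> (y \<oplus> z)" if "x \<in> A" "y \<in> B" "z \<in> C" for x y z
    using assms that by (simp add: subset_iff a_assoc)
  show ?thesis unfolding sumset_def by (auto simp: *) (metis *)+
qed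

lemma card_translate:
  assumes "A \<subseteq> carrier R" "c \<in> carrier R"
  shows "card ((\<lambda>a. a \<oplus> c) ` A) = card A"
  using assms by (intro card_image inj_onI) (auto simp: subset_iff)

lemma card_diffset_swap:
  assumes "A \<subseteq> carrier R" "B \<subseteq> carrier R"
  shows "card (diffset A B) = card (diffset B A)"
proof -
  have *: "\<ominus> (x \<ominus> y) = y \<ominus> x" if "x \<in> carrier R" "y \<in> carrier R" for x y
    using that by (simp add: a_minus_def minus_add a_comm)
  have "(\<lambda>x. \<ominus> x) ` diffset A B = diffset B A"
  proof
    show "(\<lambda>x. \<ominus> x) ` diffset A B \<subseteq> diffset B A"
    proof (clarsimp simp: diffset_def)
      fix a b assume "a \<in> A" "b \<in> B"
      with assms * show "\<exists>b' a'. \<ominus> (a \<ominus> b) = b' \<ominus> a' \<and> b' \<in> B \<and> a' \<in> A" by blast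
    qed
    show "diffset B A \<subseteq> (\<lambda>x. \<ominus> x) ` diffset A B"
    proof
      fix z assume "z \<in> diffset B A"
      then obtain b a where z: "b \<in> B" "a \<in> A" "z = b \<ominus> a" by (auto simp: diffset_def)
      then have "z = \<ominus> (a \<ominus> b)" using *[of a b] assms by (metis subsetD)
      then show "z \<in> (\<lambda>x. \<ominus> x) ` diffset A B" using z by (auto simp: diffset_def)
    qed
  qed
  moreover have "inj_on (\<lambda>x. \<ominus> x) (diffset A B)"
    using diffset_closed[OF assms] by (intro inj_onI) (metis minus_minus subsetD)
  ultimately show ?thesis by (metis card_image)
qed

text \<open>Fix one representation d = x - y for each d in A - C and send (d, b) to (x - b, b - y).
  The two coordinates add up to d, which fixes x and y and then b, so the map is injective.\<close>

lemma ruzsa_triangle: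
  assumes "finite A" "finite B" "finite C"
    and "A \<subseteq> carrier R" "B \<subseteq> carrier R" "C \<subseteq> carrier R"
  shows "card (diffset A C) * card B \<le> card (diffset A B) * card (diffset B C)"
proof -
  define rep where "rep d = (SOME q. fst q \<in> A \<and> snd q \<in> C \<and> d = fst q \<ominus> snd q)" for d
  have rep: "fst (rep d) \<in> A \<and> snd (rep d) \<in> C \<and> d = fst (rep d) \<ominus> snd (rep d)" if "d \<in> diffset A C" for d
    unfolding rep_def by (rule someI_ex) (use that in \<open>auto simp: diffset_def\<close>)
  define f where "f = (\<lambda>(d, b). (fst (rep d) \<ominus> b, b \<ominus> snd (rep d)))"
  have "inj_on f (diffset A C \<times> B)"
  proof (rule inj_onI, clarify)
    fix d b d' b'
    assume d: "d \<in> diffset A C" "d' \<in> diffset A C" and b: "b \<in> B" "b' \<in> B" and e: "f (d, b) = f (d', b')"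
    define x y x' y' where "x = fst (rep d)" and "y = snd (rep d)" and "x' = fst (rep d')" and "y' = snd (rep d')"
    have c: "x \<in> carrier R" "y \<in> carrier R" "x' \<in> carrier R" "y' \<in> carrier R" "b \<in> carrier R" "b' \<in> carrier R"
      using rep[OF d(1)] rep[OF d(2)] b assms by (auto simp: x_def y_def x'_def y'_def)
    have e1: "x \<ominus> b = x' \<ominus> b'" and e2: "b \<ominus> y = b' \<ominus> y'"
      using e by (auto simp: f_def x_def y_def x'_def y'_def)
    have "d = x \<ominus> y" "d' = x' \<ominus> y'" using rep[OF d(1)] rep[OF d(2)] by (auto simp: x_def y_def x'_def y'_def)
    moreover have "x \<ominus> y = (x \<ominus> b) \<oplus> (b \<ominus> y)" "x' \<ominus> y' = (x' \<ominus> b') \<oplus> (b' \<ominus> y')"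
      using c by algebra+
    ultimately have dd: "d = d'" using e1 e2 by simp
    then have "x = x'" by (simp add: x_def x'_def)
    moreover have "b = x \<ominus> (x \<ominus> b)" "b' = x' \<ominus> (x' \<ominus> b')" using c by algebra+
    ultimately have "b = b'" using e1 by simp
    with dd show "d = d' \<and> b = b'" by simp
  qed
  moreover have "f ` (diffset A C \<times> B) \<subseteq> diffset A B \<times> diffset B C"
    using rep by (fastforce simp: f_def diffset_def)
  ultimately have "card (diffset A C \<times> B) \<le> card (diffset A B \<times> diffset B C)"
    using assms by (intro card_inj_on_le) auto
  then show ?thesis by (simp add: card_cartesian_product)
qed

text \<open>Induction on \<open>C\<close>. A new element \<open>c\<close> enlarges the left-hand
  sumset by at most |X+B| - |X'+B| and \<open>sumset X C\<close> by at least |X| - |X'|, with the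
  same exceptional set X'. Minimality of the ratio |X+B| / |X| is exactly what compares these two
  increments.\<close>

lemma petridis:
  assumes fin: "finite X" "finite B" "finite C"
    and sub: "X \<subseteq> carrier R" "B \<subseteq> carrier R" "C \<subseteq> carrier R"
    and min: "\<And>X'. X' \<subseteq> X \<Longrightarrow> card (sumset X B) * card X' \<le> card (sumset X' B) * card X"
  shows "card (sumset (sumset X B) C) * card X \<le> card (sumset X B) * card (sumset X C)"
  using fin(3) sub(3)
proof (induction C rule: finite_induct)
  case empty
  then show ?case by (simp add: sumset_def)
next
  case (insert c C)
  then have c: "c \<in> carrier R" and C: "C \<subseteq> carrier R" "finite C" by auto
  define T where "T = sumset (sumset X B) C"
  \<comment> \<open>The exceptional set: those x whose whole translate x + B + c is already present
    and contributes nothing new.\<close>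
  define X' where "X' = {x \<in> X. \<forall>b\<in>B. x \<oplus> b \<oplus> c \<in> T}"
  have X': "X' \<subseteq> X" "finite X'" using fin by (auto simp: X'_def)
  have fT: "finite T" using fin C by (simp add: T_def)
  let ?t = "\<lambda>S. (\<lambda>a. a \<oplus> c) ` S"
  have "sumset (sumset X B) (insert c C) \<subseteq> T \<union> (?t (sumset X B) - ?t (sumset X' B))"
  proof
    fix z assume "z \<in> sumset (sumset X B) (insert c C)"
    then obtain w d where z: "z = w \<oplus> d" "w \<in> sumset X B" "d \<in> insert c C" unfolding sumset_def[of "sumset X B"] by blast
    show "z \<in> T \<union> (?t (sumset X B) - ?t (sumset X' B))"
    proof (cases "d = c")
      case False
      then show ?thesis using z by (auto simp: T_def sumset_def[of "sumset X B"])
    next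
      case True
      then have 1: "z \<in> ?t (sumset X B)" using z by auto
      have "?t (sumset X' B) \<subseteq> T" unfolding sumset_def[of X'] by (auto simp: X'_def)
      then show ?thesis using 1 by auto
    qed
  qed
  then have "card (sumset (sumset X B) (insert c C)) \<le> card (T \<union> (?t (sumset X B) - ?t (sumset X' B)))"
    using fT fin by (intro card_mono) auto
  also have "\<dots> \<le> card T + card (?t (sumset X B) - ?t (sumset X' B))" by (rule card_Un_le)
  also have "card (?t (sumset X B) - ?t (sumset X' B)) = card (?t (sumset X B)) - card (?t (sumset X' B))"
    using X' fin by (intro card_Diff_subset image_mono sumset_mono) auto
  also have "card (?t (sumset X B)) = card (sumset X B)"
    using sub c by (intro card_translate) auto
  also have "card (?t (sumset X' B)) = card (sumset X' B)"
    using sub X' c by (intro card_translate sumset_closed) auto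
  finally have up: "card (sumset (sumset X B) (insert c C)) \<le> card T + (card (sumset X B) - card (sumset X' B))" .
  have le: "card (sumset X' B) \<le> card (sumset X B)"
    using X' fin by (intro card_mono sumset_mono) auto
  \<comment> \<open>If x + c = x1 + c1 is an old sum, then x + b + c = x1 + b + c1 is old for every
    b, so x belongs to X'. Hence all other x give new elements x + c.\<close>
  have disj: "sumset X C \<inter> (?t X - ?t X') = {}"
  proof (rule ccontr)
    assume "sumset X C \<inter> (?t X - ?t X') \<noteq> {}"
    then obtain x x1 c1 where x: "x \<in> X" "x1 \<in> X" "c1 \<in> C" "x \<oplus> c = x1 \<oplus> c1" "x \<notin> X'"
      unfolding sumset_def by auto
    have "x \<oplus> b \<oplus> c \<in> T" if "b \<in> B" for b
    proof -
      have cc: "x \<in> carrier R" "x1 \<in> carrier R" "c1 \<in> carrier R" "b \<in> carrier R" using x that sub C by auto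
      have "x \<oplus> b \<oplus> c = (x \<oplus> c) \<oplus> b" using cc c by algebra
      also have "\<dots> = x1 \<oplus> b \<oplus> c1" unfolding x(4) using cc c by algebra
      finally show ?thesis using x that by (auto simp: T_def sumset_def)
    qed
    then have "x \<in> X'" using x by (auto simp: X'_def)
    with x show False by simp
  qed
  have "card (sumset X C \<union> (?t X - ?t X')) \<le> card (sumset X (insert c C))"
    using fin C by (intro card_mono finite_sumset) (auto simp: sumset_def)
  moreover have "finite (?t X)" "finite (?t X')" "?t X' \<subseteq> ?t X" "card (?t X) = card X" "card (?t X') = card X'"
    using fin X' sub c by (auto simp: card_translate)
  ultimately have low: "card (sumset X C) + (card X - card X') \<le> card (sumset X (insert c C))"
    using disj fin C by (simp add: card_Un_disjoint card_Diff_subset)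
  have IH: "card T * card X \<le> card (sumset X B) * card (sumset X C)"
    using insert.IH C by (simp add: T_def)
  have cX': "card X' \<le> card X" using X' fin by (simp add: card_mono)
  have "card (sumset (sumset X B) (insert c C)) * card X
      \<le> card T * card X + (card (sumset X B) * card X - card (sumset X' B) * card X)"
    using mult_right_mono[OF up, of "card X"] by (simp add: add_mult_distrib diff_mult_distrib)
  also have "\<dots> \<le> card (sumset X B) * card (sumset X C) + (card (sumset X B) * card X - card (sumset X B) * card X')"
    using IH min[OF X'(1)] by (intro add_mono diff_le_mono2) auto
  also have "\<dots> = card (sumset X B) * (card (sumset X C) + (card X - card X'))"
    by (simp add: add_mult_distrib2 diff_mult_distrib2)
  also have "\<dots> \<le> card (sumset X B) * card (sumset X (insert c C))"
    using low by (rule mult_left_mono) simp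
  finally show ?case .
qed

end

section \<open>Cauchy-Schwarz and collisions\<close>

lemma sum_square_le_card_mult:
  fixes f :: "'b \<Rightarrow> real"
  assumes "finite I"
  shows "(\<Sum>i\<in>I. f i)\<^sup>2 \<le> card I * (\<Sum>i\<in>I. (f i)\<^sup>2)"
proof -
  have "0 \<le> (\<Sum>i\<in>I. \<Sum>j\<in>I. (f i - f j)\<^sup>2)" by (intro sum_nonneg) auto
  also have "\<dots> = (\<Sum>i\<in>I. \<Sum>j\<in>I. (f i)\<^sup>2) + (\<Sum>i\<in>I. \<Sum>j\<in>I. (f j)\<^sup>2) - 2 * (\<Sum>i\<in>I. \<Sum>j\<in>I. f i * f j)"
    by (simp add: power2_diff sum.distrib sum_subtractf sum_distrib_left algebra_simps)
  also have "(\<Sum>i\<in>I. \<Sum>j\<in>I. f i * f j) = (\<Sum>i\<in>I. f i)\<^sup>2"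
    by (simp add: power2_eq_square sum_product)
  finally show ?thesis by (simp flip: sum_distrib_left)
qed

text \<open>Cauchy-Schwarz for the fibre sizes of \<open>f\<close>: they sum to |S|, and their
  squares sum to the number of colliding pairs.\<close>

lemma card_collisions:
  assumes "finite S" "finite D" "f ` S \<subseteq> D"
  shows "(card S)\<^sup>2 \<le> card D * card {(p, q) \<in> S \<times> S. f p = f q}"
proof -
  define r where "r d = card {p \<in> S. f p = d}" for d
  have "S = (\<Union>d\<in>D. {p \<in> S. f p = d})" using assms by auto
  then have "card S = card (\<Union>d\<in>D. {p \<in> S. f p = d})" by simp
  also have "\<dots> = (\<Sum>d\<in>D. r d)"
    unfolding r_def using assms by (intro card_UN_disjoint) auto
  finally have 1: "card S = (\<Sum>d\<in>D. r d)" .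
  have "{(p, q) \<in> S \<times> S. f p = f q} = (\<Union>d\<in>D. {p \<in> S. f p = d} \<times> {p \<in> S. f p = d})"
    using assms by auto
  then have "card {(p, q) \<in> S \<times> S. f p = f q} = card (\<Union>d\<in>D. {p \<in> S. f p = d} \<times> {p \<in> S. f p = d})" by simp
  also have "\<dots> = (\<Sum>d\<in>D. (r d)\<^sup>2)"
    unfolding r_def power2_eq_square using assms
    by (subst card_UN_disjoint) (auto simp: card_cartesian_product)
  finally have 2: "card {(p, q) \<in> S \<times> S. f p = f q} = (\<Sum>d\<in>D. (r d)\<^sup>2)" .
  have "(\<Sum>d\<in>D. real (r d))\<^sup>2 \<le> card D * (\<Sum>d\<in>D. (real (r d))\<^sup>2)"
    by (rule sum_square_le_card_mult) (fact assms)
  then have "real ((card S)\<^sup>2) \<le> real (card D * card {(p, q) \<in> S \<times> S. f p = f q})"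
    unfolding 1 2 by simp
  then show ?thesis by (simp only: of_nat_le_iff)
qed

section \<open>Iterated sumsets and the Pluennecke inequality\<close>

context ring
begin

fun multiple_sumset :: "nat \<Rightarrow> 'a set \<Rightarrow> 'a set" where
  "multiple_sumset 0 B = {\<zero>}"
| "multiple_sumset (Suc k) B = sumset B (multiple_sumset k B)"

text \<open>This is kA - kA, built by subtracting A - A at each step. The symmetric form is what
  makes the family stable under subtraction, with levels that simply add.\<close>

fun multiple_diffset :: "nat \<Rightarrow> 'a set \<Rightarrow> 'a set" where
  "multiple_diffset 0 A = {\<zero>}"
| "multiple_diffset (Suc k) A = diffset (multiple_diffset k A) (diffset A A)"

lemma multiple_sumset_closed [simp]: "B \<subseteq> carrier R \<Longrightarrow> multiple_sumset k B \<subseteq> carrier R"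
  by (induction k) auto

lemma finite_multiple_sumset [simp]: "finite B \<Longrightarrow> finite (multiple_sumset k B)"
  by (induction k) auto

lemma multiple_diffset_closed [simp]: "A \<subseteq> carrier R \<Longrightarrow> multiple_diffset k A \<subseteq> carrier R"
  by (induction k) auto

lemma finite_multiple_diffset [simp]: "finite A \<Longrightarrow> finite (multiple_diffset k A)"
  by (induction k) auto

text \<open>Take X to minimise |X+B| / |X| over the nonempty subsets of A; this ratio is at most K.
  Petridis' inequality with C = kB then costs one factor K per further summand. The same X serves
  every k, since minimality does not involve k.\<close>

lemma plunnecke:
  fixes K :: real
  assumes A: "finite A" "A \<noteq> {}" "A \<subseteq> carrier R" and B: "finite B" "B \<subseteq> carrier R"
    and K: "real (card (sumset A B)) \<le> K * card A"
  obtains X where "X \<subseteq> A" "X \<noteq> {}" "\<And>k. real (card (sumset X (multiple_sumset k B))) \<le> K ^ k * card X"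
proof -
  define ratio where "ratio X = real (card (sumset X B)) / card X" for X
  let ?P = "Pow A - {{}}"
  have "finite (ratio ` ?P)" "ratio ` ?P \<noteq> {}" using A by auto
  from ex_min_if_finite[OF this] obtain r where "r \<in> ratio ` ?P" and r: "\<not> (\<exists>s\<in>ratio ` ?P. s < r)" by blast
  then obtain X where X: "X \<in> ?P" "r = ratio X" by blast
  have X_min: "ratio X \<le> ratio X'" if "X' \<in> ?P" for X'
    using r X(2) that by (metis imageI not_less)
  have fX: "finite X" "X \<subseteq> carrier R" "X \<noteq> {}" "X \<subseteq> A" using X(1) A by (auto intro: finite_subset)
  then have cX: "card X > 0" by (simp add: card_gt_0_iff)
  have K': "ratio X \<le> K"
  proof -
    have "ratio X \<le> ratio A" using X_min[of A] A by auto
    also have "\<dots> \<le> K" using K A by (simp add: ratio_def field_simps card_gt_0_iff)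
    finally show ?thesis .
  qed
  have min: "card (sumset X B) * card X' \<le> card (sumset X' B) * card X" if "X' \<subseteq> X" for X'
  proof (cases "X' = {}")
    case False
    then have "ratio X \<le> ratio X'" using X_min[of X'] fX that by auto
    moreover have "card X' > 0" using False that fX by (auto simp: card_gt_0_iff intro: finite_subset)
    ultimately have "real (card (sumset X B) * card X') \<le> real (card (sumset X' B) * card X)"
      using cX by (simp add: ratio_def field_simps)
    then show ?thesis by (simp only: of_nat_le_iff)
  qed simp
  have "real (card (sumset X (multiple_sumset k B))) \<le> K ^ k * card X" for k
  proof (induction k)
    case 0
    have "sumset X {\<zero>} = X" using fX by (force simp: sumset_def)
    then show ?case by simp
  next
    case (Suc k)
    let ?S = "multiple_sumset k B"
    have "card (sumset (sumset X B) ?S) * card X \<le> card (sumset X B) * card (sumset X ?S)"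
      using fX B min by (intro petridis) auto
    then have "real (card (sumset (sumset X B) ?S) * card X) \<le> real (card (sumset X B) * card (sumset X ?S))"
      by (simp only: of_nat_le_iff)
    then have "real (card (sumset (sumset X B) ?S)) \<le> ratio X * card (sumset X ?S)"
      using cX by (simp add: ratio_def field_simps)
    also have "\<dots> \<le> K * (K ^ k * card X)"
      using Suc K' order_trans[OF _ K', of 0] by (intro mult_mono) (auto simp: ratio_def)
    finally show ?case using fX B by (simp add: sumset_assoc mult.assoc)
  qed
  then show ?thesis using that fX by blast
qed

text \<open>Apply Pluennecke to B = -A to obtain X with |X + kB| <= K^k |X|. Ruzsa's triangle
  inequality through Y = -X bounds |kB - kB| by K^(2k) |X|, and kA - kA lies in kB - kB.\<close>

lemma card_multiple_diffset:
  fixes K :: real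
  assumes A: "finite A" "A \<noteq> {}" "A \<subseteq> carrier R" and K: "real (card (diffset A A)) \<le> K * card A"
  shows "real (card (multiple_diffset k A)) \<le> K ^ (2 * k) * card A"
proof -
  define B where "B = (\<lambda>x. \<ominus> x) ` A"
  have B: "finite B" "B \<subseteq> carrier R" using A by (auto simp: B_def)
  let ?S = "\<lambda>k. multiple_sumset k B"
  have "sumset A B = diffset A A" by (auto simp: sumset_def diffset_def B_def a_minus_def)
  with K have "real (card (sumset A B)) \<le> K * card A" by simp
  from plunnecke[OF A B this] obtain X where
    X: "X \<subseteq> A" "X \<noteq> {}" "\<And>k. real (card (sumset X (?S k))) \<le> K ^ k * card X"
    by blast
  have fX: "finite X" "X \<subseteq> carrier R" "card X > 0" using X A by (auto simp: card_gt_0_iff intro: finite_subset)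
  define Y where "Y = (\<lambda>x. \<ominus> x) ` X"
  have Y: "finite Y" "Y \<subseteq> carrier R" "card Y = card X"
    using fX unfolding Y_def by (auto intro!: card_image inj_onI) (metis minus_minus subsetD)
  have im: "diffset Y (?S k) \<subseteq> (\<lambda>x. \<ominus> x) ` sumset X (?S k)"
  proof
    fix z assume "z \<in> diffset Y (?S k)"
    then obtain x s where z: "x \<in> X" "s \<in> ?S k" "z = \<ominus> x \<ominus> s" by (auto simp: diffset_def Y_def)
    then have "x \<in> carrier R" "s \<in> carrier R" using fX multiple_sumset_closed[OF B(2), of k] by auto
    then have "z = \<ominus> (x \<oplus> s)" unfolding z(3) by algebra
    moreover have "x \<oplus> s \<in> sumset X (?S k)" using z by (auto simp: sumset_def)
    ultimately show "z \<in> (\<lambda>x. \<ominus> x) ` sumset X (?S k)" by blast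
  qed
  have "card (diffset Y (?S k)) \<le> card (sumset X (?S k))"
    using fX B by (intro surj_card_le[OF _ im]) auto
  then have 1: "real (card (diffset Y (?S k))) \<le> K ^ k * card X" using X(3)[of k] by linarith
  have "card (diffset (?S k) (?S k)) * card Y \<le> card (diffset (?S k) Y) * card (diffset Y (?S k))"
    using Y B by (intro ruzsa_triangle) auto
  also have "card (diffset (?S k) Y) = card (diffset Y (?S k))" using Y B by (intro card_diffset_swap) auto
  finally have "real (card (diffset (?S k) (?S k)) * card X) \<le> real (card (diffset Y (?S k)) * card (diffset Y (?S k)))"
    using Y by (simp only: of_nat_le_iff)
  also have "\<dots> \<le> (K ^ k * card X) * (K ^ k * card X)"
    unfolding of_nat_mult using 1 by (intro mult_mono) (auto intro: order_trans[OF of_nat_0_le_iff])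
  finally have "real (card (diffset (?S k) (?S k))) \<le> K ^ (2 * k) * card X"
    using fX by (simp add: power_mult power2_eq_square power_mult_distrib mult_ac)
  also have "\<dots> \<le> K ^ (2 * k) * card A"
    using X A by (intro mult_left_mono) (auto intro: card_mono)
  finally have 2: "real (card (diffset (?S k) (?S k))) \<le> K ^ (2 * k) * card A" .
  have "multiple_diffset k A \<subseteq> diffset (?S k) (?S k)"
  proof (induction k)
    case 0
    have "\<zero> = \<zero> \<ominus> \<zero>" by algebra
    then show ?case by (auto simp: diffset_def)
  next
    case (Suc k)
    show ?case
    proof
      fix z assume "z \<in> multiple_diffset (Suc k) A"
      then obtain w a b where z: "z = w \<ominus> (a \<ominus> b)" "w \<in> multiple_diffset k A" "a \<in> A" "b \<in> A"
        by (auto simp: diffset_def)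
      with Suc obtain s t where w: "w = s \<ominus> t" "s \<in> ?S k" "t \<in> ?S k" by (auto simp: diffset_def)
      have c: "a \<in> carrier R" "b \<in> carrier R" "s \<in> carrier R" "t \<in> carrier R"
        using z w A multiple_sumset_closed[OF B(2), of k] by auto
      have "z = (\<ominus> a \<oplus> s) \<ominus> (\<ominus> b \<oplus> t)" unfolding z w using c by algebra
      moreover have "\<ominus> a \<oplus> s \<in> ?S (Suc k)" "\<ominus> b \<oplus> t \<in> ?S (Suc k)"
        using z w by (auto simp: sumset_def B_def)
      ultimately show "z \<in> diffset (?S (Suc k)) (?S (Suc k))" by (auto simp: diffset_def)
    qed
  qed
  then have "card (multiple_diffset k A) \<le> card (diffset (?S k) (?S k))"
    using B by (intro card_mono) auto
  with 2 show ?thesis by linarith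
qed

lemma diffset_multiple_diffset:
  assumes A: "A \<subseteq> carrier R"
  shows "diffset (multiple_diffset k A) (multiple_diffset m A) \<subseteq> multiple_diffset (k + m) A"
proof (induction m)
  case 0
  have "diffset (multiple_diffset k A) {\<zero>} \<subseteq> multiple_diffset k A"
    using multiple_diffset_closed[OF A, of k] by (auto simp: diffset_def a_minus_def)
  then show ?case by simp
next
  case (Suc m)
  show ?case
  proof
    fix z assume "z \<in> diffset (multiple_diffset k A) (multiple_diffset (Suc m) A)"
    then obtain x y a b where z: "z = x \<ominus> (y \<ominus> (a \<ominus> b))" "x \<in> multiple_diffset k A" "y \<in> multiple_diffset m A"
      "a \<in> A" "b \<in> A" by (auto simp: diffset_def)
    have c: "x \<in> carrier R" "y \<in> carrier R" "a \<in> carrier R" "b \<in> carrier R"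
      using z(2-5) multiple_diffset_closed[OF A, of k] multiple_diffset_closed[OF A, of m] A by blast+
    have "x \<ominus> y \<in> multiple_diffset (k + m) A" using Suc z by (auto simp: diffset_def)
    moreover have "z = (x \<ominus> y) \<ominus> (b \<ominus> a)" unfolding z using c by algebra
    ultimately show "z \<in> multiple_diffset (k + Suc m) A" using z by (auto simp: diffset_def)
  qed
qed

end

section \<open>Dilates and coverings\<close>

context field
begin

definition dilate :: "'a \<Rightarrow> 'a set \<Rightarrow> 'a set" where
  "dilate r S = (\<lambda>x. r \<otimes> x) ` S"

text \<open>The two costs are kept apart because the operations treat them differently: a difference
  of two sets multiplies the numbers of translates and adds the levels, while a dilation doubles the
  level. Only at the end does \<open>card_covered\<close> turn both into a cardinality.\<close>

definition covered :: "'a set \<Rightarrow> real \<Rightarrow> nat \<Rightarrow> 'a set \<Rightarrow> bool" where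
  "covered A \<kappa> k S \<longleftrightarrow> (\<exists>T. finite T \<and> T \<subseteq> carrier R \<and> real (card T) \<le> \<kappa> \<and>
     S \<subseteq> sumset T (multiple_diffset k A))"

lemma dilateI: "x \<in> S \<Longrightarrow> r \<otimes> x \<in> dilate r S"
  by (auto simp: dilate_def)

lemma dilate_closed [simp]: "r \<in> carrier R \<Longrightarrow> S \<subseteq> carrier R \<Longrightarrow> dilate r S \<subseteq> carrier R"
  by (auto simp: dilate_def)

lemma finite_dilate [simp]: "finite S \<Longrightarrow> finite (dilate r S)"
  by (simp add: dilate_def)

lemma card_dilate:
  assumes "r \<in> carrier R" "r \<noteq> \<zero>" "S \<subseteq> carrier R"
  shows "card (dilate r S) = card S"
  unfolding dilate_def using assms by (intro card_image inj_onI) (auto simp: m_lcancel subset_iff)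

lemma covered_subset: "covered A \<kappa> k S \<Longrightarrow> S' \<subseteq> S \<Longrightarrow> covered A \<kappa> k S'"
  unfolding covered_def by (meson subset_trans)

lemma covered_nonneg: "covered A \<kappa> k S \<Longrightarrow> 0 \<le> \<kappa>"
  unfolding covered_def using of_nat_0_le_iff order_trans by blast

lemma covered_diffset:
  assumes A: "A \<subseteq> carrier R" and 1: "covered A \<kappa> k S" and 2: "covered A \<kappa>' k' S'"
  shows "covered A (\<kappa> * \<kappa>') (k + k') (diffset S S')"
proof -
  obtain T where T: "finite T" "T \<subseteq> carrier R" "real (card T) \<le> \<kappa>" "S \<subseteq> sumset T (multiple_diffset k A)"
    using 1 by (auto simp: covered_def)
  obtain T' where T': "finite T'" "T' \<subseteq> carrier R" "real (card T') \<le> \<kappa>'" "S' \<subseteq> sumset T' (multiple_diffset k' A)"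
    using 2 by (auto simp: covered_def)
  have "real (card (diffset T T')) \<le> real (card T * card T')"
    using card_diffset_le[OF T(1) T'(1)] by (simp only: of_nat_le_iff)
  also have "\<dots> \<le> \<kappa> * \<kappa>'"
    unfolding of_nat_mult using T T' covered_nonneg[OF 1] by (intro mult_mono) auto
  finally have c: "real (card (diffset T T')) \<le> \<kappa> * \<kappa>'" .
  have "diffset S S' \<subseteq> sumset (diffset T T') (multiple_diffset (k + k') A)"
  proof
    fix z assume "z \<in> diffset S S'"
    then obtain s s' where z: "z = s \<ominus> s'" "s \<in> S" "s' \<in> S'" by (auto simp: diffset_def)
    then have "s \<in> sumset T (multiple_diffset k A)" "s' \<in> sumset T' (multiple_diffset k' A)" using T T' by auto
    then obtain t d t' d' where t: "s = t \<oplus> d" "s' = t' \<oplus> d'" "t \<in> T" "t' \<in> T'"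
      "d \<in> multiple_diffset k A" "d' \<in> multiple_diffset k' A" by (auto simp: sumset_def)
    have c: "t \<in> carrier R" "t' \<in> carrier R" "d \<in> carrier R" "d' \<in> carrier R"
      using t(3-6) T(2) T'(2) multiple_diffset_closed[OF A] by blast+
    have "d \<ominus> d' \<in> multiple_diffset (k + k') A"
      using t diffset_multiple_diffset[OF A, of k k'] by (auto simp: diffset_def)
    moreover have "t \<ominus> t' \<in> diffset T T'" using t by (auto simp: diffset_def)
    moreover have "z = (t \<ominus> t') \<oplus> (d \<ominus> d')" unfolding z t(1,2) using c by algebra
    ultimately show "z \<in> sumset (diffset T T') (multiple_diffset (k + k') A)" by (auto simp: sumset_def)
  qed
  with c T T' show ?thesis unfolding covered_def by (metis diffset_closed finite_diffset)
qed

lemma card_covered: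
  fixes K :: real
  assumes A: "finite A" "A \<noteq> {}" "A \<subseteq> carrier R" and K: "real (card (diffset A A)) \<le> K * card A"
    and S: "covered A \<kappa> k S"
  shows "real (card S) \<le> \<kappa> * K ^ (2 * k) * card A"
proof -
  obtain T where T: "finite T" "T \<subseteq> carrier R" "real (card T) \<le> \<kappa>" "S \<subseteq> sumset T (multiple_diffset k A)"
    using S by (auto simp: covered_def)
  have "card S \<le> card (sumset T (multiple_diffset k A))"
    using T A by (intro card_mono) auto
  also have "\<dots> \<le> card T * card (multiple_diffset k A)" using T A by (intro card_sumset_le) auto
  finally have "real (card S) \<le> real (card T) * real (card (multiple_diffset k A))"
    by (metis of_nat_le_iff of_nat_mult)
  also have "\<dots> \<le> \<kappa> * (K ^ (2 * k) * card A)"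
    using T(3) card_multiple_diffset[OF A K, of k] covered_nonneg[OF S] by (intro mult_mono) auto
  finally show ?thesis by (simp add: mult.assoc)
qed

text \<open>Choose a maximal T in S for which the sets t - U are disjoint. Counting gives |T| |U| <=
  |S - U|. By maximality x - U meets some t - U, and then x lies in t + U - U, which is inside t + A
  - A.\<close>

lemma ruzsa_covering:
  fixes \<kappa> :: real
  assumes A: "A \<subseteq> carrier R" and S: "finite S" "S \<subseteq> carrier R"
    and U: "finite U" "U \<subseteq> A" "U \<noteq> {}" and \<kappa>: "real (card (diffset S U)) \<le> \<kappa> * card U"
  shows "covered A \<kappa> 1 S"
proof -
  define P where "P T \<longleftrightarrow> T \<subseteq> S \<and> inj_on (\<lambda>(t, u). t \<ominus> u) (T \<times> U)" for T
  have "finite {T. P T}" using S by (auto simp: P_def intro: finite_subset[of _ "Pow S"])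
  moreover have "{} \<in> {T. P T}" by (simp add: P_def)
  ultimately obtain T where T: "P T" and max: "\<And>T'. P T' \<Longrightarrow> T \<subseteq> T' \<Longrightarrow> T = T'"
    using finite_has_maximal[of "{T. P T}"] by auto
  have TS: "T \<subseteq> S" "finite T" "T \<subseteq> carrier R" using T S by (auto simp: P_def intro: finite_subset)
  have "card T * card U = card ((\<lambda>(t, u). t \<ominus> u) ` (T \<times> U))"
    using T by (simp add: P_def card_image card_cartesian_product)
  also have "\<dots> \<le> card (diffset S U)" using TS U S by (intro card_mono) (auto simp: diffset_def intro!: finite_diffset[unfolded diffset_def])
  finally have "real (card T) * card U \<le> \<kappa> * card U" using \<kappa> by (metis of_nat_le_iff of_nat_mult order_trans)
  moreover have "card U > 0" using U by (simp add: card_gt_0_iff)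
  ultimately have cT: "real (card T) \<le> \<kappa>" by simp
  have Uc: "U \<subseteq> carrier R" using U A by auto
  have key: "t \<oplus> (\<zero> \<ominus> (u' \<ominus> u)) \<in> sumset T (multiple_diffset 1 A)" if "t \<in> T" "u \<in> U" "u' \<in> U" for t u u'
    using that U by (auto intro!: sumsetI diffsetI)
  have "x \<in> sumset T (multiple_diffset 1 A)" if x: "x \<in> S" for x
  proof (cases "x \<in> T")
    case True
    obtain u where u: "u \<in> U" using U by auto
    have "x \<in> carrier R" "u \<in> carrier R" using True TS u Uc by auto
    then have "x = x \<oplus> (\<zero> \<ominus> (u \<ominus> u))" by algebra
    then show ?thesis using key[OF True u u] by simp
  next
    case False
    then have "\<not> P (insert x T)" using max[of "insert x T"] by auto
    then have "\<not> inj_on (\<lambda>(t, u). t \<ominus> u) (insert x T \<times> U)" using x TS by (simp add: P_def)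
    then obtain t u t' u' where tu: "t \<in> insert x T" "t' \<in> insert x T" "u \<in> U" "u' \<in> U" "(t, u) \<noteq> (t', u')" "t \<ominus> u = t' \<ominus> u'"
      by (auto simp: inj_on_def)
    have inj: "inj_on (\<lambda>(t, u). t \<ominus> u) (T \<times> U)" using T by (simp add: P_def)
    have xc: "x \<in> carrier R" using x S by auto
    have step: "x \<in> sumset T (multiple_diffset 1 A)" if "s \<in> T" "w \<in> U" "w' \<in> U" "x \<ominus> w = s \<ominus> w'" for s w w'
    proof -
      have c: "s \<in> carrier R" "w \<in> carrier R" "w' \<in> carrier R" using that TS Uc by auto
      have "x = (x \<ominus> w) \<oplus> w" using c xc by algebra
      also have "\<dots> = s \<oplus> (\<zero> \<ominus> (w' \<ominus> w))" unfolding that(4) using c by algebra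
      finally show ?thesis using key[of s w w'] that by simp
    qed
    consider "t \<in> T" "t' \<in> T" | "t = x" "t' = x" | "t = x" "t' \<in> T" | "t \<in> T" "t' = x" using tu by auto
    then show ?thesis
    proof cases
      case 1
      then show ?thesis using inj tu by (auto simp: inj_on_def)
    next
      case 2
      have c: "u \<in> carrier R" "u' \<in> carrier R" using tu Uc by auto
      have "u = x \<ominus> (x \<ominus> u)" using c xc by algebra
      also have "x \<ominus> u = x \<ominus> u'" using tu 2 by simp
      also have "x \<ominus> (x \<ominus> u') = u'" using c xc by algebra
      finally show ?thesis using tu 2 by simp
    next
      case 3
      then show ?thesis using step tu by blast
    next
      case 4
      then show ?thesis using step[of t u' u] tu by simp
    qed
  qed
  then show ?thesis using cT TS unfolding covered_def by blast
qed

lemma covered_self: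
  assumes "A \<subseteq> carrier R" "A \<noteq> {}"
  shows "covered A 1 1 A"
proof -
  obtain a where a: "a \<in> A" using assms by auto
  have "x \<in> sumset {a} (multiple_diffset 1 A)" if x: "x \<in> A" for x
  proof -
    have "a \<in> carrier R" "x \<in> carrier R" using a x assms by auto
    then have "x = a \<oplus> (\<zero> \<ominus> (a \<ominus> x))" by algebra
    moreover have "\<zero> \<ominus> (a \<ominus> x) \<in> multiple_diffset 1 A" using a x by (auto simp: diffset_def)
    ultimately show ?thesis by (auto simp: sumset_def)
  qed
  then show ?thesis using a assms unfolding covered_def by (intro exI[of _ "{a}"]) auto
qed

text \<open>Each level subtracts one more copy of rA - rA, a difference of two sets covered at level
  1. So it multiplies the count by \<kappa>^2 and raises the level by 2.\<close>

lemma covered_dilate_multiple_diffset: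
  assumes A: "A \<subseteq> carrier R" and r: "r \<in> carrier R" "covered A \<kappa> 1 (dilate r A)"
  shows "covered A (\<kappa> ^ (2 * k)) (2 * k) (dilate r (multiple_diffset k A))"
proof (induction k)
  case 0
  then show ?case using r unfolding covered_def
    by (intro exI[of _ "{\<zero>}"]) (auto simp: sumset_def dilate_def)
next
  case (Suc k)
  have "dilate r (multiple_diffset (Suc k) A)
      \<subseteq> diffset (dilate r (multiple_diffset k A)) (diffset (dilate r A) (dilate r A))"
  proof
    fix z assume "z \<in> dilate r (multiple_diffset (Suc k) A)"
    then obtain x a b where z: "z = r \<otimes> (x \<ominus> (a \<ominus> b))" "x \<in> multiple_diffset k A" "a \<in> A" "b \<in> A"
      by (auto simp: dilate_def diffset_def)
    have c: "x \<in> carrier R" "a \<in> carrier R" "b \<in> carrier R" using z(2-4) multiple_diffset_closed[OF A] A by blast+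
    have "z = r \<otimes> x \<ominus> (r \<otimes> a \<ominus> r \<otimes> b)" unfolding z using c r by algebra
    then show "z \<in> diffset (dilate r (multiple_diffset k A)) (diffset (dilate r A) (dilate r A))"
      using z(2-4) by (simp add: dilateI diffsetI)
  qed
  moreover have "covered A (\<kappa> ^ (2 * k) * (\<kappa> * \<kappa>)) (2 * k + (1 + 1))
      (diffset (dilate r (multiple_diffset k A)) (diffset (dilate r A) (dilate r A)))"
    using Suc r A by (intro covered_diffset) auto
  ultimately show ?case using covered_subset by (simp add: mult_ac)
qed

text \<open>A translate t + D dilates to rt + rD, so the centres are dilated and the cover of rD is
  inserted at each of them.\<close>

lemma covered_dilate:
  assumes A: "A \<subseteq> carrier R" and r: "r \<in> carrier R" "covered A \<kappa> 1 (dilate r A)"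
    and S: "covered A \<kappa>' k S"
  shows "covered A (\<kappa>' * \<kappa> ^ (2 * k)) (2 * k) (dilate r S)"
proof -
  obtain T where T: "finite T" "T \<subseteq> carrier R" "real (card T) \<le> \<kappa>'" "S \<subseteq> sumset T (multiple_diffset k A)"
    using S by (auto simp: covered_def)
  obtain T' where T': "finite T'" "T' \<subseteq> carrier R" "real (card T') \<le> \<kappa> ^ (2 * k)"
    "dilate r (multiple_diffset k A) \<subseteq> sumset T' (multiple_diffset (2 * k) A)"
    using covered_dilate_multiple_diffset[OF A r, of k] by (auto simp: covered_def)
  let ?T = "sumset (dilate r T) T'"
  have "card ?T \<le> card (dilate r T) * card T'" using T T' by (intro card_sumset_le) auto
  also have "\<dots> \<le> card T * card T'" unfolding dilate_def using T by (intro mult_right_mono card_image_le) auto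
  finally have "real (card ?T) \<le> real (card T) * real (card T')" by (metis of_nat_le_iff of_nat_mult)
  also have "\<dots> \<le> \<kappa>' * \<kappa> ^ (2 * k)" using T T' covered_nonneg[OF S] by (intro mult_mono) auto
  finally have c: "real (card ?T) \<le> \<kappa>' * \<kappa> ^ (2 * k)" .
  have "dilate r S \<subseteq> sumset ?T (multiple_diffset (2 * k) A)"
  proof
    fix z assume "z \<in> dilate r S"
    then obtain s where s: "s \<in> S" "z = r \<otimes> s" by (auto simp: dilate_def)
    then have "s \<in> sumset T (multiple_diffset k A)" using T by auto
    then obtain t d where t: "s = t \<oplus> d" "t \<in> T" "d \<in> multiple_diffset k A" by (auto simp: sumset_def)
    then have "r \<otimes> d \<in> sumset T' (multiple_diffset (2 * k) A)" using T' by (auto simp: dilate_def)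
    then obtain t' e where e: "r \<otimes> d = t' \<oplus> e" "t' \<in> T'" "e \<in> multiple_diffset (2 * k) A" by (auto simp: sumset_def)
    have cc: "t \<in> carrier R" "d \<in> carrier R" "t' \<in> carrier R" "e \<in> carrier R"
      using t(2,3) e(2,3) T(2) T'(2) multiple_diffset_closed[OF A] by blast+
    have "z = r \<otimes> t \<oplus> r \<otimes> d" unfolding s(2) t(1) using cc r by algebra
    also have "\<dots> = r \<otimes> t \<oplus> t' \<oplus> e" unfolding e(1) using cc r by algebra
    finally show "z \<in> sumset ?T (multiple_diffset (2 * k) A)"
      using t(2) e(2,3) by (simp add: sumsetI dilateI)
  qed
  then show ?thesis unfolding covered_def using c T T' r by (intro exI[of _ ?T]) auto
qed

text \<open>An element \<xi> lies outside this set exactly when (u, v) |-> u + v \<xi> is injective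
  on L x L. This dichotomy forces the closure properties below.\<close>

definition difference_quotients :: "'a set \<Rightarrow> 'a set" where
  "difference_quotients L = {(a \<ominus> b) \<otimes> inv (c \<ominus> d) | a b c d. a \<in> L \<and> b \<in> L \<and> c \<in> L \<and> d \<in> L \<and> c \<noteq> d}"

lemma minus_eq_zero_iff: "x \<in> carrier R \<Longrightarrow> y \<in> carrier R \<Longrightarrow> x \<ominus> y = \<zero> \<longleftrightarrow> x = y"
  by (metis a_minus_def minus_equality minus_minus r_neg a_inv_closed a_comm)

lemma field_inv_closed [simp]: "x \<in> carrier R \<Longrightarrow> x \<noteq> \<zero> \<Longrightarrow> inv x \<in> carrier R"
  and field_inv_mult [simp]: "x \<in> carrier R \<Longrightarrow> x \<noteq> \<zero> \<Longrightarrow> x \<otimes> inv x = \<one>" "x \<in> carrier R \<Longrightarrow> x \<noteq> \<zero> \<Longrightarrow> inv x \<otimes> x = \<one>"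
  by (simp_all add: field_Units)

lemma inv_nonzero: "x \<in> carrier R \<Longrightarrow> x \<noteq> \<zero> \<Longrightarrow> inv x \<noteq> \<zero>"
  by (metis field_inv_mult(1) r_null zero_not_one)

text \<open>Dilating by c - d preserves cardinality and clears the denominator: the result lies in
  (cA - dA) - (aA - bA). Four covered dilates at level 1 give \<kappa>^4 and level 4, hence
  K^8.\<close>

lemma quotient_dilate_bound:
  fixes K :: real
  assumes A: "finite A" "A \<noteq> {}" "A \<subseteq> carrier R" and K: "real (card (diffset A A)) \<le> K * card A"
    and cl: "a \<in> carrier R" "b \<in> carrier R" "c \<in> carrier R" "d \<in> carrier R" "c \<noteq> d"
    and cov: "covered A \<kappa> 1 (dilate a A)" "covered A \<kappa> 1 (dilate b A)"
      "covered A \<kappa> 1 (dilate c A)" "covered A \<kappa> 1 (dilate d A)"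
  shows "real (card (diffset A (dilate ((a \<ominus> b) \<otimes> inv (c \<ominus> d)) A))) \<le> \<kappa> ^ 4 * K ^ 8 * card A"
proof -
  define i where "i = inv (c \<ominus> d)"
  have nz: "c \<ominus> d \<noteq> \<zero>" using cl by (simp add: minus_eq_zero_iff)
  then have i: "i \<in> carrier R" "(c \<ominus> d) \<otimes> i = \<one>" using cl by (auto simp: i_def)
  let ?D = "diffset A (dilate ((a \<ominus> b) \<otimes> i) A)"
  let ?E = "diffset (diffset (dilate c A) (dilate d A)) (diffset (dilate a A) (dilate b A))"
  have D: "?D \<subseteq> carrier R" using A cl i by auto
  have "dilate (c \<ominus> d) ?D \<subseteq> ?E"
  proof
    fix z assume "z \<in> dilate (c \<ominus> d) ?D"
    then obtain x y where z: "z = (c \<ominus> d) \<otimes> (x \<ominus> (a \<ominus> b) \<otimes> i \<otimes> y)" "x \<in> A" "y \<in> A"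
      by (auto simp: dilate_def diffset_def)
    then have c': "x \<in> carrier R" "y \<in> carrier R" using A by auto
    have "z = (c \<ominus> d) \<otimes> x \<ominus> ((c \<ominus> d) \<otimes> i) \<otimes> ((a \<ominus> b) \<otimes> y)"
      unfolding z using c' cl i(1) by algebra
    also have "\<dots> = (c \<otimes> x \<ominus> d \<otimes> x) \<ominus> (a \<otimes> y \<ominus> b \<otimes> y)"
      unfolding i(2) using c' cl by algebra
    finally show "z \<in> ?E" using z(2,3) by (simp add: diffsetI dilateI)
  qed
  then have "card (dilate (c \<ominus> d) ?D) \<le> card ?E" using A by (intro card_mono) auto
  then have "card ?D \<le> card ?E" using card_dilate[OF _ nz D] cl by simp
  also have "covered A ((\<kappa> * \<kappa>) * (\<kappa> * \<kappa>)) ((1 + 1) + (1 + 1)) ?E"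
    using A cov by (intro covered_diffset) auto
  from card_covered[OF A K this] have "real (card ?E) \<le> \<kappa> ^ 4 * K ^ 8 * card A"
    by (simp add: power4_eq_xxxx mult.assoc)
  finally show ?thesis by (simp add: i_def)
qed

text \<open>Split the dilate as A - uA - vA - v(rA). The levels are 1, 1, 1 and 2, hence K^10; the
  doubly dilated term contributes \<kappa>' \<kappa>^2.\<close>

lemma succ_dilate_bound:
  fixes K :: real
  assumes A: "finite A" "A \<noteq> {}" "A \<subseteq> carrier R" and K: "real (card (diffset A A)) \<le> K * card A"
    and cl: "u \<in> carrier R" "v \<in> carrier R" "r \<in> carrier R"
    and cov: "covered A \<kappa> 1 (dilate u A)" "covered A \<kappa> 1 (dilate v A)" "covered A \<kappa>' 1 (dilate r A)"
  shows "real (card (diffset A (dilate (u \<oplus> v \<otimes> (\<one> \<oplus> r)) A))) \<le> \<kappa> ^ 4 * \<kappa>' * K ^ 10 * card A"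
proof -
  let ?E = "diffset (diffset (diffset A (dilate u A)) (dilate v A)) (dilate v (dilate r A))"
  have "diffset A (dilate (u \<oplus> v \<otimes> (\<one> \<oplus> r)) A) \<subseteq> ?E"
  proof
    fix z assume "z \<in> diffset A (dilate (u \<oplus> v \<otimes> (\<one> \<oplus> r)) A)"
    then obtain x y where z: "z = x \<ominus> (u \<oplus> v \<otimes> (\<one> \<oplus> r)) \<otimes> y" "x \<in> A" "y \<in> A"
      by (auto simp: dilate_def diffset_def)
    then have c: "x \<in> carrier R" "y \<in> carrier R" using A by auto
    have "z = ((x \<ominus> u \<otimes> y) \<ominus> v \<otimes> y) \<ominus> v \<otimes> (r \<otimes> y)" unfolding z using c cl by algebra
    then show "z \<in> ?E" using z(2,3) by (simp add: diffsetI dilateI)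
  qed
  moreover have "covered A (((1 * \<kappa>) * \<kappa>) * (\<kappa>' * \<kappa> ^ (2 * 1))) (((1 + 1) + 1) + 2 * 1) ?E"
    using A cl cov by (intro covered_diffset covered_dilate covered_self) auto
  moreover have "((1 * \<kappa>) * \<kappa>) * (\<kappa>' * \<kappa> ^ (2 * 1)) = \<kappa> ^ 4 * \<kappa>'" "((1 + 1) + 1) + 2 * 1 = (5::nat)"
    by (simp_all add: eval_nat_numeral mult_ac)
  ultimately have "covered A (\<kappa> ^ 4 * \<kappa>') 5 (diffset A (dilate (u \<oplus> v \<otimes> (\<one> \<oplus> r)) A))"
    using covered_subset by metis
  from card_covered[OF A K this] show ?thesis by simp
qed

text \<open>Here the last term is v(w(rA)), at level 4 and with count \<kappa>' \<kappa>^2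
  \<kappa>^4. Together with A - uA the level is 6, hence K^12.\<close>

lemma mult_dilate_bound:
  fixes K :: real
  assumes A: "finite A" "A \<noteq> {}" "A \<subseteq> carrier R" and K: "real (card (diffset A A)) \<le> K * card A"
    and cl: "u \<in> carrier R" "v \<in> carrier R" "w \<in> carrier R" "r \<in> carrier R"
    and cov: "covered A \<kappa> 1 (dilate u A)" "covered A \<kappa> 1 (dilate v A)"
      "covered A \<kappa> 1 (dilate w A)" "covered A \<kappa>' 1 (dilate r A)"
  shows "real (card (diffset A (dilate (u \<oplus> v \<otimes> (w \<otimes> r)) A))) \<le> \<kappa> ^ 7 * \<kappa>' * K ^ 12 * card A"
proof -
  let ?E = "diffset (diffset A (dilate u A)) (dilate v (dilate w (dilate r A)))"
  have "diffset A (dilate (u \<oplus> v \<otimes> (w \<otimes> r)) A) \<subseteq> ?E"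
  proof
    fix z assume "z \<in> diffset A (dilate (u \<oplus> v \<otimes> (w \<otimes> r)) A)"
    then obtain x y where z: "z = x \<ominus> (u \<oplus> v \<otimes> (w \<otimes> r)) \<otimes> y" "x \<in> A" "y \<in> A"
      by (auto simp: dilate_def diffset_def)
    then have c: "x \<in> carrier R" "y \<in> carrier R" using A by auto
    have "z = (x \<ominus> u \<otimes> y) \<ominus> v \<otimes> (w \<otimes> (r \<otimes> y))" unfolding z using c cl by algebra
    then show "z \<in> ?E" using z(2,3) by (simp add: diffsetI dilateI)
  qed
  moreover have "covered A ((1 * \<kappa>) * ((\<kappa>' * \<kappa> ^ (2 * 1)) * \<kappa> ^ (2 * (2 * 1)))) ((1 + 1) + 2 * (2 * 1)) ?E"
    using A cl cov by (intro covered_diffset covered_dilate covered_self) auto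
  moreover have "(1 * \<kappa>) * ((\<kappa>' * \<kappa> ^ (2 * 1)) * \<kappa> ^ (2 * (2 * 1))) = \<kappa> ^ 7 * \<kappa>'" "(1 + 1) + 2 * (2 * 1) = (6::nat)"
    by (simp_all add: eval_nat_numeral mult_ac)
  ultimately have "covered A (\<kappa> ^ 7 * \<kappa>') 6 (diffset A (dilate (u \<oplus> v \<otimes> (w \<otimes> r)) A))"
    using covered_subset by metis
  from card_covered[OF A K this] show ?thesis by simp
qed

text \<open>Let a = |A|. If |A - tA| <= W, the map (x, y) |-> x - ty has at least a^4 / W colliding
  pairs. At most a^2 of them have equal y, which is at most half because 2W <= a^2. A collision with
  y and y' distinct determines t, so the remaining collisions of different t are disjoint, and all
  of them live among a^4 pairs.\<close>

lemma card_small_dilates: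
  assumes A: "finite A" "A \<noteq> {}" "A \<subseteq> carrier R"
    and T: "finite T" "T \<subseteq> carrier R" "\<And>t. t \<in> T \<Longrightarrow> real (card (diffset A (dilate t A))) \<le> W"
    and W: "0 \<le> W" "2 * W \<le> (real (card A))\<^sup>2"
  shows "real (card T) \<le> 2 * W"
proof (cases "T = {}")
  case True
  then show ?thesis using W by simp
next
  case False
  define a where "a = real (card A)"
  have a: "a > 0" using A by (simp add: a_def card_gt_0_iff)
  have Wpos: "W > 0"
  proof -
    obtain t where t: "t \<in> T" using False by auto
    obtain x where "x \<in> A" using A by auto
    then have "diffset A (dilate t A) \<noteq> {}" using diffsetI dilateI by blast
    then have "card (diffset A (dilate t A)) > 0" using A by (simp add: card_gt_0_iff)
    then show ?thesis using T(3)[OF t] by linarith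
  qed
  let ?f = "\<lambda>t (x, y). x \<ominus> t \<otimes> y"
  define E where "E t = {(p, q) \<in> (A \<times> A) \<times> (A \<times> A). ?f t p = ?f t q}" for t
  define N where "N t = {(p, q) \<in> E t. snd p \<noteq> snd q}" for t
  have fE: "finite (E t)" for t unfolding E_def by (rule finite_subset[of _ "(A \<times> A) \<times> (A \<times> A)"]) (use A in auto)
  then have fN: "finite (N t)" for t by (rule finite_subset[rotated]) (auto simp: N_def)
  have low: "a ^ 4 / (2 * W) \<le> real (card (N t))" if t: "t \<in> T" for t
  proof -
    have tc: "t \<in> carrier R" using t T by auto
    have "(card (A \<times> A))\<^sup>2 \<le> card (diffset A (dilate t A)) * card (E t)"
      unfolding E_def using A
      by (intro card_collisions finite_diffset finite_dilate finite_cartesian_product) (auto intro!: diffsetI dilateI)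
    then have "real ((card (A \<times> A))\<^sup>2) \<le> real (card (diffset A (dilate t A)) * card (E t))" by (simp only: of_nat_le_iff)
    also have "\<dots> \<le> W * real (card (E t))" using T(3)[OF t] by (simp add: mult_right_mono)
    finally have 1: "a ^ 4 \<le> W * real (card (E t))" by (simp add: a_def card_cartesian_product power2_eq_square power4_eq_xxxx mult_ac)
    have "E t - N t \<subseteq> (\<lambda>p. (p, p)) ` (A \<times> A)"
    proof
      fix z assume "z \<in> E t - N t"
      then obtain x y x' where z: "z = ((x, y), (x', y))" "x \<in> A" "x' \<in> A" "y \<in> A" "x \<ominus> t \<otimes> y = x' \<ominus> t \<otimes> y"
        by (auto simp: E_def N_def)
      have c: "x \<in> carrier R" "x' \<in> carrier R" "y \<in> carrier R" using z A by auto
      have "x = (x \<ominus> t \<otimes> y) \<oplus> t \<otimes> y" using c tc by algebra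
      also have "\<dots> = x'" unfolding z(5) using c tc by algebra
      finally show "z \<in> (\<lambda>p. (p, p)) ` (A \<times> A)" using z by auto
    qed
    then have "card (E t - N t) \<le> card ((\<lambda>p. (p, p)) ` (A \<times> A))" using A by (intro card_mono) auto
    also have "\<dots> \<le> card (A \<times> A)" using A by (intro card_image_le) auto
    finally have "card (E t - N t) \<le> card A * card A" by (simp add: card_cartesian_product)
    moreover have "E t = (E t - N t) \<union> N t" by (auto simp: N_def)
    then have "card (E t) \<le> card (E t - N t) + card (N t)" by (metis card_Un_le)
    ultimately have "card (E t) \<le> card A * card A + card (N t)" by linarith
    then have "real (card (E t)) \<le> real (card A * card A + card (N t))" by (simp only: of_nat_le_iff)
    then have "real (card (E t)) \<le> a\<^sup>2 + real (card (N t))"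
      by (simp add: a_def power2_eq_square)
    then have "W * real (card (E t)) \<le> W * (a\<^sup>2 + real (card (N t)))" using Wpos by simp
    with 1 have "a ^ 4 \<le> W * a\<^sup>2 + W * real (card (N t))" by (simp add: distrib_left)
    moreover have "W * a\<^sup>2 \<le> a ^ 4 / 2"
      using mult_right_mono[OF W(2), of "a\<^sup>2"] by (simp add: a_def power2_eq_square power4_eq_xxxx mult_ac)
    ultimately show ?thesis using Wpos by (simp add: field_simps)
  qed
  have "disjoint_family_on N T"
  proof (unfold disjoint_family_on_def, intro ballI impI, rule ccontr)
    fix t t' assume t: "t \<in> T" "t' \<in> T" "t \<noteq> t'" and "N t \<inter> N t' \<noteq> {}"
    then obtain x y x' y' where z: "((x, y), (x', y')) \<in> N t" "((x, y), (x', y')) \<in> N t'" by auto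
    then have c: "x \<in> carrier R" "y \<in> carrier R" "x' \<in> carrier R" "y' \<in> carrier R" "t \<in> carrier R" "t' \<in> carrier R"
      and e: "x \<ominus> t \<otimes> y = x' \<ominus> t \<otimes> y'" "x \<ominus> t' \<otimes> y = x' \<ominus> t' \<otimes> y'" "y \<noteq> y'"
      using A T t by (auto simp: N_def E_def)
    have "(t \<ominus> t') \<otimes> (y \<ominus> y') = ((x \<ominus> t' \<otimes> y) \<ominus> (x \<ominus> t \<otimes> y)) \<ominus> ((x' \<ominus> t' \<otimes> y') \<ominus> (x' \<ominus> t \<otimes> y'))"
      using c by algebra
    also have "\<dots> = \<zero>" unfolding e(1,2) using c by algebra
    finally show False using c e t by (auto simp: integral_iff minus_eq_zero_iff)
  qed
  then have "card (\<Union>t\<in>T. N t) = (\<Sum>t\<in>T. card (N t))"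
    using T fN by (intro card_UN_disjoint) (auto simp: disjoint_family_on_def)
  moreover have "card (\<Union>t\<in>T. N t) \<le> card ((A \<times> A) \<times> (A \<times> A))"
    using A by (intro card_mono) (auto simp: N_def E_def)
  ultimately have "(\<Sum>t\<in>T. card (N t)) \<le> card ((A \<times> A) \<times> (A \<times> A))" by simp
  then have "real (\<Sum>t\<in>T. card (N t)) \<le> real (card ((A \<times> A) \<times> (A \<times> A)))" by (simp only: of_nat_le_iff)
  then have "(\<Sum>t\<in>T. real (card (N t))) \<le> a ^ 4" by (simp add: a_def card_cartesian_product power4_eq_xxxx mult_ac)
  moreover have "real (card T) * (a ^ 4 / (2 * W)) \<le> (\<Sum>t\<in>T. real (card (N t)))"
    using sum_bounded_below[of T "a ^ 4 / (2 * W)" "\<lambda>t. real (card (N t))"] low by auto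
  ultimately have "real (card T) * (a ^ 4 / (2 * W)) \<le> a ^ 4" by linarith
  then have "a ^ 4 * real (card T) \<le> a ^ 4 * (2 * W)" using Wpos by (simp add: field_simps)
  then show ?thesis using a by simp
qed

section \<open>Sets with many almost invariant dilates\<close>

lemma difference_quotients_closed: "L \<subseteq> carrier R \<Longrightarrow> difference_quotients L \<subseteq> carrier R"
  unfolding difference_quotients_def by (auto simp: minus_eq_zero_iff subset_iff)

lemma difference_quotientsI:
  "\<lbrakk>a \<in> L; b \<in> L; c \<in> L; d \<in> L; c \<noteq> d\<rbrakk> \<Longrightarrow> (a \<ominus> b) \<otimes> inv (c \<ominus> d) \<in> difference_quotients L"
  unfolding difference_quotients_def by blast

lemma difference_quotientsE:
  assumes "r \<in> difference_quotients L"
  obtains a b c d where "a \<in> L" "b \<in> L" "c \<in> L" "d \<in> L" "c \<noteq> d" "r = (a \<ominus> b) \<otimes> inv (c \<ominus> d)"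
  using assms unfolding difference_quotients_def by blast

text \<open>The stabilizer \<open>H\<close> of the set of quotients under translation is a subring containing \<open>L\<close>, on
  which multiplication by any nonzero difference of \<open>L\<close> is injective and hence, by finiteness, surjective.
  So \<open>H\<close> is closed under multiplication by quotients and coincides with the set of quotients.\<close>

lemma subfield_difference_quotients:
  assumes fin: "finite (carrier R)" and L: "L \<subseteq> carrier R" "\<zero> \<in> L" "\<one> \<in> L"
    and succ: "\<And>r. r \<in> difference_quotients L \<Longrightarrow> \<one> \<oplus> r \<in> difference_quotients L"
    and mult: "\<And>w r. w \<in> L \<Longrightarrow> r \<in> difference_quotients L \<Longrightarrow> w \<otimes> r \<in> difference_quotients L"
  shows "subfield (difference_quotients L) R" and "L \<subseteq> difference_quotients L"
proof -
  define Q where "Q = difference_quotients L"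
  have Qc: "Q \<subseteq> carrier R" using L difference_quotients_closed by (simp add: Q_def)
  have fQ: "finite Q" using fin Qc finite_subset by blast
  have zQ: "\<zero> \<in> Q"
    using difference_quotientsI[of \<zero> L \<zero> \<one> \<zero>] L by (simp add: Q_def a_minus_def)
  have surj: "\<exists>y\<in>S. k \<otimes> y = x" if "S \<subseteq> Q" "\<And>x. x \<in> S \<Longrightarrow> k \<otimes> x \<in> S" "k \<in> carrier R" "k \<noteq> \<zero>" "x \<in> S" for S k x
  proof -
    have "inj_on (\<lambda>x. k \<otimes> x) S" using that Qc by (intro inj_onI) (auto simp: m_lcancel subset_iff)
    moreover have "(\<lambda>x. k \<otimes> x) ` S \<subseteq> S" using that by auto
    moreover have "finite S" using that fQ finite_subset by blast
    ultimately have "(\<lambda>x. k \<otimes> x) ` S = S" using endo_inj_surj by blast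
    then show ?thesis using that by (metis imageE)
  qed
  define H where "H = {h \<in> carrier R. \<forall>r\<in>Q. r \<oplus> h \<in> Q}"
  have Hc: "H \<subseteq> carrier R" by (auto simp: H_def)
  have HQ: "H \<subseteq> Q"
  proof
    fix h assume h: "h \<in> H"
    then have "\<zero> \<oplus> h \<in> Q" using zQ by (auto simp: H_def)
    then show "h \<in> Q" using h Hc by auto
  qed
  have H_add: "h \<oplus> h' \<in> H" if h: "h \<in> H" "h' \<in> H" for h h'
  proof -
    have "r \<oplus> (h \<oplus> h') \<in> Q" if r: "r \<in> Q" for r
    proof -
      have "(r \<oplus> h) \<oplus> h' \<in> Q" using h r by (auto simp: H_def)
      then show ?thesis using h r Qc Hc by (simp add: a_assoc subset_iff)
    qed
    then show ?thesis using h by (simp add: H_def)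
  qed
  have H_neg: "\<ominus> h \<in> H" if h: "h \<in> H" for h
  proof -
    have hc: "h \<in> carrier R" using h Hc by auto
    have "inj_on (\<lambda>r. r \<oplus> h) Q" using hc Qc by (intro inj_onI) (auto simp: subset_iff)
    moreover have "(\<lambda>r. r \<oplus> h) ` Q \<subseteq> Q" using h by (auto simp: H_def)
    ultimately have im: "(\<lambda>r. r \<oplus> h) ` Q = Q" using endo_inj_surj fQ by blast
    have "r \<oplus> \<ominus> h \<in> Q" if r: "r \<in> Q" for r
    proof -
      obtain r' where r': "r' \<in> Q" "r = r' \<oplus> h" using im r by blast
      have "r' \<in> carrier R" using r' Qc by auto
      then have "r \<oplus> \<ominus> h = r'" unfolding r'(2) using hc by algebra
      then show ?thesis using r' by simp
    qed
    then show ?thesis using hc by (simp add: H_def)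
  qed
  have H_mult: "w \<otimes> h \<in> H" if w: "w \<in> L" and h: "h \<in> H" for w h
  proof -
    have c: "w \<in> carrier R" "h \<in> carrier R" using w h L Hc by auto
    have "r \<oplus> w \<otimes> h \<in> Q" if r: "r \<in> Q" for r
    proof (cases "w = \<zero>")
      case True
      then show ?thesis using r c Qc by (auto simp: subset_iff)
    next
      case False
      \<comment> \<open>Multiplication by \<open>w\<close> permutes the finite set \<open>Q\<close>,
        so \<open>r\<close> can be divided by \<open>w\<close> inside \<open>Q\<close>, and r + wh
        becomes w(r' + h).\<close>
      obtain r' where r': "r' \<in> Q" "w \<otimes> r' = r"
        using surj[of Q w r] mult w c False r by (auto simp: Q_def)
      have "r' \<in> carrier R" using r' Qc by auto
      then have "r \<oplus> w \<otimes> h = w \<otimes> (r' \<oplus> h)" unfolding r'(2)[symmetric] using c by algebra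
      then show ?thesis using mult[of w "r' \<oplus> h"] w h r' by (simp add: Q_def H_def)
    qed
    then show ?thesis using c by (simp add: H_def)
  qed
  have LH: "L \<subseteq> H"
  proof
    fix w assume w: "w \<in> L"
    have "\<one> \<in> H"
    proof -
      have "r \<oplus> \<one> \<in> Q" if "r \<in> Q" for r
      proof -
        have "r \<in> carrier R" using that Qc by auto
        then have "r \<oplus> \<one> = \<one> \<oplus> r" by algebra
        then show ?thesis using succ that by (simp add: Q_def)
      qed
      then show ?thesis by (simp add: H_def)
    qed
    from H_mult[OF w this] show "w \<in> H" using w L by auto
  qed
  have H_diff_mult: "(a \<ominus> b) \<otimes> h \<in> H" if "a \<in> L" "b \<in> L" "h \<in> H" for a b h
  proof -
    have c: "a \<in> carrier R" "b \<in> carrier R" "h \<in> carrier R" using that L Hc by auto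
    have "(a \<ominus> b) \<otimes> h = a \<otimes> h \<oplus> \<ominus> (b \<otimes> h)" using c by algebra
    then show ?thesis using that H_mult H_add H_neg by simp
  qed
  have H_Q_mult: "r \<otimes> h \<in> H" if "r \<in> Q" and h: "h \<in> H" for r h
  proof -
    from that(1) obtain a b c d where r: "a \<in> L" "b \<in> L" "c \<in> L" "d \<in> L" "c \<noteq> d" "r = (a \<ominus> b) \<otimes> inv (c \<ominus> d)"
      unfolding Q_def by (rule difference_quotientsE)
    have cl: "a \<in> carrier R" "b \<in> carrier R" "c \<in> carrier R" "d \<in> carrier R" "h \<in> carrier R"
      using r L h Hc by auto
    have nz: "c \<ominus> d \<noteq> \<zero>" using cl r by (simp add: minus_eq_zero_iff)
    obtain h' where h': "h' \<in> H" "(c \<ominus> d) \<otimes> h' = h"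
      using surj[of H "c \<ominus> d" h] HQ H_diff_mult r cl nz h by auto
    have h'c: "h' \<in> carrier R" using h' Hc by auto
    have ic: "inv (c \<ominus> d) \<in> carrier R" "(c \<ominus> d) \<otimes> inv (c \<ominus> d) = \<one>" using cl nz by auto
    have "r \<otimes> h = (a \<ominus> b) \<otimes> (((c \<ominus> d) \<otimes> inv (c \<ominus> d)) \<otimes> h')"
      unfolding r(6) h'(2)[symmetric] using cl h'c ic(1) by algebra
    also have "\<dots> = (a \<ominus> b) \<otimes> h'" unfolding ic(2) using cl h'c by simp
    finally show ?thesis using H_diff_mult r h' by simp
  qed
  have QH: "Q = H"
  proof
    show "Q \<subseteq> H"
    proof
      fix r assume r: "r \<in> Q"
      then have "r \<otimes> \<one> \<in> H" using LH L H_Q_mult by blast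
      then show "r \<in> H" using r Qc by auto
    qed
  qed (rule HQ)
  have "subring Q R"
    by (rule subringI) (use Qc LH L QH H_neg H_Q_mult H_add in auto)
  moreover have "inv k \<in> Q" if "k \<in> Q - {\<zero>}" for k
  proof -
    from that have "k \<in> difference_quotients L" "k \<noteq> \<zero>" by (auto simp: Q_def)
    then obtain a b c d where r: "a \<in> L" "b \<in> L" "c \<in> L" "d \<in> L" "c \<noteq> d" "k = (a \<ominus> b) \<otimes> inv (c \<ominus> d)"
      using difference_quotientsE by metis
    have cl: "a \<in> carrier R" "b \<in> carrier R" "c \<in> carrier R" "d \<in> carrier R" using r L by auto
    have nz: "c \<ominus> d \<noteq> \<zero>" using cl r by (simp add: minus_eq_zero_iff)
    have ic: "inv (c \<ominus> d) \<in> carrier R" "inv (c \<ominus> d) \<otimes> (c \<ominus> d) = \<one>" using cl nz by auto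
    have "a \<noteq> b"
    proof
      assume "a = b"
      then have "k = \<zero>" unfolding r(6) using cl ic(1) by (simp add: a_minus_def r_neg)
      with \<open>k \<noteq> \<zero>\<close> show False by simp
    qed
    then have nz': "a \<ominus> b \<noteq> \<zero>" using cl by (simp add: minus_eq_zero_iff)
    have ia: "inv (a \<ominus> b) \<in> carrier R" "(a \<ominus> b) \<otimes> inv (a \<ominus> b) = \<one>" using cl nz' by auto
    have "k \<otimes> ((c \<ominus> d) \<otimes> inv (a \<ominus> b)) = ((a \<ominus> b) \<otimes> inv (a \<ominus> b)) \<otimes> (inv (c \<ominus> d) \<otimes> (c \<ominus> d))"
      unfolding r(6) using cl ia(1) ic(1) by algebra
    also have "\<dots> = \<one>" unfolding ia ic by simp
    finally have "inv k = (c \<ominus> d) \<otimes> inv (a \<ominus> b)"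
      using cl ia ic that Qc by (intro comm_inv_char) (auto simp: subset_iff)
    then show ?thesis using difference_quotientsI r \<open>a \<noteq> b\<close> by (simp add: Q_def)
  qed
  ultimately show "subfield (difference_quotients L) R" unfolding Q_def by (rule subfieldI')
  show "L \<subseteq> difference_quotients L" using LH HQ by (auto simp: Q_def)
qed

text \<open>Adjoin zero to \<Lambda> and let Q be the set of difference quotients. Every r in Q has
  a small set A - rA. If 1 + r or wr left Q, the elements u + v(1 + r) or u + v(wr) would be more
  than |\<Lambda>|^2 - 1 different numbers, all with small dilates, against
  \<open>card_small_dilates\<close>. So Q is closed and thus a subfield, and the same count bounds
  its order. The first size condition makes the count applicable, the second yields the
  contradiction.\<close>

theorem contained_in_small_subfield:
  fixes K \<kappa> :: real
  assumes fin: "finite (carrier R)" and A: "A \<noteq> {}" "A \<subseteq> carrier R" and \<Lambda>: "\<Lambda> \<subseteq> carrier R" "\<one> \<in> \<Lambda>"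
    and K: "1 \<le> K" "real (card (diffset A A)) \<le> K * card A"
    and \<kappa>: "1 \<le> \<kappa>" "\<And>r. r \<in> \<Lambda> \<Longrightarrow> real (card (diffset A A)) \<le> \<kappa> * card (A \<inter> dilate r A)"
    and size: "2 * \<kappa> ^ 11 * K ^ 20 \<le> card A" "2 * \<kappa> ^ 11 * K ^ 20 * card A < (real (card \<Lambda>))\<^sup>2"
  obtains G where "subfield G R" "\<Lambda> \<subseteq> G" "real (card G) \<le> 2 * \<kappa> ^ 4 * K ^ 8 * card A"
proof -
  have fA: "finite A" using A fin finite_subset by blast
  define L where "L = insert \<zero> \<Lambda>"
  have L: "L \<subseteq> carrier R" "\<zero> \<in> L" "\<one> \<in> L" "finite L" using \<Lambda> fin by (auto simp: L_def intro: finite_subset)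
  define Q where "Q = difference_quotients L"
  \<comment> \<open>The bound of the more expensive closure case: \<kappa>^7 \<kappa>' K^12 with
    \<kappa>' = \<kappa>^4 K^8, whence the exponents 11 and 20.\<close>
  define W where "W = \<kappa> ^ 11 * K ^ 20 * card A"
  define \<kappa>' where "\<kappa>' = \<kappa> ^ 4 * K ^ 8"
  have a1: "card A > 0" using fA A by (simp add: card_gt_0_iff)
  have k1: "0 \<le> \<kappa>'" using K \<kappa> by (simp add: \<kappa>'_def)
  have W2: "2 * W \<le> (real (card A))\<^sup>2" "0 \<le> W"
    using mult_right_mono[OF size(1), of "real (card A)"] K \<kappa> by (simp_all add: W_def power2_eq_square mult_ac)
  have covL: "covered A \<kappa> 1 (dilate w A)" if w: "w \<in> L" for w
  proof (cases "w \<in> \<Lambda>")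
    case True
    have wc: "w \<in> carrier R" using w L by auto
    \<comment> \<open>The intersection is the test set of the covering lemma. It lies in A, as that
      lemma demands, and also in wA, so the difference stays in w(A - A) and is no larger than A -
      A.\<close>
    have "diffset (dilate w A) (A \<inter> dilate w A) \<subseteq> dilate w (diffset A A)"
    proof
      fix z assume "z \<in> diffset (dilate w A) (A \<inter> dilate w A)"
      then obtain x y where z: "z = w \<otimes> x \<ominus> w \<otimes> y" "x \<in> A" "y \<in> A" by (auto simp: diffset_def dilate_def)
      have "x \<in> carrier R" "y \<in> carrier R" using z A by auto
      then have "z = w \<otimes> (x \<ominus> y)" unfolding z using wc by algebra
      then show "z \<in> dilate w (diffset A A)" using z by (simp add: diffsetI dilateI)
    qed
    then have "card (diffset (dilate w A) (A \<inter> dilate w A)) \<le> card (dilate w (diffset A A))"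
      using fA by (intro card_mono) auto
    also have "\<dots> \<le> card (diffset A A)" unfolding dilate_def using fA by (intro card_image_le) auto
    finally have "real (card (diffset (dilate w A) (A \<inter> dilate w A))) \<le> \<kappa> * card (A \<inter> dilate w A)"
      using \<kappa>(2)[OF True] by linarith
    moreover have "A \<inter> dilate w A \<noteq> {}"
    proof
      assume "A \<inter> dilate w A = {}"
      then have "card (diffset A A) = 0" using \<kappa>(2)[OF True] by simp
      then have "diffset A A = {}" using fA by simp
      then show False using A diffsetI by blast
    qed
    ultimately show ?thesis
      by (intro ruzsa_covering[of A "dilate w A" "A \<inter> dilate w A"]) (use A fA wc in auto)
  next
    case False
    then have "w = \<zero>" using w by (simp add: L_def)
    have "\<exists>x. x \<in> A" using A by auto
    then obtain x where x: "x \<in> A" by blast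
    then have "x \<in> carrier R" using A by auto
    then have e: "\<zero> = \<zero> \<oplus> (\<zero> \<ominus> (x \<ominus> x))" by algebra
    have "\<zero> \<oplus> (\<zero> \<ominus> (x \<ominus> x)) \<in> sumset {\<zero>} (multiple_diffset 1 A)"
      using x by (intro sumsetI) (auto intro!: diffsetI)
    then have "dilate w A \<subseteq> sumset {\<zero>} (multiple_diffset 1 A)"
      using A e unfolding \<open>w = \<zero>\<close> by (auto simp: dilate_def)
    then show ?thesis unfolding covered_def using \<kappa>(1) by (intro exI[of _ "{\<zero>}"]) auto
  qed
  have Qc: "Q \<subseteq> carrier R" using L difference_quotients_closed by (simp add: Q_def)
  have small: "real (card (diffset A (dilate r A))) \<le> \<kappa>' * card A" if "r \<in> Q" for r
  proof -
    from that obtain a b c d where r: "a \<in> L" "b \<in> L" "c \<in> L" "d \<in> L" "c \<noteq> d" "r = (a \<ominus> b) \<otimes> inv (c \<ominus> d)"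
      unfolding Q_def by (rule difference_quotientsE)
    then show ?thesis using quotient_dilate_bound[OF fA A K(2), of a b c d \<kappa>] covL L by (auto simp: \<kappa>'_def subset_iff)
  qed
  have covQ: "covered A \<kappa>' 1 (dilate r A)" if r: "r \<in> Q" for r
  proof (rule ruzsa_covering)
    have rc: "r \<in> carrier R" using r Qc by auto
    then show "dilate r A \<subseteq> carrier R" using A by simp
    show "real (card (diffset (dilate r A) A)) \<le> \<kappa>' * card A"
      using small[OF r] card_diffset_swap[of A "dilate r A"] A rc by simp
  qed (use A fA in auto)
  have pow_le: "\<kappa> ^ i * K ^ j \<le> \<kappa> ^ 11 * K ^ 20" if "i \<le> 11" "j \<le> 20" for i j
    using K \<kappa> that by (intro mult_mono power_increasing) auto
  \<comment> \<open>Outside Q the map (u, v) |-> u + v \<xi> is injective on L x L, so T has |L|^2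
    elements. That exceeds the 2W allowed by \<open>card_small_dilates\<close>.\<close>
  have in_Q: "\<xi> \<in> Q" if \<xi>: "\<xi> \<in> carrier R"
    and bnd: "\<And>u v. u \<in> L \<Longrightarrow> v \<in> L \<Longrightarrow> real (card (diffset A (dilate (u \<oplus> v \<otimes> \<xi>) A))) \<le> W" for \<xi>
  proof (rule ccontr)
    assume nQ: "\<xi> \<notin> Q"
    define T where "T = (\<lambda>(u, v). u \<oplus> v \<otimes> \<xi>) ` (L \<times> L)"
    have "inj_on (\<lambda>(u, v). u \<oplus> v \<otimes> \<xi>) (L \<times> L)"
    proof (rule inj_onI, clarify)
      fix u v u' v' assume uv: "u \<in> L" "v \<in> L" "u' \<in> L" "v' \<in> L" and e: "u \<oplus> v \<otimes> \<xi> = u' \<oplus> v' \<otimes> \<xi>"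
      have c: "u \<in> carrier R" "v \<in> carrier R" "u' \<in> carrier R" "v' \<in> carrier R" using uv L by auto
      have 1: "(v' \<ominus> v) \<otimes> \<xi> = (u \<ominus> u') \<ominus> ((u \<oplus> v \<otimes> \<xi>) \<ominus> (u' \<oplus> v' \<otimes> \<xi>))" using c \<xi> by algebra
      have e1: "(v' \<ominus> v) \<otimes> \<xi> = u \<ominus> u'" unfolding 1 unfolding e using c \<xi> by algebra
      have "v = v'"
      proof (rule ccontr)
        assume ne: "v \<noteq> v'"
        then have nz: "v' \<ominus> v \<noteq> \<zero>" using c by (auto simp: minus_eq_zero_iff)
        then have i: "inv (v' \<ominus> v) \<in> carrier R" "(v' \<ominus> v) \<otimes> inv (v' \<ominus> v) = \<one>" using c by auto
        have "\<xi> = ((v' \<ominus> v) \<otimes> inv (v' \<ominus> v)) \<otimes> \<xi>" unfolding i(2) using \<xi> by simp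
        also have "\<dots> = ((v' \<ominus> v) \<otimes> \<xi>) \<otimes> inv (v' \<ominus> v)" using c \<xi> i(1) by algebra
        also have "\<dots> = (u \<ominus> u') \<otimes> inv (v' \<ominus> v)" unfolding e1 ..
        finally have "\<xi> \<in> Q" unfolding Q_def using difference_quotientsI uv ne by metis
        with nQ show False by simp
      qed
      moreover have "u = u'"
      proof -
        have "u \<ominus> u' = \<zero>" using e1 c \<xi> unfolding \<open>v = v'\<close> by (simp add: a_minus_def r_neg)
        then show ?thesis using c by (simp add: minus_eq_zero_iff)
      qed
      ultimately show "u = u' \<and> v = v'" by simp
    qed
    then have "card T = card L * card L" by (simp add: T_def card_image card_cartesian_product)
    moreover have "card \<Lambda> \<le> card L" using L by (intro card_mono) (auto simp: L_def)
    ultimately have "(card \<Lambda>)\<^sup>2 \<le> card T" by (simp add: power2_eq_square mult_mono)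
    then have 1: "(real (card \<Lambda>))\<^sup>2 \<le> real (card T)" by (metis of_nat_le_iff of_nat_power)
    have "real (card T) \<le> 2 * W"
    proof (rule card_small_dilates[OF fA A])
      show "finite T" using L by (auto simp: T_def)
      show "T \<subseteq> carrier R" using L(1) \<xi> by (auto simp: T_def subset_iff)
      show "real (card (diffset A (dilate t A))) \<le> W" if "t \<in> T" for t
        using that bnd by (auto simp: T_def)
    qed (use W2 in auto)
    moreover have "2 * W < (real (card \<Lambda>))\<^sup>2" using size(2) by (simp add: W_def mult.assoc)
    ultimately show False using 1 by linarith
  qed
  have W_ge: "\<kappa> ^ i * \<kappa>' * K ^ j * card A \<le> W" if "i \<le> 7" "j \<le> 12" for i j
  proof -
    have "\<kappa> ^ i * \<kappa>' * K ^ j = \<kappa> ^ (i + 4) * K ^ (j + 8)" by (simp add: \<kappa>'_def power_add)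
    also have "\<dots> \<le> \<kappa> ^ 11 * K ^ 20" using that by (intro pow_le) auto
    finally show ?thesis unfolding W_def by (intro mult_right_mono) auto
  qed
  have succ: "\<one> \<oplus> r \<in> Q" if r: "r \<in> Q" for r
  proof (rule in_Q)
    fix u v assume "u \<in> L" "v \<in> L"
    then have "real (card (diffset A (dilate (u \<oplus> v \<otimes> (\<one> \<oplus> r)) A))) \<le> \<kappa> ^ 4 * \<kappa>' * K ^ 10 * card A"
      using covL covQ r L Qc by (intro succ_dilate_bound[OF fA A K(2)]) auto
    also have "\<dots> \<le> W" by (rule W_ge) auto
    finally show "real (card (diffset A (dilate (u \<oplus> v \<otimes> (\<one> \<oplus> r)) A))) \<le> W" .
  qed (use r Qc in auto)
  have mult: "w \<otimes> r \<in> Q" if w: "w \<in> L" and r: "r \<in> Q" for w r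
  proof (rule in_Q)
    fix u v assume "u \<in> L" "v \<in> L"
    then have "real (card (diffset A (dilate (u \<oplus> v \<otimes> (w \<otimes> r)) A))) \<le> \<kappa> ^ 7 * \<kappa>' * K ^ 12 * card A"
      using covL covQ w r L Qc by (intro mult_dilate_bound[OF fA A K(2)]) auto
    also have "\<dots> \<le> W" by (rule W_ge) auto
    finally show "real (card (diffset A (dilate (u \<oplus> v \<otimes> (w \<otimes> r)) A))) \<le> W" .
  qed (use w r L Qc in auto)
  have "subfield Q R" "L \<subseteq> Q"
    using subfield_difference_quotients[OF fin L(1-3)] succ mult by (auto simp: Q_def)
  \<comment> \<open>Q itself is a set of multipliers with small dilates, now with the smaller bound
    \<kappa>' |A|.\<close>
  moreover have "real (card Q) \<le> 2 * (\<kappa>' * card A)"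
  proof (rule card_small_dilates[OF fA A])
    have "\<kappa>' * card A \<le> W"
      using pow_le[of 4 8] by (simp add: \<kappa>'_def W_def mult_right_mono)
    then show "2 * (\<kappa>' * card A) \<le> (real (card A))\<^sup>2" using W2 by linarith
  qed (use small fin Qc k1 in \<open>auto intro: finite_subset\<close>)
  ultimately show ?thesis using that[of Q] by (auto simp: L_def \<kappa>'_def mult_ac)
qed

end

section \<open>The Balog-Szemeredi-Gowers theorem\<close>

context ring
begin

text \<open>Choosing a random vertex \<open>v\<close> makes all but few pairs of its neighbours have many common neighbours.\<close>

lemma balog_szemeredi_gowers:
  fixes m \<delta> :: real
  assumes fin: "finite A" "finite B" and sub: "A \<subseteq> carrier R" "B \<subseteq> carrier R" and \<Gamma>: "\<Gamma> \<subseteq> A \<times> B"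
    and m: "card A \<le> m" "card B \<le> m" "card ((\<lambda>(a, b). a \<oplus> b) ` \<Gamma>) \<le> m" "0 < m"
    and \<delta>: "0 < \<delta>" "\<delta> * m\<^sup>2 \<le> card \<Gamma>"
  obtains v A' where "v \<in> B" "A' \<subseteq> {a \<in> A. (a, v) \<in> \<Gamma>}" "\<delta> * m / 4 \<le> card A'"
    "card (diffset A' A') \<le> 4096 * m / \<delta> ^ 5"
proof -
  \<comment> \<open>Pairs with fewer than this many common neighbours count as bad. Summed over all
    v there are at most m^2 \<theta> = \<delta>^2 m^3 / 32 bad pairs, and 16 times that is half of
    the lower bound for the sum of the squared degrees.\<close>
  define \<theta> where "\<theta> = \<delta>\<^sup>2 * m / 32"
  have \<theta>: "\<theta> > 0" using \<delta> m by (simp add: \<theta>_def)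
  define N where "N v = {a \<in> A. (a, v) \<in> \<Gamma>}" for v
  define C where "C a a' = {b \<in> B. (a, b) \<in> \<Gamma> \<and> (a', b) \<in> \<Gamma>}" for a a'
  define Bad where "Bad v = {(a, a') \<in> N v \<times> N v. card (C a a') < \<theta>}" for v
  have fN: "finite (N v)" and fC: "finite (C a a')" for v a a' using fin by (auto simp: N_def C_def)
  have fBad: "finite (Bad v)" for v
    by (rule finite_subset[of _ "N v \<times> N v"]) (use fN in \<open>auto simp: Bad_def\<close>)
  have "\<Gamma> = (\<lambda>(v, a). (a, v)) ` (SIGMA v:B. N v)" using \<Gamma> by (force simp: N_def image_iff)
  then have "card \<Gamma> = card ((\<lambda>(v, a). (a, v)) ` (SIGMA v:B. N v))" by simp
  also have "\<dots> = card (SIGMA v:B. N v)" by (intro card_image inj_onI) auto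
  also have "\<dots> = (\<Sum>v\<in>B. card (N v))" using fin fN by (simp add: card_SigmaI)
  finally have "real (card \<Gamma>) = (\<Sum>v\<in>B. real (card (N v)))" by simp
  then have "(\<delta> * m\<^sup>2)\<^sup>2 \<le> (\<Sum>v\<in>B. real (card (N v)))\<^sup>2" using \<delta> m by (intro power_mono) auto
  also have "\<dots> \<le> card B * (\<Sum>v\<in>B. (real (card (N v)))\<^sup>2)" using fin by (intro sum_square_le_card_mult)
  also have "\<dots> \<le> m * (\<Sum>v\<in>B. (real (card (N v)))\<^sup>2)" using m by (intro mult_right_mono sum_nonneg) auto
  finally have deg: "\<delta>\<^sup>2 * m ^ 3 \<le> (\<Sum>v\<in>B. (real (card (N v)))\<^sup>2)"
    using m(4) by (simp add: power2_eq_square power3_eq_cube mult_ac)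
  define W where "W = {(a, a') \<in> A \<times> A. card (C a a') < \<theta>}"
  have fW: "finite W" by (rule finite_subset[of _ "A \<times> A"]) (use fin in \<open>auto simp: W_def\<close>)
  have "(\<Sum>v\<in>B. card (Bad v)) = card (SIGMA v:B. Bad v)" using fin fBad by (simp add: card_SigmaI)
  also have "(SIGMA v:B. Bad v) = (\<lambda>(p, v). (v, p)) ` (SIGMA p:W. C (fst p) (snd p))"
    by (force simp: Bad_def W_def C_def N_def image_iff)
  also have "card \<dots> = card (SIGMA p:W. C (fst p) (snd p))" by (intro card_image inj_onI) auto
  also have "\<dots> = (\<Sum>p\<in>W. card (C (fst p) (snd p)))" using fW fC by (simp add: card_SigmaI)
  finally have "(\<Sum>v\<in>B. real (card (Bad v))) = (\<Sum>p\<in>W. real (card (C (fst p) (snd p))))"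
    by (simp only: of_nat_sum[symmetric])
  also have "\<dots> \<le> (\<Sum>p\<in>W. \<theta>)" by (intro sum_mono) (auto simp: W_def)
  also have "\<dots> = card W * \<theta>" by simp
  also have "card W \<le> card (A \<times> A)" using fin by (intro card_mono) (auto simp: W_def)
  then have "real (card W) \<le> real (card A) * real (card A)"
    by (metis card_cartesian_product of_nat_le_iff of_nat_mult)
  then have "real (card W) \<le> m * m" using m(1) mult_mono[OF m(1) m(1)] m(4) by auto
  then have "card W * \<theta> \<le> m * m * \<theta>" using \<theta> by (intro mult_right_mono) auto
  finally have bad: "(\<Sum>v\<in>B. real (card (Bad v))) \<le> \<delta>\<^sup>2 * m ^ 3 / 32"
    by (simp add: \<theta>_def power2_eq_square power3_eq_cube mult_ac)
  \<comment> \<open>Averaging squared degree minus 16 times the number of bad pairs yields a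
    neighbourhood that is large and has few bad pairs at the same time.\<close>
  have "\<exists>v\<in>B. \<delta>\<^sup>2 * m\<^sup>2 / 2 \<le> (real (card (N v)))\<^sup>2 - 16 * card (Bad v)"
  proof (rule ccontr)
    assume "\<not> ?thesis"
    then have lt: "\<And>v. v \<in> B \<Longrightarrow> (real (card (N v)))\<^sup>2 - 16 * card (Bad v) < \<delta>\<^sup>2 * m\<^sup>2 / 2" by (simp add: not_le)
    have ne: "B \<noteq> {}"
    proof
      assume "B = {}"
      then have "\<Gamma> = {}" using \<Gamma> by auto
      then have "\<delta> * m\<^sup>2 \<le> 0" using \<delta>(2) by simp
      moreover have "\<delta> * m\<^sup>2 > 0" using \<delta>(1) m(4) by simp
      ultimately show False by linarith
    qed
    have "\<delta>\<^sup>2 * m ^ 3 - 16 * (\<delta>\<^sup>2 * m ^ 3 / 32) \<le> (\<Sum>v\<in>B. (real (card (N v)))\<^sup>2 - 16 * card (Bad v))"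
      using deg bad by (simp add: sum_subtractf flip: sum_distrib_left)
    also have "\<dots> < (\<Sum>v\<in>B. \<delta>\<^sup>2 * m\<^sup>2 / 2)" using fin ne lt by (intro sum_strict_mono) auto
    also have "\<dots> \<le> m * (\<delta>\<^sup>2 * m\<^sup>2 / 2)" using m(2) by (simp add: mult_right_mono)
    finally show False by (simp add: power2_eq_square power3_eq_cube mult_ac)
  qed
  then obtain v where v: "v \<in> B" "\<delta>\<^sup>2 * m\<^sup>2 / 2 \<le> (real (card (N v)))\<^sup>2 - 16 * card (Bad v)" by blast
  define d where "d = real (card (N v))"
  have d2: "16 * real (card (Bad v)) \<le> d\<^sup>2"
  proof -
    have "0 \<le> \<delta>\<^sup>2 * m\<^sup>2 / 2" by simp
    then show ?thesis using v(2) unfolding d_def by linarith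
  qed
  have "(\<delta> * m / 2)\<^sup>2 \<le> d\<^sup>2"
  proof -
    have "(\<delta> * m / 2)\<^sup>2 \<le> \<delta>\<^sup>2 * m\<^sup>2 / 2" by (simp add: power_mult_distrib power_divide)
    also have "\<dots> \<le> d\<^sup>2" using v(2) unfolding d_def by linarith
    finally show ?thesis .
  qed
  then have d: "\<delta> * m / 2 \<le> d" by (rule power2_le_imp_le) (simp add: d_def)
  have dpos: "d > 0" using d \<delta> m by (smt (verit) half_gt_zero mult_pos_pos)
  \<comment> \<open>Markov's inequality: there are at most d^2/16 bad pairs, so at most d/4 vertices
    have more than d/4 bad partners.\<close>
  define A' where "A' = {a \<in> N v. real (card {a' \<in> N v. (a, a') \<in> Bad v}) \<le> d / 4}"
  have A': "A' \<subseteq> N v" "finite A'" using fN by (auto simp: A'_def)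
  have "card (SIGMA a:N v - A'. {a' \<in> N v. (a, a') \<in> Bad v}) \<le> card (Bad v)"
    using fBad by (intro card_mono) auto
  moreover have "card (SIGMA a:N v - A'. {a' \<in> N v. (a, a') \<in> Bad v}) = (\<Sum>a\<in>N v - A'. card {a' \<in> N v. (a, a') \<in> Bad v})"
    using fN by (simp add: card_SigmaI)
  ultimately have "(\<Sum>a\<in>N v - A'. real (card {a' \<in> N v. (a, a') \<in> Bad v})) \<le> real (card (Bad v))"
    by (simp only: of_nat_sum[symmetric] of_nat_le_iff)
  moreover have "real (card (N v - A')) * (d / 4) \<le> (\<Sum>a\<in>N v - A'. real (card {a' \<in> N v. (a, a') \<in> Bad v}))"
    by (rule sum_bounded_below) (auto simp: A'_def)
  moreover have "d / 4 * (d / 4) = d\<^sup>2 / 16" by (simp add: power2_eq_square)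
  ultimately have "real (card (N v - A')) * (d / 4) \<le> d / 4 * (d / 4)" using d2 by linarith
  then have "real (card (N v - A')) \<le> d / 4" using dpos by (simp add: mult.commute)
  moreover have "real (card (N v - A')) = d - card A'"
    using A' fN by (simp add: card_Diff_subset card_mono d_def of_nat_diff)
  ultimately have cA': "3 / 4 * d \<le> card A'" by simp
  \<comment> \<open>Midpoints c of paths a - b - c - b' - a': each of the two halves can be
    completed in at least \<theta> ways. Since each endpoint excludes at most d/4 vertices, at least
    d/2 midpoints remain.\<close>
  define G where "G a a' = {c \<in> N v. (a, c) \<notin> Bad v \<and> (a', c) \<notin> Bad v}" for a a'
  have G: "d / 2 \<le> card (G a a')" if "a \<in> A'" "a' \<in> A'" for a a'
  proof -
    have "N v = G a a' \<union> ({c \<in> N v. (a, c) \<in> Bad v} \<union> {c \<in> N v. (a', c) \<in> Bad v})" by (auto simp: G_def)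
    then have "card (N v) \<le> card (G a a') + (card {c \<in> N v. (a, c) \<in> Bad v} + card {c \<in> N v. (a', c) \<in> Bad v})"
      by (metis (no_types, lifting) add_left_mono card_Un_le order_trans)
    then have "d \<le> real (card (G a a')) + (real (card {c \<in> N v. (a, c) \<in> Bad v}) + real (card {c \<in> N v. (a', c) \<in> Bad v}))"
      unfolding d_def by linarith
    moreover have "real (card {c \<in> N v. (a, c) \<in> Bad v}) \<le> d / 4" "real (card {c \<in> N v. (a', c) \<in> Bad v}) \<le> d / 4"
      using that by (auto simp: A'_def)
    ultimately show ?thesis by linarith
  qed
  have CG: "\<theta> \<le> card (C a c)" "\<theta> \<le> card (C a' c)" if "a \<in> A'" "a' \<in> A'" "c \<in> G a a'" for a a' c
    using that by (auto simp: G_def Bad_def A'_def not_less)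
  define D where "D = diffset A' A'"
  have fD: "finite D" using A' by (simp add: D_def)
  define rep where "rep z = (SOME q. fst q \<in> A' \<and> snd q \<in> A' \<and> z = fst q \<ominus> snd q)" for z
  have rep: "fst (rep z) \<in> A' \<and> snd (rep z) \<in> A' \<and> z = fst (rep z) \<ominus> snd (rep z)" if "z \<in> D" for z
    unfolding rep_def by (rule someI_ex) (use that in \<open>auto simp: D_def diffset_def\<close>)
  \<comment> \<open>Such a path writes a - a' as (a+b) - (c+b) + (c+b') - (a'+b'), four sums along
    edges. With one representation fixed per difference, the four sums recover z, then b and b',
    then c. So |D| (d/2) \<theta>^2 <= m^4, which gives the constant 4096 = 4 * 32^2.\<close>
  define \<Omega> where "\<Omega> = (SIGMA z:D. SIGMA c:G (fst (rep z)) (snd (rep z)). C (fst (rep z)) c \<times> C (snd (rep z)) c)"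
  define S where "S = (\<lambda>(a, b). a \<oplus> b) ` \<Gamma>"
  have f\<Gamma>: "finite \<Gamma>" using \<Gamma> fin finite_subset by blast
  define \<Phi> where "\<Phi> = (\<lambda>(z, c, b, b'). (fst (rep z) \<oplus> b, c \<oplus> b, c \<oplus> b', snd (rep z) \<oplus> b'))"
  have inj: "inj_on \<Phi> \<Omega>"
  proof (rule inj_onI)
    fix p q assume pq: "p \<in> \<Omega>" "q \<in> \<Omega>" "\<Phi> p = \<Phi> q"
    obtain z c b b' where p: "p = (z, c, b, b')" by (metis prod.collapse)
    obtain z1 c1 b1 b1' where q: "q = (z1, c1, b1, b1')" by (metis prod.collapse)
    note in1 = pq(1)[unfolded p] and in2 = pq(2)[unfolded q] and e = pq(3)[unfolded p q]
    define a a' a1 a1' where "a = fst (rep z)" and "a' = snd (rep z)" and "a1 = fst (rep z1)" and "a1' = snd (rep z1)"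
    have zD: "z \<in> D" "z1 \<in> D" using in1 in2 by (auto simp: \<Omega>_def)
    have z: "z = a \<ominus> a'" "z1 = a1 \<ominus> a1'" "a \<in> A'" "a' \<in> A'" "a1 \<in> A'" "a1' \<in> A'"
      using rep[OF zD(1)] rep[OF zD(2)] by (auto simp: a_def a'_def a1_def a1'_def)
    have cl: "a \<in> carrier R" "a' \<in> carrier R" "a1 \<in> carrier R" "a1' \<in> carrier R"
      "b \<in> carrier R" "b' \<in> carrier R" "b1 \<in> carrier R" "b1' \<in> carrier R" "c \<in> carrier R" "c1 \<in> carrier R"
      using z(3-6) in1 in2 A' sub by (auto simp: \<Omega>_def G_def C_def N_def)
    have eq: "a \<oplus> b = a1 \<oplus> b1" "c \<oplus> b = c1 \<oplus> b1" "c \<oplus> b' = c1 \<oplus> b1'" "a' \<oplus> b' = a1' \<oplus> b1'"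
      using e by (auto simp: \<Phi>_def a_def a'_def a1_def a1'_def)
    have "z = (a \<oplus> b) \<ominus> (c \<oplus> b) \<oplus> (c \<oplus> b') \<ominus> (a' \<oplus> b')" unfolding z using cl by algebra
    also have "\<dots> = z1" unfolding z eq using cl by algebra
    finally have zz: "z = z1" .
    then have "a = a1" "a' = a1'" by (auto simp: a_def a1_def a'_def a1'_def)
    then have "b = b1" "b' = b1'" using eq(1,4) cl by auto
    moreover from this have "c = c1" using eq(2) cl by auto
    ultimately show "p = q" using zz p q by simp
  qed
  have "\<Phi> ` \<Omega> \<subseteq> S \<times> S \<times> S \<times> S"
  proof
    fix w assume "w \<in> \<Phi> ` \<Omega>"
    then obtain z c b b' where w: "(z, c, b, b') \<in> \<Omega>" "w = \<Phi> (z, c, b, b')" by auto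
    then have "(fst (rep z), b) \<in> \<Gamma>" "(c, b) \<in> \<Gamma>" "(c, b') \<in> \<Gamma>" "(snd (rep z), b') \<in> \<Gamma>"
      by (auto simp: \<Omega>_def C_def)
    then show "w \<in> S \<times> S \<times> S \<times> S" unfolding w(2) \<Phi>_def S_def by force
  qed
  then have "card \<Omega> \<le> card (S \<times> S \<times> S \<times> S)"
    using inj f\<Gamma> by (intro card_inj_on_le) (auto simp: S_def)
  then have "real (card \<Omega>) \<le> real (card (S \<times> S \<times> S \<times> S))" by (simp only: of_nat_le_iff)
  also have "\<dots> = real (card S) ^ 4" by (simp add: card_cartesian_product power4_eq_xxxx mult_ac)
  also have "\<dots> \<le> m ^ 4" using m(3) by (intro power_mono) (auto simp: S_def)
  finally have up: "real (card \<Omega>) \<le> m ^ 4" .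
  have fG: "finite (G a a')" for a a' using fN by (auto simp: G_def)
  have "card \<Omega> = (\<Sum>z\<in>D. \<Sum>c\<in>G (fst (rep z)) (snd (rep z)). card (C (fst (rep z)) c) * card (C (snd (rep z)) c))"
    unfolding \<Omega>_def using fD fG fC by (simp add: card_SigmaI card_cartesian_product)
  then have "real (card \<Omega>) = (\<Sum>z\<in>D. \<Sum>c\<in>G (fst (rep z)) (snd (rep z)). real (card (C (fst (rep z)) c)) * card (C (snd (rep z)) c))"
    by simp
  moreover have "(\<Sum>z\<in>D. d / 2 * (\<theta> * \<theta>)) \<le> (\<Sum>z\<in>D. \<Sum>c\<in>G (fst (rep z)) (snd (rep z)). real (card (C (fst (rep z)) c)) * card (C (snd (rep z)) c))"
  proof (rule sum_mono)
    fix z assume z: "z \<in> D"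
    let ?a = "fst (rep z)" and ?a' = "snd (rep z)"
    have a: "?a \<in> A'" "?a' \<in> A'" using rep[OF z] by auto
    have "d / 2 * (\<theta> * \<theta>) \<le> card (G ?a ?a') * (\<theta> * \<theta>)" using G[OF a] \<theta> by (intro mult_right_mono) auto
    also have "\<dots> = (\<Sum>c\<in>G ?a ?a'. \<theta> * \<theta>)" by simp
    also have "\<dots> \<le> (\<Sum>c\<in>G ?a ?a'. real (card (C ?a c)) * card (C ?a' c))"
      using CG[OF a] \<theta> by (intro sum_mono mult_mono) auto
    finally show "d / 2 * (\<theta> * \<theta>) \<le> (\<Sum>c\<in>G ?a ?a'. real (card (C ?a c)) * card (C ?a' c))" .
  qed
  ultimately have "card D * (d / 2 * (\<theta> * \<theta>)) \<le> m ^ 4" using up by simp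
  moreover have "card D * (\<delta> * m / 4 * (\<theta> * \<theta>)) \<le> card D * (d / 2 * (\<theta> * \<theta>))"
    using d \<theta> by (intro mult_left_mono mult_right_mono) auto
  ultimately have "card D * (\<delta> * m / 4 * (\<theta> * \<theta>)) \<le> m ^ 4" by linarith
  then have "card D * (\<delta> ^ 5 * m ^ 3 / 4096) \<le> m * m ^ 3"
    by (simp add: \<theta>_def eval_nat_numeral mult_ac)
  then have "(card D * \<delta> ^ 5) * m ^ 3 \<le> (4096 * m) * m ^ 3" by (simp add: mult_ac)
  then have "card D * \<delta> ^ 5 \<le> 4096 * m" using m(4) by (simp only: mult_le_cancel_right) simp
  then have "card D \<le> 4096 * m / \<delta> ^ 5" using \<delta> by (simp add: field_simps)
  moreover have "\<delta> * m / 4 \<le> card A'" using cA' d dpos by linarith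
  ultimately show ?thesis using that[of v A'] v(1) A' by (auto simp: D_def N_def)
qed

end

section \<open>Double counting and averaging\<close>

lemma sum_card_swap:
  assumes "finite A" "finite B"
  shows "(\<Sum>a\<in>A. card {b \<in> B. P a b}) = (\<Sum>b\<in>B. card {a \<in> A. P a b})"
proof -
  have *: "card {b \<in> B. Q b} = (\<Sum>b\<in>B. if Q b then 1 else 0)" if "finite B" for B :: "'c set" and Q
    using that by (simp add: sum.If_cases Int_def)
  show ?thesis using assms by (simp add: *) (rule sum.swap)
qed

lemma exists_ge_average:
  fixes f :: "'b \<Rightarrow> real" and c k :: real
  assumes "finite T" "card T \<le> k" "0 < c" "c \<le> (\<Sum>t\<in>T. f t)"
  obtains t where "t \<in> T" "c / k \<le> f t"
proof -
  have "\<exists>t\<in>T. c / k \<le> f t"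
  proof (rule ccontr)
    assume "\<not> ?thesis"
    then have lt: "\<And>t. t \<in> T \<Longrightarrow> f t < c / k" by auto
    have ne: "T \<noteq> {}" using assms by auto
    then have "0 < card T" using assms by (simp add: card_gt_0_iff)
    then have k: "0 < k" using assms by linarith
    have "(\<Sum>t\<in>T. f t) < (\<Sum>t\<in>T. c / k)" using assms ne lt by (intro sum_strict_mono) auto
    also have "\<dots> = card T * (c / k)" by simp
    also have "\<dots> \<le> k * (c / k)" using assms k by (intro mult_right_mono) auto
    finally show False using assms k by simp
  qed
  then show ?thesis using that by blast
qed

text \<open>Count triples of distinct rows on each l. With k rows there are at least k^3 - 3k^2 of
  them, and k >= 6 makes this at least k^3/2, hence at least k r^2/2. Then average over the at most
  m^3 triples.\<close>

lemma three_common_rows: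
  fixes m r I :: real and row :: "'l \<Rightarrow> 'r set"
  assumes fin: "finite L" "finite Y" and row: "\<And>l. l \<in> L \<Longrightarrow> row l \<subseteq> Y" "\<And>l. l \<in> L \<Longrightarrow> r \<le> card (row l)"
    and r: "6 \<le> r" and Y: "card Y \<le> m" and I: "0 < I" "I \<le> (\<Sum>l\<in>L. real (card (row l)))"
  obtains a b c where "a \<in> Y" "b \<in> Y" "c \<in> Y" "a \<noteq> b" "a \<noteq> c" "b \<noteq> c"
    "I * r\<^sup>2 / (2 * m ^ 3) \<le> card {l \<in> L. a \<in> row l \<and> b \<in> row l \<and> c \<in> row l}"
proof -
  define T where "T = {(a, b, c) \<in> Y \<times> Y \<times> Y. a \<noteq> b \<and> a \<noteq> c \<and> b \<noteq> c}"
  define P where "P = (\<lambda>(a, b, c) l. a \<in> row l \<and> b \<in> row l \<and> c \<in> row l)"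
  have fT: "finite T" by (rule finite_subset[of _ "Y \<times> Y \<times> Y"]) (use fin in \<open>auto simp: T_def\<close>)
  have low: "real (card (row l)) * (r\<^sup>2 / 2) \<le> card {t \<in> T. P t l}" if l: "l \<in> L" for l
  proof -
    let ?R = "row l"
    have fR: "finite ?R" using row(1)[OF l] fin finite_subset by blast
    have "?R \<times> ?R \<times> ?R \<subseteq> {t \<in> T. P t l} \<union> ((\<lambda>(a, b). (a, a, b)) ` (?R \<times> ?R) \<union>
        ((\<lambda>(a, b). (a, b, a)) ` (?R \<times> ?R) \<union> (\<lambda>(a, b). (a, b, b)) ` (?R \<times> ?R)))"
      using row(1)[OF l] by (auto simp: T_def P_def image_iff)
    then have "card (?R \<times> ?R \<times> ?R) \<le> card ({t \<in> T. P t l} \<union> ((\<lambda>(a, b). (a, a, b)) ` (?R \<times> ?R) \<union>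
        ((\<lambda>(a, b). (a, b, a)) ` (?R \<times> ?R) \<union> (\<lambda>(a, b). (a, b, b)) ` (?R \<times> ?R))))"
      using fR fT by (intro card_mono) auto
    also have "\<dots> \<le> card {t \<in> T. P t l} + (card ((\<lambda>(a, b). (a, a, b)) ` (?R \<times> ?R)) +
        (card ((\<lambda>(a, b). (a, b, a)) ` (?R \<times> ?R)) + card ((\<lambda>(a, b). (a, b, b)) ` (?R \<times> ?R))))"
      by (intro order_trans[OF card_Un_le] add_left_mono card_Un_le)
    also have "\<dots> \<le> card {t \<in> T. P t l} + (card (?R \<times> ?R) + (card (?R \<times> ?R) + card (?R \<times> ?R)))"
      using fR by (intro add_mono card_image_le order_refl) auto
    finally have "real (card ?R * (card ?R * card ?R)) \<le> real (card {t \<in> T. P t l} + 3 * (card ?R * card ?R))"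
      by (simp only: of_nat_le_iff card_cartesian_product)
    then have 1: "real (card ?R) * (real (card ?R) * real (card ?R)) - 3 * (real (card ?R) * real (card ?R)) \<le> card {t \<in> T. P t l}"
      by simp
    define x where "x = real (card ?R)"
    have x: "r \<le> x" "6 \<le> x" using row(2)[OF l] r by (auto simp: x_def)
    have "r\<^sup>2 \<le> x\<^sup>2" using x r by (intro power_mono) auto
    then have "x * (r\<^sup>2 / 2) \<le> x * (x\<^sup>2 / 2)" using x by (intro mult_left_mono) auto
    also have "\<dots> = x * (x * x) - x * (x * x) / 2" by (simp add: power2_eq_square)
    also have "\<dots> \<le> x * (x * x) - 6 * (x * x) / 2"
      using mult_right_mono[OF x(2), of "x * x"] by simp
    finally show ?thesis using 1 by (simp add: x_def)
  qed
  have "I * (r\<^sup>2 / 2) \<le> (\<Sum>l\<in>L. real (card (row l))) * (r\<^sup>2 / 2)" using I by (intro mult_right_mono) auto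
  also have "\<dots> \<le> (\<Sum>l\<in>L. real (card {t \<in> T. P t l}))"
    unfolding sum_distrib_right by (intro sum_mono low)
  also have "\<dots> = (\<Sum>t\<in>T. real (card {l \<in> L. P t l}))"
    using sum_card_swap[OF fin(1) fT, of "\<lambda>l t. P t l"] by (simp only: of_nat_sum[symmetric])
  finally have s: "I * (r\<^sup>2 / 2) \<le> (\<Sum>t\<in>T. real (card {l \<in> L. P t l}))" .
  have "card T \<le> card (Y \<times> Y \<times> Y)" using fin by (intro card_mono) (auto simp: T_def)
  then have "real (card T) \<le> real (card Y) ^ 3"
    by (simp add: card_cartesian_product power3_eq_cube) (metis of_nat_le_iff of_nat_mult mult.assoc)
  also have "\<dots> \<le> m ^ 3" using Y by (intro power_mono) auto
  finally have cT: "real (card T) \<le> m ^ 3" .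
  obtain t where t: "t \<in> T" "I * (r\<^sup>2 / 2) / m ^ 3 \<le> card {l \<in> L. P t l}"
    using exists_ge_average[OF fT cT _ s] I r by (auto simp: field_simps)
  obtain a b c where "t = (a, b, c)" by (cases t)
  with t that[of a b c] show ?thesis by (auto simp: T_def P_def)
qed

text \<open>By Cauchy-Schwarz over the columns, the average number of common columns of two rows is
  at least \<eta>^2 m. Averaging fixes a row y', and rows sharing few columns with y' are dropped. A
  second average over the columns that meet y' yields x. The row y' becomes the unit of the
  dilations, and so it has to be a member of Y'.\<close>

lemma popular_column:
  fixes m \<eta> :: real
  assumes fin: "finite X" "finite Y" and Z: "Z \<subseteq> X \<times> Y" and m: "card X \<le> m" "card Y \<le> m" "0 < m"
    and \<eta>: "0 < \<eta>" "\<eta> * m\<^sup>2 \<le> card Z"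
  obtains x y' Y' where "y' \<in> Y'" "Y' \<subseteq> Y" "\<eta>\<^sup>2 * m / 2 \<le> card Y'"
    "\<And>y. y \<in> Y' \<Longrightarrow> (x, y) \<in> Z"
    "\<And>y. y \<in> Y' \<Longrightarrow> \<eta>\<^sup>2 * m / 2 \<le> card {x \<in> X. (x, y) \<in> Z \<and> (x, y') \<in> Z}"
proof -
  define C where "C x = {y \<in> Y. (x, y) \<in> Z}" for x
  define V where "V y y' = {x \<in> X. (x, y) \<in> Z \<and> (x, y') \<in> Z}" for y y'
  have fC: "finite (C x)" and fV: "finite (V y y')" for x y y' using fin by (auto simp: C_def V_def)
  have "Z = (SIGMA x:X. C x)" using Z by (auto simp: C_def)
  then have "card Z = card (SIGMA x:X. C x)" by simp
  also have "\<dots> = (\<Sum>x\<in>X. card (C x))" using fin fC by (simp add: card_SigmaI)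
  finally have "real (card Z) = (\<Sum>x\<in>X. real (card (C x)))" by simp
  then have "(\<eta> * m\<^sup>2)\<^sup>2 \<le> (\<Sum>x\<in>X. real (card (C x)))\<^sup>2" using \<eta> by (intro power_mono) auto
  also have "\<dots> \<le> card X * (\<Sum>x\<in>X. (real (card (C x)))\<^sup>2)" using fin by (intro sum_square_le_card_mult)
  also have "\<dots> \<le> m * (\<Sum>x\<in>X. (real (card (C x)))\<^sup>2)" using m by (intro mult_right_mono sum_nonneg) auto
  finally have "\<eta>\<^sup>2 * m ^ 3 \<le> (\<Sum>x\<in>X. (real (card (C x)))\<^sup>2)"
    using m(3) by (simp add: power2_eq_square power3_eq_cube mult_ac)
  also have "\<dots> = (\<Sum>x\<in>X. real (card {p \<in> Y \<times> Y. (x, fst p) \<in> Z \<and> (x, snd p) \<in> Z}))"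
  proof (intro sum.cong refl)
    fix x
    have "{p \<in> Y \<times> Y. (x, fst p) \<in> Z \<and> (x, snd p) \<in> Z} = C x \<times> C x" by (auto simp: C_def)
    then show "(real (card (C x)))\<^sup>2 = real (card {p \<in> Y \<times> Y. (x, fst p) \<in> Z \<and> (x, snd p) \<in> Z})"
      by (simp add: card_cartesian_product power2_eq_square)
  qed
  also have "\<dots> = (\<Sum>p\<in>Y \<times> Y. real (card (V (fst p) (snd p))))"
    unfolding V_def using sum_card_swap[of X "Y \<times> Y" "\<lambda>x p. (x, fst p) \<in> Z \<and> (x, snd p) \<in> Z"] fin
    by (simp only: of_nat_sum[symmetric]) auto
  also have "\<dots> = (\<Sum>y\<in>Y. \<Sum>y'\<in>Y. real (card (V y y')))"
    by (simp add: sum.cartesian_product case_prod_unfold)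
  also have "\<dots> = (\<Sum>y'\<in>Y. \<Sum>y\<in>Y. real (card (V y y')))" by (rule sum.swap)
  finally have s: "\<eta>\<^sup>2 * m ^ 3 \<le> (\<Sum>y'\<in>Y. \<Sum>y\<in>Y. real (card (V y y')))" .
  obtain y' where y': "y' \<in> Y" "\<eta>\<^sup>2 * m ^ 3 / m \<le> (\<Sum>y\<in>Y. real (card (V y y')))"
    using exists_ge_average[OF fin(2) m(2) _ s] \<eta> m by auto
  define Y1 where "Y1 = {y \<in> Y. \<eta>\<^sup>2 * m / 2 \<le> card (V y y')}"
  have fY1: "finite Y1" using fin by (auto simp: Y1_def)
  have "\<eta>\<^sup>2 * m\<^sup>2 \<le> (\<Sum>y\<in>Y. real (card (V y y')))"
    using y'(2) m(3) by (simp add: power2_eq_square power3_eq_cube)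
  also have "\<dots> = (\<Sum>y\<in>Y1. real (card (V y y'))) + (\<Sum>y\<in>Y - Y1. real (card (V y y')))"
    using fin by (subst sum.subset_diff[of Y1 Y]) (auto simp: Y1_def)
  also have "(\<Sum>y\<in>Y - Y1. real (card (V y y'))) \<le> (\<Sum>y\<in>Y - Y1. \<eta>\<^sup>2 * m / 2)"
    by (intro sum_mono) (auto simp: Y1_def)
  also have "\<dots> = card (Y - Y1) * (\<eta>\<^sup>2 * m / 2)" by simp
  also have "\<dots> \<le> m * (\<eta>\<^sup>2 * m / 2)"
  proof (rule mult_right_mono)
    have "card (Y - Y1) \<le> card Y" using fin by (intro card_mono) auto
    then show "real (card (Y - Y1)) \<le> m" using m(2) by linarith
  qed (use m in auto)
  also have "m * (\<eta>\<^sup>2 * m / 2) = \<eta>\<^sup>2 * m\<^sup>2 / 2" by (simp add: power2_eq_square)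
  finally have "\<eta>\<^sup>2 * m\<^sup>2 / 2 \<le> (\<Sum>y\<in>Y1. real (card (V y y')))" by simp
  also have "\<dots> = (\<Sum>y\<in>Y1. real (card {x \<in> V y' y'. (x, y) \<in> Z}))"
    by (intro sum.cong refl arg_cong[of _ _ card] arg_cong[of _ _ real]) (auto simp: V_def)
  also have "\<dots> = (\<Sum>x\<in>V y' y'. real (card {y \<in> Y1. (x, y) \<in> Z}))"
    using sum_card_swap[OF fY1 fV, of y' y' "\<lambda>y x. (x, y) \<in> Z"] by (simp only: of_nat_sum[symmetric])
  finally have s2: "\<eta>\<^sup>2 * m\<^sup>2 / 2 \<le> (\<Sum>x\<in>V y' y'. real (card {y \<in> Y1. (x, y) \<in> Z}))" .
  have "card (V y' y') \<le> card X" using fin by (intro card_mono) (auto simp: V_def)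
  then have cV: "real (card (V y' y')) \<le> m" using m(1) by linarith
  obtain x where x: "x \<in> V y' y'" "\<eta>\<^sup>2 * m\<^sup>2 / 2 / m \<le> card {y \<in> Y1. (x, y) \<in> Z}"
    using exists_ge_average[OF fV cV _ s2] \<eta> m by auto
  define Y2 where "Y2 = {y \<in> Y1. (x, y) \<in> Z}"
  have big: "\<eta>\<^sup>2 * m / 2 \<le> card Y2" using x(2) m(3) by (simp add: Y2_def power2_eq_square)
  moreover have "0 < \<eta>\<^sup>2 * m / 2" using \<eta> m by simp
  ultimately have "Y2 \<noteq> {}" by auto
  then obtain y where y: "y \<in> Y2" by blast
  \<comment> \<open>No row shares more columns with y' than y' itself, so y' passes the threshold as
    soon as some row does.\<close>
  have "card (V y y') \<le> card (V y' y')" by (rule card_mono[OF fV]) (auto simp: V_def)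
  then have "y' \<in> Y1" using y y'(1) by (auto simp: Y2_def Y1_def)
  then have "y' \<in> Y2" using x(1) by (auto simp: Y2_def V_def)
  then show ?thesis
  proof (rule that)
    show "Y2 \<subseteq> Y" "\<eta>\<^sup>2 * m / 2 \<le> card Y2" using big by (auto simp: Y2_def Y1_def)
    fix y assume "y \<in> Y2"
    then show "(x, y) \<in> Z" "\<eta>\<^sup>2 * m / 2 \<le> card {x \<in> X. (x, y) \<in> Z \<and> (x, y') \<in> Z}"
      by (simp_all add: Y2_def Y1_def V_def)
  qed
qed

section \<open>Rich lines on grids\<close>

context field
begin

text \<open>A pair (s, k) stands for the line x = sy + k, parametrised by its second coordinate.
  Multiplicative relations between slopes then come from comparing rows.\<close>

definition row :: "'a set \<Rightarrow> ('a \<times> 'a) set \<Rightarrow> 'a \<times> 'a \<Rightarrow> 'a set" where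
  "row Y Z l = {y \<in> Y. (fst l \<otimes> y \<oplus> snd l, y) \<in> Z}"

text \<open>There are at least N^3 / M^5 incidences between Z and L. Lines with fewer than N / (2
  M^5) points carry at most half of them and are discarded; the rest feeds
  \<open>three_common_rows\<close> with m = NM.\<close>

lemma rich_rows:
  fixes M N :: real
  assumes fin: "finite (carrier R)" and M: "4096 \<le> M" and N: "M ^ 6 \<le> N"
    and XY: "X \<subseteq> carrier R" "Y \<subseteq> carrier R" "card Y \<le> N * M" and Z: "Z \<subseteq> X \<times> Y" "N\<^sup>2 / M ^ 4 \<le> card Z"
    and L: "L \<subseteq> carrier R \<times> carrier R" "card L \<le> N\<^sup>2"
      "\<And>z. z \<in> Z \<Longrightarrow> N / M \<le> card {l \<in> L. fst z = fst l \<otimes> snd z \<oplus> snd l}"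
  obtains a b c L' where "a \<in> Y" "b \<in> Y" "c \<in> Y" "a \<noteq> b" "a \<noteq> c" "b \<noteq> c" "L' \<subseteq> L"
    "N\<^sup>2 / (16 * M ^ 18) \<le> card L'"
    "\<And>l. l \<in> L' \<Longrightarrow> a \<in> row Y Z l \<and> b \<in> row Y Z l \<and> c \<in> row Y Z l \<and> N / (2 * M ^ 5) \<le> card (row Y Z l)"
proof -
  have Mpos: "M > 0" using M by simp
  then have Npos: "N > 0" using N by (intro less_le_trans[OF zero_less_power N])
  have fX: "finite X" "finite Y" using XY fin finite_subset by blast+
  have fZ: "finite Z" using Z fX finite_subset by blast
  have fL: "finite L" using L fin finite_subset by blast
  define r where "r = N / (2 * M ^ 5)"
  define I where "I = N ^ 3 / (2 * M ^ 5)"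
  have "12 * M ^ 5 \<le> M * M ^ 5" using M by (intro mult_right_mono) auto
  also have "\<dots> = M ^ 6" by (simp add: power_Suc[symmetric] del: power_Suc)
  finally have r6: "6 \<le> r" using N Mpos by (simp add: r_def field_simps)
  have card_row: "card (row Y Z l) = card {z \<in> Z. fst z = fst l \<otimes> snd z \<oplus> snd l}" for l
  proof -
    have "{z \<in> Z. fst z = fst l \<otimes> snd z \<oplus> snd l} = (\<lambda>y. (fst l \<otimes> y \<oplus> snd l, y)) ` row Y Z l"
      using Z by (auto simp: row_def image_iff)
    moreover have "inj_on (\<lambda>y. (fst l \<otimes> y \<oplus> snd l, y)) (row Y Z l)" by (auto simp: inj_on_def)
    ultimately show ?thesis by (simp add: card_image)
  qed
  have "N ^ 3 / M ^ 5 = N\<^sup>2 / M ^ 4 * (N / M)" by (simp add: power2_eq_square eval_nat_numeral)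
  also have "\<dots> \<le> card Z * (N / M)" using Z Npos Mpos by (intro mult_right_mono) auto
  also have "\<dots> \<le> (\<Sum>z\<in>Z. real (card {l \<in> L. fst z = fst l \<otimes> snd z \<oplus> snd l}))"
    using L(3) by (intro sum_bounded_below) auto
  also have "\<dots> = (\<Sum>l\<in>L. real (card (row Y Z l)))"
    unfolding card_row using sum_card_swap[OF fZ fL, of "\<lambda>z l. fst z = fst l \<otimes> snd z \<oplus> snd l"]
    by (simp only: of_nat_sum[symmetric])
  finally have tot: "N ^ 3 / M ^ 5 \<le> (\<Sum>l\<in>L. real (card (row Y Z l)))" .
  define Lr where "Lr = {l \<in> L. r \<le> card (row Y Z l)}"
  have "(\<Sum>l\<in>L. real (card (row Y Z l))) = (\<Sum>l\<in>Lr. real (card (row Y Z l))) + (\<Sum>l\<in>L - Lr. real (card (row Y Z l)))"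
    using fL by (subst sum.subset_diff[of Lr L]) (auto simp: Lr_def)
  also have "(\<Sum>l\<in>L - Lr. real (card (row Y Z l))) \<le> (\<Sum>l\<in>L - Lr. r)"
    by (intro sum_mono) (auto simp: Lr_def)
  also have "\<dots> = card (L - Lr) * r" by simp
  also have "\<dots> \<le> N\<^sup>2 * r"
  proof (rule mult_right_mono)
    have "card (L - Lr) \<le> card L" using fL by (intro card_mono) auto
    then show "real (card (L - Lr)) \<le> N\<^sup>2" using L(2) by linarith
  qed (use r6 in auto)
  also have "N\<^sup>2 * r = N ^ 3 / (2 * M ^ 5)" by (simp add: r_def power2_eq_square power3_eq_cube)
  finally have "N ^ 3 / M ^ 5 - N ^ 3 / (2 * M ^ 5) \<le> (\<Sum>l\<in>Lr. real (card (row Y Z l)))" using tot by linarith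
  then have I: "I \<le> (\<Sum>l\<in>Lr. real (card (row Y Z l)))" by (simp add: I_def field_simps)
  have "0 < I" using Npos Mpos by (simp add: I_def)
  moreover have "finite Lr" using fL by (simp add: Lr_def)
  ultimately obtain a b c where abc: "a \<in> Y" "b \<in> Y" "c \<in> Y" "a \<noteq> b" "a \<noteq> c" "b \<noteq> c"
    "I * r\<^sup>2 / (2 * (N * M) ^ 3) \<le> card {l \<in> Lr. a \<in> row Y Z l \<and> b \<in> row Y Z l \<and> c \<in> row Y Z l}"
    using three_common_rows[of Lr Y "row Y Z" r "N * M" I] fX r6 XY(3) I by (auto simp: Lr_def row_def)
  have "I * r\<^sup>2 / (2 * (N * M) ^ 3) = N\<^sup>2 / (16 * M ^ 18)"
    using Npos Mpos by (simp add: I_def r_def field_simps power_mult_distrib eval_nat_numeral)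
  with abc show ?thesis
    by (intro that[of a b c "{l \<in> Lr. a \<in> row Y Z l \<and> b \<in> row Y Z l \<and> c \<in> row Y Z l}"]) (auto simp: Lr_def r_def)
qed

text \<open>Suitably scaled, the positions on rows a and b add up to the position on row c. This is
  the additive relation to which Balog-Szemeredi-Gowers is applied.\<close>

lemma three_rows_collinear:
  assumes "a \<in> carrier R" "b \<in> carrier R" "c \<in> carrier R" "s \<in> carrier R" "k \<in> carrier R"
  shows "(b \<ominus> c) \<otimes> (s \<otimes> a \<oplus> k) \<oplus> (c \<ominus> a) \<otimes> (s \<otimes> b \<oplus> k) = (b \<ominus> a) \<otimes> (s \<otimes> c \<oplus> k)"
  using assms by algebra

text \<open>Each line is an edge from its scaled position on row a to that on row b, and the sums
  along edges lie in a scaled copy of X. Balog-Szemeredi-Gowers returns a vertex v, that is, a point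
  (x, b), and neighbours A' of it, that is, lines through this point. Their positions on row a are
  an affine function of the slope, so the slopes inherit the small difference set.\<close>

lemma rich_pencil:
  fixes m \<delta> :: real
  assumes fin: "finite (carrier R)" and X: "X \<subseteq> carrier R" "card X \<le> m"
    and abc: "a \<in> carrier R" "b \<in> carrier R" "c \<in> carrier R" "a \<noteq> b" "a \<noteq> c" "b \<noteq> c"
    and L: "L \<subseteq> carrier R \<times> carrier R"
      "\<And>s k. (s, k) \<in> L \<Longrightarrow> s \<otimes> a \<oplus> k \<in> X \<and> s \<otimes> b \<oplus> k \<in> X \<and> s \<otimes> c \<oplus> k \<in> X"
    and \<delta>: "0 < \<delta>" "\<delta> * m\<^sup>2 \<le> card L" and m: "0 < m"
  obtains x S where "x \<in> X" "S \<subseteq> carrier R" "\<And>s. s \<in> S \<Longrightarrow> (s, x \<ominus> s \<otimes> b) \<in> L"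
    "\<delta> * m / 4 \<le> card S" "card S \<le> m" "card (diffset S S) \<le> 4096 * m / \<delta> ^ 5"
proof -
  have fX: "finite X" using X fin finite_subset by blast
  define g where "g = (\<lambda>(s, k). ((b \<ominus> c) \<otimes> (s \<otimes> a \<oplus> k), (c \<ominus> a) \<otimes> (s \<otimes> b \<oplus> k)))"
  define \<Gamma> where "\<Gamma> = g ` L"
  have nz: "b \<ominus> c \<noteq> \<zero>" "c \<ominus> a \<noteq> \<zero>" "b \<ominus> a \<noteq> \<zero>" "a \<ominus> b \<noteq> \<zero>" using abc by (auto simp: minus_eq_zero_iff)
  have canc: "u = v" if "e \<otimes> u = e \<otimes> v" "e \<noteq> \<zero>" "e \<in> carrier R" "u \<in> carrier R" "v \<in> carrier R" for e u v
    using that by (metis m_lcancel)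
  have "inj_on g L"
  proof (rule inj_onI)
    fix p q assume pq: "p \<in> L" "q \<in> L" "g p = g q"
    obtain s k s' k' where p: "p = (s, k)" "q = (s', k')" by (metis prod.collapse)
    have cl: "s \<in> carrier R" "k \<in> carrier R" "s' \<in> carrier R" "k' \<in> carrier R" using pq p L by auto
    have e: "s \<otimes> a \<oplus> k = s' \<otimes> a \<oplus> k'" "s \<otimes> b \<oplus> k = s' \<otimes> b \<oplus> k'"
      using pq(3) canc nz cl abc by (auto simp: g_def p)
    have 1: "(a \<ominus> b) \<otimes> (s \<ominus> s') = ((s \<otimes> a \<oplus> k) \<ominus> (s \<otimes> b \<oplus> k)) \<ominus> ((s' \<otimes> a \<oplus> k') \<ominus> (s' \<otimes> b \<oplus> k'))"
      using cl abc by algebra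
    have "(a \<ominus> b) \<otimes> (s \<ominus> s') = \<zero>" unfolding 1 e using cl abc by algebra
    then have s: "s = s'" using nz cl abc by (auto simp: integral_iff minus_eq_zero_iff)
    have "k = (s \<otimes> a \<oplus> k) \<ominus> s \<otimes> a" using cl abc by algebra
    also have "\<dots> = k'" unfolding e unfolding s using cl abc by algebra
    finally show "p = q" using s p by simp
  qed
  then have c\<Gamma>: "card \<Gamma> = card L" by (simp add: \<Gamma>_def card_image)
  let ?A = "dilate (b \<ominus> c) X" and ?B = "dilate (c \<ominus> a) X"
  have \<Gamma>: "\<Gamma> \<subseteq> ?A \<times> ?B" using L(2) by (auto simp: \<Gamma>_def g_def intro!: dilateI)
  have "(\<lambda>(u, v). u \<oplus> v) ` \<Gamma> \<subseteq> dilate (b \<ominus> a) X"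
  proof
    fix z assume "z \<in> (\<lambda>(u, v). u \<oplus> v) ` \<Gamma>"
    then obtain s k where sk: "(s, k) \<in> L" "z = (b \<ominus> c) \<otimes> (s \<otimes> a \<oplus> k) \<oplus> (c \<ominus> a) \<otimes> (s \<otimes> b \<oplus> k)"
      by (auto simp: \<Gamma>_def g_def)
    have "s \<in> carrier R" "k \<in> carrier R" using sk L by auto
    then have "z = (b \<ominus> a) \<otimes> (s \<otimes> c \<oplus> k)" unfolding sk(2) using abc by (intro three_rows_collinear) auto
    then show "z \<in> dilate (b \<ominus> a) X" using L(2)[OF sk(1)] by (simp add: dilateI)
  qed
  then have "card ((\<lambda>(u, v). u \<oplus> v) ` \<Gamma>) \<le> card (dilate (b \<ominus> a) X)" using fX by (intro card_mono) auto
  then have c3: "real (card ((\<lambda>(u, v). u \<oplus> v) ` \<Gamma>)) \<le> m" using card_dilate[OF _ nz(3) X(1)] abc X(2) by simp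
  have c12: "real (card ?A) \<le> m" "real (card ?B) \<le> m"
    using card_dilate[OF _ nz(1) X(1)] card_dilate[OF _ nz(2) X(1)] abc X(2) by auto
  obtain v A' where v: "v \<in> ?B" "A' \<subseteq> {u \<in> ?A. (u, v) \<in> \<Gamma>}" "\<delta> * m / 4 \<le> card A'"
    "card (diffset A' A') \<le> 4096 * m / \<delta> ^ 5"
    using balog_szemeredi_gowers[of ?A ?B \<Gamma> m \<delta>] fX X abc \<Gamma> c12 c3 m \<delta> by (auto simp: c\<Gamma>)
  obtain x where x: "x \<in> X" "v = (c \<ominus> a) \<otimes> x" using v(1) by (auto simp: dilate_def)
  have xc: "x \<in> carrier R" using x X by auto
  \<comment> \<open>The scaled position on row a of the line of slope s through (x, b).\<close>
  define h where "h s = (b \<ominus> c) \<otimes> (x \<oplus> s \<otimes> (a \<ominus> b))" for s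
  define S where "S = {s \<in> carrier R. (s, x \<ominus> s \<otimes> b) \<in> L \<and> h s \<in> A'}"
  have Sc: "S \<subseteq> carrier R" by (auto simp: S_def)
  have fS: "finite S" using Sc fin finite_subset by blast
  have hS: "h ` S = A'"
  proof
    show "h ` S \<subseteq> A'" by (auto simp: S_def)
    show "A' \<subseteq> h ` S"
    proof
      fix u assume u: "u \<in> A'"
      then have "(u, v) \<in> \<Gamma>" using v(2) by auto
      then obtain s k where sk: "(s, k) \<in> L" "u = (b \<ominus> c) \<otimes> (s \<otimes> a \<oplus> k)" "v = (c \<ominus> a) \<otimes> (s \<otimes> b \<oplus> k)"
        by (auto simp: \<Gamma>_def g_def)
      have cl: "s \<in> carrier R" "k \<in> carrier R" using sk L by auto
      have xe: "x = s \<otimes> b \<oplus> k" using sk(3) x(2) canc[of "c \<ominus> a" x "s \<otimes> b \<oplus> k"] nz xc cl abc by auto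
      have k: "x \<ominus> s \<otimes> b = k" unfolding xe using cl abc by algebra
      have hs: "h s = u" unfolding h_def xe sk(2) using cl abc by algebra
      then have "s \<in> S" unfolding S_def using k sk(1) u cl by simp
      then show "u \<in> h ` S" using hs by blast
    qed
  qed
  have h_diff: "h s \<ominus> h t = ((b \<ominus> c) \<otimes> (a \<ominus> b)) \<otimes> (s \<ominus> t)" if "s \<in> S" "t \<in> S" for s t
  proof -
    have "s \<in> carrier R" "t \<in> carrier R" using that Sc by auto
    then show ?thesis unfolding h_def using abc xc by algebra
  qed
  have nz2: "(b \<ominus> c) \<otimes> (a \<ominus> b) \<in> carrier R" "(b \<ominus> c) \<otimes> (a \<ominus> b) \<noteq> \<zero>" using nz abc by (auto simp: integral_iff)
  have "diffset A' A' = dilate ((b \<ominus> c) \<otimes> (a \<ominus> b)) (diffset S S)"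
    unfolding hS[symmetric] diffset_image dilate_def image_image by (force simp: h_diff image_iff)
  then have d: "card (diffset A' A') = card (diffset S S)" using card_dilate nz2 Sc by simp
  have "inj_on h S"
  proof (rule inj_onI)
    fix s t assume st: "s \<in> S" "t \<in> S" "h s = h t"
    have cl: "s \<in> carrier R" "t \<in> carrier R" using st Sc by auto
    have "((b \<ominus> c) \<otimes> (a \<ominus> b)) \<otimes> (s \<ominus> t) = h s \<ominus> h t" by (rule h_diff[OF st(1,2), symmetric])
    also have "\<dots> = \<zero>" unfolding st(3) using cl abc xc by (simp add: h_def a_minus_def r_neg)
    finally have "s \<ominus> t = \<zero>" using nz2 cl by (auto simp: integral_iff)
    then show "s = t" using cl by (simp add: minus_eq_zero_iff)
  qed
  then have cS: "card S = card A'" using hS card_image by fastforce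
  have "card A' \<le> card ?A" using v(2) fX by (intro card_mono) auto
  then have "real (card S) \<le> m" using c12 cS by linarith
  then show ?thesis using that[of x S] x v Sc by (simp add: d cS) (simp add: S_def)
qed

text \<open>The exponents are not optimized: the application needs \<open>55 \<le> 1299\<close>, \<open>3 * 2000 \<le> 6419\<close>
  and \<open>5000 \<le> 6419\<close>, where \<open>1299 = 6419 - 5120\<close> and \<open>5120 / 6419 = 2 * (2560 / 6419)\<close>.\<close>

theorem grid_incidences:
  fixes M N :: real
  assumes fin: "finite (carrier R)" and M: "4096 \<le> M" and N: "M ^ 5000 \<le> N"
    and XY: "X \<subseteq> carrier R" "Y \<subseteq> carrier R" "card X \<le> N * M" "card Y \<le> N * M"
    and Z: "Z \<subseteq> X \<times> Y" "N\<^sup>2 / M ^ 4 \<le> card Z"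
    and L: "L \<subseteq> carrier R \<times> carrier R" "card L \<le> N\<^sup>2"
      "\<And>z. z \<in> Z \<Longrightarrow> N / M \<le> card {l \<in> L. fst z = fst l \<otimes> snd z \<oplus> snd l}"
  obtains G x y e \<Lambda> where "subfield G R" "card G \<le> N * M ^ 2000" "\<Lambda> \<subseteq> G" "N / M ^ 55 \<le> card \<Lambda>"
    "y \<in> carrier R" "e \<in> carrier R" "e \<noteq> \<zero>" "\<And>g. g \<in> \<Lambda> \<Longrightarrow> (x, y \<oplus> e \<otimes> g) \<in> Z"
proof -
  have Mpos: "M > 0" and M1: "M \<ge> 1" using M by auto
  have MN: "M ^ k \<le> N" if "k \<le> 5000" for k
    using power_increasing[OF that M1] N by linarith
  have Npos: "N > 0" using N Mpos by (intro less_le_trans[OF zero_less_power N])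
  define m where "m = N * M"
  have m: "m > 0" using Npos Mpos by (simp add: m_def)
  have fX: "finite X" "finite Y" using XY fin finite_subset by blast+
  have M6: "M ^ 6 \<le> N" using MN by simp
  obtain a b c L' where abc: "a \<in> Y" "b \<in> Y" "c \<in> Y" "a \<noteq> b" "a \<noteq> c" "b \<noteq> c"
    and L': "L' \<subseteq> L" "N\<^sup>2 / (16 * M ^ 18) \<le> card L'"
    "\<And>l. l \<in> L' \<Longrightarrow> a \<in> row Y Z l \<and> b \<in> row Y Z l \<and> c \<in> row Y Z l \<and> N / (2 * M ^ 5) \<le> card (row Y Z l)"
    using rich_rows[OF fin M M6 XY(1,2,4) Z L] by blast
  have abc_c: "a \<in> carrier R" "b \<in> carrier R" "c \<in> carrier R" using abc XY by auto
  \<comment> \<open>The N^2 / (16 M^18) lines rich on three rows, relative to m^2 = N^2 M^2.\<close>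
  define \<delta> where "\<delta> = 1 / (16 * M ^ 20)"
  have "\<delta> * m\<^sup>2 = N\<^sup>2 / (16 * M ^ 18)"
    using Mpos by (simp add: \<delta>_def m_def field_simps eval_nat_numeral)
  then have \<delta>L: "\<delta> * m\<^sup>2 \<le> card L'" using L' by simp
  have \<delta>: "0 < \<delta>" using Mpos by (simp add: \<delta>_def)
  have L'c: "L' \<subseteq> carrier R \<times> carrier R" using L' L by auto
  have L'X: "s \<otimes> a \<oplus> k \<in> X \<and> s \<otimes> b \<oplus> k \<in> X \<and> s \<otimes> c \<oplus> k \<in> X" if "(s, k) \<in> L'" for s k
    using L'(3)[OF that] Z(1) by (auto simp: row_def)
  have cXY: "card X \<le> m" "card Y \<le> m" using XY by (simp_all add: m_def)
  obtain x0 S where S: "x0 \<in> X" "S \<subseteq> carrier R" "\<And>s. s \<in> S \<Longrightarrow> (s, x0 \<ominus> s \<otimes> b) \<in> L'"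
    "\<delta> * m / 4 \<le> card S" "card S \<le> m" "card (diffset S S) \<le> 4096 * m / \<delta> ^ 5"
    using rich_pencil[OF fin XY(1) cXY(1) abc_c abc(4-6) L'c L'X \<delta> \<delta>L m] by blast
  have x0c: "x0 \<in> carrier R" using S XY by auto
  have fS: "finite S" using S fin finite_subset by blast
  have S_ne: "S \<noteq> {}"
  proof
    assume "S = {}"
    then have "\<delta> * m / 4 \<le> 0" using S(4) by simp
    then show False using \<delta> m by (simp add: mult_le_0_iff)
  qed
  \<comment> \<open>The points of Z on the pencil through (x0, b). Row b is removed because all
    these lines meet there; on any other row a point determines its slope, so the sets
    \<open>V s\<close> below are disjoint.\<close>
  define Z' where "Z' = {(x, y) \<in> Z. y \<noteq> b \<and> (\<exists>s\<in>S. x = x0 \<oplus> s \<otimes> (y \<ominus> b))}"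
  have fZ': "finite Z'" using Z fX by (auto simp: Z'_def intro: finite_subset[of _ "X \<times> Y"])
  have Z': "Z' \<subseteq> X \<times> Y" using Z by (auto simp: Z'_def)
  define V where "V s = (\<lambda>y. (x0 \<oplus> s \<otimes> (y \<ominus> b), y)) ` (row Y Z (s, x0 \<ominus> s \<otimes> b) - {b})" for s
  have VZ: "V s \<subseteq> Z'" if s: "s \<in> S" for s
  proof
    fix z assume "z \<in> V s"
    then obtain y where y: "z = (x0 \<oplus> s \<otimes> (y \<ominus> b), y)" "y \<in> Y" "y \<noteq> b" "(s \<otimes> y \<oplus> (x0 \<ominus> s \<otimes> b), y) \<in> Z"
      by (auto simp: V_def row_def)
    have "s \<in> carrier R" "y \<in> carrier R" using s S y XY by auto
    then have e: "s \<otimes> y \<oplus> (x0 \<ominus> s \<otimes> b) = x0 \<oplus> s \<otimes> (y \<ominus> b)" using abc_c x0c by algebra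
    show "z \<in> Z'" using y(4) s y(3) unfolding y(1) e Z'_def by auto
  qed
  have fV: "finite (V s)" for s unfolding V_def using fX by (auto simp: row_def)
  have "V s \<inter> V t = {}" if st: "s \<in> S" "t \<in> S" "s \<noteq> t" for s t
  proof (rule ccontr)
    assume "V s \<inter> V t \<noteq> {}"
    then obtain y where y: "y \<in> Y" "y \<noteq> b" "x0 \<oplus> s \<otimes> (y \<ominus> b) = x0 \<oplus> t \<otimes> (y \<ominus> b)"
      by (auto simp: V_def row_def)
    have cl: "s \<in> carrier R" "t \<in> carrier R" "y \<in> carrier R" using st S y XY by auto
    then have "s \<otimes> (y \<ominus> b) = t \<otimes> (y \<ominus> b)" using y(3) x0c abc_c by simp
    then show False using cl abc_c y(2) st(3) by (simp add: m_rcancel minus_eq_zero_iff)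
  qed
  then have "card (\<Union>s\<in>S. V s) = (\<Sum>s\<in>S. card (V s))"
    using fS fV by (intro card_UN_disjoint) auto
  moreover have "card (\<Union>s\<in>S. V s) \<le> card Z'" using VZ fZ' by (intro card_mono) auto
  ultimately have "(\<Sum>s\<in>S. card (V s)) \<le> card Z'" by simp
  then have "(\<Sum>s\<in>S. real (card (V s))) \<le> card Z'" by (simp only: of_nat_sum[symmetric] of_nat_le_iff)
  moreover have "card S * (N / (4 * M ^ 5)) \<le> (\<Sum>s\<in>S. real (card (V s)))"
  proof (rule sum_bounded_below)
    fix s assume s: "s \<in> S"
    let ?r = "row Y Z (s, x0 \<ominus> s \<otimes> b)"
    have "card (V s) = card (?r - {b})" unfolding V_def by (intro card_image) (auto simp: inj_on_def)
    moreover have "card ?r - card {b} \<le> card (?r - {b})" by (intro diff_card_le_card_Diff) auto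
    ultimately have "real (card ?r) - 1 \<le> card (V s)" by simp
    moreover have "N / (2 * M ^ 5) \<le> card ?r" using L'(3)[OF S(3)[OF s]] by simp
    moreover have "1 \<le> N / (4 * M ^ 5)"
    proof -
      have "4 * M ^ 5 \<le> M * M ^ 5" using M by (intro mult_right_mono) auto
      also have "\<dots> = M ^ 6" by (simp add: power_Suc[symmetric] del: power_Suc)
      finally show ?thesis using MN[of 6] Mpos by simp
    qed
    moreover have "N / (2 * M ^ 5) = 2 * (N / (4 * M ^ 5))" by simp
    ultimately show "N / (4 * M ^ 5) \<le> card (V s)" by linarith
  qed
  moreover have "\<delta> * m / 4 * (N / (4 * M ^ 5)) \<le> card S * (N / (4 * M ^ 5))"
    using S(4) Npos Mpos by (intro mult_right_mono) auto
  ultimately have cZ': "\<delta> * m / 4 * (N / (4 * M ^ 5)) \<le> card Z'" by linarith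
  \<comment> \<open>The count of Z' is at least N^2 / (256 M^24). One further factor M absorbs the
    256, and division by m^2 gives M^27.\<close>
  define \<eta> where "\<eta> = 1 / M ^ 27"
  have \<eta>: "0 < \<eta>" using Mpos by (simp add: \<eta>_def)
  have "\<eta> * m\<^sup>2 \<le> \<delta> * m / 4 * (N / (4 * M ^ 5))"
  proof -
    have "\<eta> * m\<^sup>2 = N\<^sup>2 / (M * M ^ 24)"
      using Mpos by (simp add: \<eta>_def m_def field_simps eval_nat_numeral)
    also have "\<dots> \<le> N\<^sup>2 / (256 * M ^ 24)"
      using M by (intro divide_left_mono mult_right_mono mult_pos_pos) auto
    also have "\<dots> = \<delta> * m / 4 * (N / (4 * M ^ 5))"
      using Mpos by (simp add: \<delta>_def m_def field_simps eval_nat_numeral)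
    finally show ?thesis .
  qed
  then have \<eta>Z': "\<eta> * m\<^sup>2 \<le> card Z'" using cZ' by linarith
  obtain x y' Y' where Y': "y' \<in> Y'" "Y' \<subseteq> Y" "\<eta>\<^sup>2 * m / 2 \<le> card Y'"
    "\<And>y. y \<in> Y' \<Longrightarrow> (x, y) \<in> Z'"
    "\<And>y. y \<in> Y' \<Longrightarrow> \<eta>\<^sup>2 * m / 2 \<le> card {x \<in> X. (x, y) \<in> Z' \<and> (x, y') \<in> Z'}"
    by (rule popular_column[OF fX Z' cXY m \<eta> \<eta>Z'], rule that)
  have y'c: "y' \<in> carrier R" using Y' XY by auto
  define e where "e = y' \<ominus> b"
  have "y' \<noteq> b" using Y'(4)[OF Y'(1)] by (auto simp: Z'_def)
  then have e: "e \<in> carrier R" "e \<noteq> \<zero>" using y'c abc_c by (auto simp: e_def minus_eq_zero_iff)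
  \<comment> \<open>If slope s at row y and slope s' at row y' reach the same column, then s(y - b)
    = s'(y' - b), so s' = q(y) s. Columns shared by the two rows thus become elements of S and its
    dilate by q(y), and y' itself gets the multiplier one.\<close>
  define q where "q y = (y \<ominus> b) \<otimes> inv e" for y
  define \<Lambda> where "\<Lambda> = q ` Y'"
  have q: "q y \<in> carrier R" "e \<otimes> q y = y \<ominus> b" if "y \<in> carrier R" for y
  proof -
    show "q y \<in> carrier R" using that e abc_c by (simp add: q_def)
    have ie: "inv e \<in> carrier R" "e \<otimes> inv e = \<one>" using e by auto
    have "e \<otimes> q y = (y \<ominus> b) \<otimes> (e \<otimes> inv e)" unfolding q_def using that e(1) ie(1) abc_c by algebra
    then show "e \<otimes> q y = y \<ominus> b" using ie that abc_c by simp
  qed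
  have Y'c: "y \<in> carrier R" if "y \<in> Y'" for y using that Y' XY by auto
  have bq: "b \<oplus> e \<otimes> q y = y" if "y \<in> carrier R" for y
    unfolding q(2)[OF that] using that abc_c by algebra
  then have "inj_on q Y'" using Y'c by (intro inj_onI) metis
  then have c\<Lambda>: "card \<Lambda> = card Y'" by (simp add: \<Lambda>_def card_image)
  have \<Lambda>c: "\<Lambda> \<subseteq> carrier R" using q Y'c by (auto simp: \<Lambda>_def)
  have "q y' = \<one>" using e by (simp add: q_def flip: e_def)
  then have one\<Lambda>: "\<one> \<in> \<Lambda>" using Y'(1) by (auto simp: \<Lambda>_def intro: image_eqI[of _ _ y'])
  have half: "\<eta>\<^sup>2 * m / 2 \<ge> N / M ^ 54"
  proof -
    have "N / M ^ 54 = N / (M * M ^ 53)" by (simp add: power_Suc[symmetric] del: power_Suc)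
    also have "\<dots> \<le> N / (2 * M ^ 53)"
      using M Npos by (intro divide_left_mono mult_right_mono mult_pos_pos) auto
    also have "\<dots> = \<eta>\<^sup>2 * m / 2" using Mpos by (simp add: \<eta>_def m_def field_simps eval_nat_numeral)
    finally show ?thesis .
  qed
  have inter: "N / M ^ 54 \<le> card (S \<inter> dilate r S)" if r: "r \<in> \<Lambda>" for r
  proof -
    obtain y where y: "y \<in> Y'" "r = q y" using r by (auto simp: \<Lambda>_def)
    have yc: "y \<in> carrier R" using y Y'c by auto
    have rc: "r \<in> carrier R" using y q yc by auto
    let ?W = "{x \<in> X. (x, y) \<in> Z' \<and> (x, y') \<in> Z'}"
    have "?W \<subseteq> (\<lambda>s. x0 \<oplus> s \<otimes> e) ` (S \<inter> dilate r S)"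
    proof
      fix x assume "x \<in> ?W"
      then obtain s s' where s: "s \<in> S" "x = x0 \<oplus> s \<otimes> (y \<ominus> b)" and s': "s' \<in> S" "x = x0 \<oplus> s' \<otimes> e"
        by (auto simp: Z'_def e_def)
      have cl: "s \<in> carrier R" "s' \<in> carrier R" using s s' S by auto
      have "s' \<otimes> e = s \<otimes> (e \<otimes> r)" using s(2) s'(2) cl e x0c q[OF yc] y abc_c yc by simp
      also have "\<dots> = (r \<otimes> s) \<otimes> e" using cl e(1) rc by algebra
      finally have "s' = r \<otimes> s" using cl e rc by (simp add: m_rcancel)
      then have "s' \<in> S \<inter> dilate r S" using s(1) s'(1) by (auto simp: dilate_def)
      then show "x \<in> (\<lambda>s. x0 \<oplus> s \<otimes> e) ` (S \<inter> dilate r S)" unfolding s'(2) by (rule imageI)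
    qed
    then have "card ?W \<le> card (S \<inter> dilate r S)" using fS by (intro surj_card_le) auto
    then show ?thesis using Y'(5)[OF y(1)] half by linarith
  qed
  have cancel: "N * u = (u * w) * (N / w)" if "w \<noteq> 0" for u w :: real using that by simp
  \<comment> \<open>Since |S - S| <= N M^104 and |S| >= N / M^20, K has exponent 104 + 20. Since |S
    \<inter> rS| >= N / M^54, \<kappa> has exponent 104 + 54.\<close>
  define K where "K = M ^ 124"
  define \<kappa> where "\<kappa> = M ^ 158"
  have dS: "card (diffset S S) \<le> N * M ^ 104"
  proof -
    have "4096 * m / \<delta> ^ 5 = (2 ^ 32 * M ^ 101) * N"
      using Mpos by (simp add: \<delta>_def m_def power_mult_distrib power_divide flip: power_mult) (simp add: field_simps eval_nat_numeral)
    also have "\<dots> \<le> (M ^ 3 * M ^ 101) * N"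
    proof (intro mult_right_mono)
      have "(2::real) ^ 32 \<le> 4096 ^ 3" by simp
      also have "\<dots> \<le> M ^ 3" using M by (intro power_mono) auto
      finally show "2 ^ 32 \<le> M ^ 3" .
    qed (use Mpos Npos in auto)
    finally show ?thesis using S(6) by (simp flip: power_add add: mult.commute)
  qed
  have cS: "N / M ^ 20 \<le> card S"
  proof -
    have "N / M ^ 20 = N / (M * M ^ 19)" by (simp add: power_Suc[symmetric] del: power_Suc)
    also have "\<dots> \<le> N / (64 * M ^ 19)"
      using M Npos by (intro divide_left_mono mult_right_mono mult_pos_pos) auto
    also have "\<dots> = \<delta> * m / 4" using Mpos by (simp add: \<delta>_def m_def field_simps eval_nat_numeral)
    finally show ?thesis using S(4) by linarith
  qed
  have K1: "1 \<le> K" "1 \<le> \<kappa>" using M1 by (auto simp: K_def \<kappa>_def)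
  have KS: "real (card (diffset S S)) \<le> K * card S"
  proof -
    have "N * M ^ 104 = K * (N / M ^ 20)"
    proof -
      have *: "K = M ^ 104 * M ^ 20" unfolding K_def by (simp flip: power_add)
      have "M ^ 20 \<noteq> 0" using Mpos by simp
      then show ?thesis unfolding * by (rule cancel)
    qed
    also have "\<dots> \<le> K * card S" using cS K1 by (intro mult_left_mono) auto
    finally show ?thesis using dS by linarith
  qed
  have \<kappa>S: "real (card (diffset S S)) \<le> \<kappa> * card (S \<inter> dilate r S)" if "r \<in> \<Lambda>" for r
  proof -
    have "N * M ^ 104 = \<kappa> * (N / M ^ 54)"
    proof -
      have *: "\<kappa> = M ^ 104 * M ^ 54" unfolding \<kappa>_def by (simp flip: power_add)
      have "M ^ 54 \<noteq> 0" using Mpos by simp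
      then show ?thesis unfolding * by (rule cancel)
    qed
    also have "\<dots> \<le> \<kappa> * card (S \<inter> dilate r S)" using inter[OF that] K1 by (intro mult_left_mono) auto
    finally show ?thesis using dS by linarith
  qed
  have W: "2 * \<kappa> ^ 11 * K ^ 20 \<le> M ^ 4219"
  proof -
    have "2 * \<kappa> ^ 11 * K ^ 20 = 2 * M ^ 4218" unfolding \<kappa>_def K_def by (simp flip: power_mult power_add)
    also have "\<dots> \<le> M * M ^ 4218" using M by (intro mult_right_mono) auto
    also have "\<dots> = M ^ 4219" by (simp flip: power_Suc)
    finally show ?thesis .
  qed
  have size1: "2 * \<kappa> ^ 11 * K ^ 20 \<le> card S"
  proof -
    have "M ^ 4219 = M ^ 4239 / M ^ 20"
      using power_diff[of M 20 4239] Mpos by simp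
    also have "\<dots> \<le> N / M ^ 20" using MN[of 4239] Mpos by (intro divide_right_mono) auto
    finally show ?thesis using W cS by linarith
  qed
  \<comment> \<open>The decisive numerical condition: the left side is at most N M^4220 and the
    right side at least N^2 / M^108, so N has to beat M^4328. This is why M^5000 <= N is
    assumed.\<close>
  have size2: "2 * \<kappa> ^ 11 * K ^ 20 * card S < (real (card \<Lambda>))\<^sup>2"
  proof -
    have "2 * \<kappa> ^ 11 * K ^ 20 * card S \<le> M ^ 4219 * (N * M)"
      using W S(5) K1 Mpos by (intro mult_mono) (auto simp: m_def)
    also have "\<dots> = N * M ^ 4220"
    proof -
      have "M ^ 4220 = M ^ 4219 * M" by (simp flip: power_Suc2)
      then show ?thesis by simp
    qed
    also have "\<dots> < N * (N / M ^ 108)"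
    proof (intro mult_strict_left_mono Npos)
      have "M ^ 4220 * M ^ 108 = M ^ 4328" by (simp flip: power_add)
      also have "\<dots> < M ^ 5000" using M by (intro power_strict_increasing) auto
      finally show "M ^ 4220 < N / M ^ 108" using N Mpos by (simp add: pos_less_divide_eq)
    qed
    also have "\<dots> = (N / M ^ 54)\<^sup>2" by (simp add: power_divide power2_eq_square flip: power_add)
    also have "\<dots> \<le> (real (card \<Lambda>))\<^sup>2"
    proof (rule power_mono)
      show "N / M ^ 54 \<le> card \<Lambda>" using half Y'(3) unfolding c\<Lambda> by linarith
    qed (use Npos Mpos in auto)
    finally show ?thesis .
  qed
  obtain G where G: "subfield G R" "\<Lambda> \<subseteq> G" "real (card G) \<le> 2 * \<kappa> ^ 4 * K ^ 8 * card S"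
    using contained_in_small_subfield[OF fin S_ne S(2) \<Lambda>c one\<Lambda> K1(1) KS K1(2) \<kappa>S size1 size2] by blast
  have "2 * \<kappa> ^ 4 * K ^ 8 * card S \<le> N * M ^ 2000"
  proof -
    have "2 * \<kappa> ^ 4 * K ^ 8 = 2 * M ^ 1624" unfolding \<kappa>_def K_def by (simp flip: power_mult power_add)
    also have "\<dots> \<le> M * M ^ 1624" using M by (intro mult_right_mono) auto
    finally have "2 * \<kappa> ^ 4 * K ^ 8 \<le> M ^ 1625" by (simp flip: power_Suc)
    then have "2 * \<kappa> ^ 4 * K ^ 8 * card S \<le> M ^ 1625 * (N * M)"
      using S(5) Mpos by (intro mult_mono) (auto simp: m_def)
    also have "\<dots> = N * (M ^ 1625 * M)" by (simp add: mult_ac)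
    also have "M ^ 1625 * M = M ^ 1626" by (simp flip: power_Suc2)
    also have "N * M ^ 1626 \<le> N * M ^ 2000" using Npos M1 by (intro mult_left_mono power_increasing) auto
    finally show ?thesis .
  qed
  moreover have "N / M ^ 55 \<le> card \<Lambda>"
  proof -
    have "N / M ^ 55 \<le> N / M ^ 54" using Npos M1 Mpos by (intro divide_left_mono power_increasing) auto
    then show ?thesis using half Y'(3) c\<Lambda> by linarith
  qed
  moreover have "(x, b \<oplus> e \<otimes> g) \<in> Z" if "g \<in> \<Lambda>" for g
    using that Y'(4) bq Y'c by (auto simp: \<Lambda>_def Z'_def)
  ultimately show ?thesis using that[of G \<Lambda> b e x] G abc_c e by auto
qed

end

section \<open>Pencils through two points\<close>

text \<open>Let I be the sum in question. As two blocks share at most one point, Cauchy-Schwarz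
  gives I^2 <= |P| (I + |H|^2). Blocks of size at least D give |H| D <= I, so |P| |H|^2 <= I^2/2 and
  hence I <= 2|P|. The incidence relation is abstract so that points and lines can be
  exchanged.\<close>

lemma heavy_blocks:
  fixes D :: real
  assumes fin: "finite P" "finite H"
    and two: "\<And>p p' l l'. \<lbrakk>p \<in> P; p' \<in> P; p \<noteq> p'; l \<in> H; l' \<in> H; inc p l; inc p' l; inc p l'; inc p' l'\<rbrakk> \<Longrightarrow> l = l'"
    and D: "0 < D" "2 * card P \<le> D\<^sup>2" "\<And>l. l \<in> H \<Longrightarrow> D \<le> card {p \<in> P. inc p l}"
  shows "(\<Sum>l\<in>H. card {p \<in> P. inc p l}) \<le> 2 * card P"
proof -
  define k where "k l = {p \<in> P. inc p l}" for l
  define I where "I = (\<Sum>l\<in>H. real (card (k l)))"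
  have fk: "finite (k l)" for l using fin by (simp add: k_def)
  have "I = (\<Sum>p\<in>P. real (card {l \<in> H. inc p l}))"
    unfolding I_def k_def using sum_card_swap[OF fin(2,1), of "\<lambda>l p. inc p l"] by (simp only: of_nat_sum[symmetric])
  then have "I\<^sup>2 \<le> card P * (\<Sum>p\<in>P. (real (card {l \<in> H. inc p l}))\<^sup>2)"
    using sum_square_le_card_mult[OF fin(1)] by simp
  also have "(\<Sum>p\<in>P. (real (card {l \<in> H. inc p l}))\<^sup>2) = (\<Sum>p\<in>P. real (card {q \<in> H \<times> H. inc p (fst q) \<and> inc p (snd q)}))"
  proof (intro sum.cong refl)
    fix p
    have "{q \<in> H \<times> H. inc p (fst q) \<and> inc p (snd q)} = {l \<in> H. inc p l} \<times> {l \<in> H. inc p l}" by auto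
    then show "(real (card {l \<in> H. inc p l}))\<^sup>2 = real (card {q \<in> H \<times> H. inc p (fst q) \<and> inc p (snd q)})"
      by (simp add: card_cartesian_product power2_eq_square)
  qed
  also have "\<dots> = (\<Sum>q\<in>H \<times> H. real (card (k (fst q) \<inter> k (snd q))))"
  proof -
    have "{p \<in> P. inc p (fst q) \<and> inc p (snd q)} = k (fst q) \<inter> k (snd q)" for q by (auto simp: k_def)
    then show ?thesis
      using sum_card_swap[of P "H \<times> H" "\<lambda>p q. inc p (fst q) \<and> inc p (snd q)"] fin by (simp only: of_nat_sum[symmetric]) auto
  qed
  also have "\<dots> = (\<Sum>l\<in>H. \<Sum>l'\<in>H. real (card (k l \<inter> k l')))" by (simp add: sum.cartesian_product case_prod_unfold)
  also have "\<dots> \<le> (\<Sum>l\<in>H. \<Sum>l'\<in>H. (if l' = l then real (card (k l)) else 0) + 1)"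
  proof (intro sum_mono)
    fix l l' assume l: "l \<in> H" "l' \<in> H"
    show "real (card (k l \<inter> k l')) \<le> (if l' = l then real (card (k l)) else 0) + 1"
    proof (cases "l = l'")
      case False
      have "card (k l \<inter> k l') \<le> Suc 0"
        using two False l fk[of l] by (subst card_le_Suc0_iff_eq) (auto simp: k_def)
      then show ?thesis using False by auto
    qed auto
  qed
  also have "\<dots> = I + (real (card H))\<^sup>2" using fin by (simp add: I_def sum.distrib power2_eq_square)
  finally have 1: "I\<^sup>2 \<le> card P * (I + (real (card H))\<^sup>2)" by (simp add: mult_left_mono)
  have "card H * D \<le> I" unfolding I_def using D(3) by (intro sum_bounded_below) (auto simp: k_def)
  then have "(card H * D)\<^sup>2 \<le> I\<^sup>2" using D by (intro power_mono) auto
  then have "(real (card H))\<^sup>2 * D\<^sup>2 \<le> I\<^sup>2" by (simp add: power_mult_distrib)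
  moreover have "2 * card P * (real (card H))\<^sup>2 \<le> D\<^sup>2 * (real (card H))\<^sup>2" using D by (intro mult_right_mono) auto
  ultimately have "2 * card P * (real (card H))\<^sup>2 \<le> I\<^sup>2" by (simp add: mult.commute)
  with 1 have "I * I \<le> (2 * card P) * I" by (simp add: algebra_simps power2_eq_square)
  moreover have "0 \<le> I" by (simp add: I_def sum_nonneg)
  ultimately have "I \<le> 2 * card P" by (cases "I = 0") auto
  then have "real (\<Sum>l\<in>H. card {p \<in> P. inc p l}) \<le> real (2 * card P)" by (simp add: I_def k_def)
  then show ?thesis by (simp only: of_nat_le_iff)
qed

text \<open>After removing lines and points of degree above NM and points of degree below 8N/M, let
  s(z) count the points joined to z. Two applications of Cauchy-Schwarz bound the sum of s(z)^2
  below by a multiple of N^6 / M^4. Most pairs (p1, p2) joined to z are admissible, and averaging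
  over at most N^4 pairs fixes one of them. Distinct abscissae keep the line p1p2 from being
  vertical, and distinct joining lines keep z off that line, which is to become the line at
  infinity.\<close>

lemma two_rich_pencils:
  fixes M N :: real and inc :: "'p \<Rightarrow> 'l \<Rightarrow> bool" and x :: "'p \<Rightarrow> 'x"
  assumes fin: "finite P" "finite Q" and card: "card P \<le> N\<^sup>2" "card Q \<le> N\<^sup>2"
    and two: "\<And>p p' l l'. \<lbrakk>p \<in> P; p' \<in> P; p \<noteq> p'; l \<in> Q; l' \<in> Q; inc p l; inc p' l; inc p l'; inc p' l'\<rbrakk> \<Longrightarrow> l = l'"
    and x: "\<And>p p' l. \<lbrakk>p \<in> P; p' \<in> P; l \<in> Q; inc p l; inc p' l; x p = x p'\<rbrakk> \<Longrightarrow> p = p'"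
    and M: "4096 \<le> M" and N: "M ^ 8 \<le> N"
    and I: "40 * N ^ 3 / M \<le> (\<Sum>l\<in>Q. card {p \<in> P. inc p l})"
  obtains p1 p2 Q1 Z where "p1 \<in> P" "p2 \<in> P" "x p1 \<noteq> x p2" "Q1 \<subseteq> Q" "Z \<subseteq> P" "N\<^sup>2 / M ^ 4 \<le> card Z"
    "card {l \<in> Q1. inc p1 l} \<le> N * M" "card {l \<in> Q1. inc p2 l} \<le> N * M"
    "\<And>z. z \<in> Z \<Longrightarrow> 8 * N / M \<le> card {l \<in> Q1. inc z l}"
    "\<And>z. z \<in> Z \<Longrightarrow> z \<noteq> p1 \<and> z \<noteq> p2 \<and>
       (\<exists>l1\<in>Q1. \<exists>l2\<in>Q1. l1 \<noteq> l2 \<and> inc z l1 \<and> inc p1 l1 \<and> inc z l2 \<and> inc p2 l2)"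
proof -
  have Mpos: "M > 0" and M1: "M \<ge> 1" using M by auto
  have MN: "M ^ k \<le> N" if "k \<le> 8" for k using power_increasing[OF that M1] N by linarith
  have Npos: "N > 0" using N Mpos by (intro less_le_trans[OF zero_less_power N])
  define D where "D = N * M"
  have D: "D > 0" using Npos Mpos by (simp add: D_def)
  have "N\<^sup>2 * 2 \<le> N\<^sup>2 * M\<^sup>2"
  proof (rule mult_left_mono)
    have "(2::real) \<le> M * 1" using M by simp
    also have "\<dots> \<le> M * M" using M by (intro mult_left_mono) auto
    finally show "2 \<le> M\<^sup>2" by (simp add: power2_eq_square)
  qed simp
  then have D2: "2 * N\<^sup>2 \<le> D\<^sup>2" by (simp add: D_def power_mult_distrib)
  define k where "k S l = card {p \<in> S. inc p l}" for S l
  define deg where "deg S p = card {l \<in> S. inc p l}" for S p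
  define Qh where "Qh = {l \<in> Q. D < k P l}"
  define Q1 where "Q1 = Q - Qh"
  have Q1: "Q1 \<subseteq> Q" "finite Q1" "\<And>l. l \<in> Q1 \<Longrightarrow> k P l \<le> D" using fin by (auto simp: Q1_def Qh_def)
  have cQ1: "real (card Q1) \<le> N\<^sup>2" using card_mono[OF fin(2) Q1(1)] card(2) by linarith
  have "(\<Sum>l\<in>Qh. k P l) \<le> 2 * card P"
    unfolding k_def
  proof (rule heavy_blocks[where D = D])
    show "2 * card P \<le> D\<^sup>2" using card(1) D2 by linarith
  qed (use fin D two in \<open>auto simp: Qh_def k_def\<close>)
  then have "real (\<Sum>l\<in>Qh. k P l) \<le> real (2 * card P)" by (simp only: of_nat_le_iff)
  then have hQ: "(\<Sum>l\<in>Qh. real (k P l)) \<le> 2 * N\<^sup>2" using card(1) by simp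
  have "(\<Sum>l\<in>Q. real (k P l)) = (\<Sum>l\<in>Q1. real (k P l)) + (\<Sum>l\<in>Qh. real (k P l))"
    unfolding Q1_def using fin by (intro sum.subset_diff) (auto simp: Qh_def)
  then have "40 * N ^ 3 / M - 2 * N\<^sup>2 \<le> (\<Sum>l\<in>Q1. real (k P l))" using I hQ by (simp add: k_def)
  also have "\<dots> = (\<Sum>p\<in>P. real (deg Q1 p))"
    unfolding k_def deg_def using sum_card_swap[OF Q1(2) fin(1), of "\<lambda>l p. inc p l"] by (simp only: of_nat_sum[symmetric])
  finally have I1: "40 * N ^ 3 / M - 2 * N\<^sup>2 \<le> (\<Sum>p\<in>P. real (deg Q1 p))" .
  define Ph where "Ph = {p \<in> P. D < deg Q1 p}"
  define P1 where "P1 = {p \<in> P. 8 * N / M \<le> deg Q1 p \<and> deg Q1 p \<le> D}"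
  have P1: "P1 \<subseteq> P" "finite P1" using fin by (auto simp: P1_def)
  have cP1: "real (card P1) \<le> N\<^sup>2" using card_mono[OF fin(1) P1(1)] card(1) by linarith
  \<comment> \<open>The same estimate with points and lines in exchanged roles.\<close>
  have "(\<Sum>p\<in>Ph. deg Q1 p) \<le> 2 * card Q1"
    unfolding deg_def
  proof (rule heavy_blocks[where D = D])
    show "2 * card Q1 \<le> D\<^sup>2" using cQ1 D2 by linarith
    show "p = p'" if "l \<in> Q1" "l' \<in> Q1" "l \<noteq> l'" "p \<in> Ph" "p' \<in> Ph" "inc p l" "inc p l'" "inc p' l" "inc p' l'" for l l' p p'
      using two[of p p' l l'] that Q1(1) by (auto simp: Ph_def)
  qed (use fin D Q1 in \<open>auto simp: Ph_def deg_def\<close>)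
  then have "real (\<Sum>p\<in>Ph. deg Q1 p) \<le> real (2 * card Q1)" by (simp only: of_nat_le_iff)
  then have hP: "(\<Sum>p\<in>Ph. real (deg Q1 p)) \<le> 2 * N\<^sup>2" using cQ1 by simp
  have "(\<Sum>p\<in>P - Ph - P1. real (deg Q1 p)) \<le> (\<Sum>p\<in>P - Ph - P1. 8 * N / M)"
    by (intro sum_mono) (auto simp: Ph_def P1_def)
  also have "\<dots> = card (P - Ph - P1) * (8 * N / M)" by simp
  also have "\<dots> \<le> N\<^sup>2 * (8 * N / M)"
  proof (rule mult_right_mono)
    have "card (P - Ph - P1) \<le> card P" using fin by (intro card_mono) auto
    then show "real (card (P - Ph - P1)) \<le> N\<^sup>2" using card(1) by linarith
  qed (use Npos Mpos in auto)
  finally have lP: "(\<Sum>p\<in>P - Ph - P1. real (deg Q1 p)) \<le> 8 * (N ^ 3 / M)"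
    by (simp add: power2_eq_square power3_eq_cube mult_ac)
  have "(\<Sum>p\<in>P. real (deg Q1 p)) = (\<Sum>p\<in>P - Ph. real (deg Q1 p)) + (\<Sum>p\<in>Ph. real (deg Q1 p))"
    using fin by (intro sum.subset_diff) (auto simp: Ph_def)
  moreover have "(\<Sum>p\<in>P - Ph. real (deg Q1 p)) = (\<Sum>p\<in>P - Ph - P1. real (deg Q1 p)) + (\<Sum>p\<in>P1. real (deg Q1 p))"
    using fin by (intro sum.subset_diff) (auto simp: Ph_def P1_def)
  moreover have N2: "N\<^sup>2 \<le> N ^ 3 / M"
    using MN[of 1] Npos Mpos by (simp add: field_simps power2_eq_square power3_eq_cube)
  moreover have "40 * N ^ 3 / M = 40 * (N ^ 3 / M)" by simp
  ultimately have "16 * (N ^ 3 / M) \<le> (\<Sum>p\<in>P1. real (deg Q1 p))" using I1 hP lP zero_le_power2[of N] by linarith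
  define I' where "I' = (\<Sum>l\<in>Q1. real (k P1 l))"
  have "(\<Sum>p\<in>P1. real (deg Q1 p)) = I'"
    unfolding k_def deg_def I'_def using sum_card_swap[OF P1(2) Q1(2), of "\<lambda>p l. inc p l"] by (simp only: of_nat_sum[symmetric])
  with \<open>16 * (N ^ 3 / M) \<le> _\<close> have I': "16 * (N ^ 3 / M) \<le> I'" by simp
  define J where "J z = {p \<in> P1. z \<noteq> p \<and> (\<exists>l\<in>Q1. inc z l \<and> inc p l)}" for z
  have fJ: "finite (J z)" for z using P1 by (simp add: J_def)
  define s where "s z = real (card (J z))" for z
  have sum_s: "128 * (N ^ 4 / M\<^sup>2) \<le> (\<Sum>z\<in>P1. s z)"
  proof -
    \<comment> \<open>Ordered pairs of distinct points on l. Two points lie on at most one line, so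
      these sets are disjoint and their total is bounded by the sum of the s(z).\<close>
    define W where "W l = {q \<in> P1 \<times> P1. fst q \<noteq> snd q \<and> inc (fst q) l \<and> inc (snd q) l}" for l
    have fW: "finite (W l)" for l using P1 by (simp add: W_def)
    have "W l \<inter> W l' = {}" if "l \<in> Q1" "l' \<in> Q1" "l \<noteq> l'" for l l'
      using two[of _ _ l l'] that Q1(1) P1(1) by (fastforce simp: W_def)
    then have "card (\<Union>l\<in>Q1. W l) = (\<Sum>l\<in>Q1. card (W l))"
      using Q1 fW by (intro card_UN_disjoint) auto
    moreover have "card (\<Union>l\<in>Q1. W l) \<le> card (SIGMA z:P1. J z)"
      using P1 fJ by (intro card_mono finite_SigmaI) (auto simp: W_def J_def)
    moreover have "card (SIGMA z:P1. J z) = (\<Sum>z\<in>P1. card (J z))" using P1 fJ by (simp add: card_SigmaI)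
    ultimately have "(\<Sum>l\<in>Q1. card (W l)) \<le> (\<Sum>z\<in>P1. card (J z))" by simp
    then have 1: "(\<Sum>l\<in>Q1. real (card (W l))) \<le> (\<Sum>z\<in>P1. s z)"
      unfolding s_def by (simp only: of_nat_sum[symmetric] of_nat_le_iff)
    have "(real (k P1 l))\<^sup>2 - k P1 l \<le> card (W l)" for l
    proof -
      let ?S = "{p \<in> P1. inc p l}"
      have fS: "finite ?S" using P1 by simp
      have "?S \<times> ?S \<subseteq> W l \<union> (\<lambda>p. (p, p)) ` ?S" by (auto simp: W_def)
      then have "card (?S \<times> ?S) \<le> card (W l \<union> (\<lambda>p. (p, p)) ` ?S)" using fW fS by (intro card_mono) auto
      also have "\<dots> \<le> card (W l) + card ?S"
        by (rule order_trans[OF card_Un_le]) (use fS card_image_le in auto)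
      finally have "real (card (?S \<times> ?S)) \<le> real (card (W l) + card ?S)" by (simp only: of_nat_le_iff)
      then show ?thesis by (simp add: k_def card_cartesian_product power2_eq_square)
    qed
    then have "(\<Sum>l\<in>Q1. (real (k P1 l))\<^sup>2 - k P1 l) \<le> (\<Sum>l\<in>Q1. real (card (W l)))" by (intro sum_mono)
    then have 2: "(\<Sum>l\<in>Q1. (real (k P1 l))\<^sup>2) - I' \<le> (\<Sum>z\<in>P1. s z)" using 1 by (simp add: sum_subtractf I'_def)
    have "I'\<^sup>2 \<le> card Q1 * (\<Sum>l\<in>Q1. (real (k P1 l))\<^sup>2)" unfolding I'_def using Q1 by (intro sum_square_le_card_mult)
    also have "\<dots> \<le> N\<^sup>2 * (\<Sum>l\<in>Q1. (real (k P1 l))\<^sup>2)" using cQ1 by (intro mult_right_mono sum_nonneg) auto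
    finally have 3: "I'\<^sup>2 / N\<^sup>2 \<le> (\<Sum>l\<in>Q1. (real (k P1 l))\<^sup>2)" using Npos by (simp add: field_simps)
    have "16 * (N / M) * N\<^sup>2 \<le> I'" using I' by (simp add: power2_eq_square power3_eq_cube)
    then have "16 * (N / M) \<le> I' / N\<^sup>2" using Npos by (simp add: field_simps)
    moreover have "1 \<le> N / M" using MN[of 1] Mpos by simp
    ultimately have 4: "8 * (N / M) \<le> I' / N\<^sup>2 - 1" by linarith
    have "128 * (N ^ 4 / M\<^sup>2) = (16 * (N ^ 3 / M)) * (8 * (N / M))" by (simp add: eval_nat_numeral)
    also have "\<dots> \<le> I' * (I' / N\<^sup>2 - 1)"
      using I' 4 Npos Mpos by (intro mult_mono) (auto simp: I'_def intro!: sum_nonneg)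
    also have "\<dots> = I'\<^sup>2 / N\<^sup>2 - I'" by (simp add: power2_eq_square algebra_simps)
    finally show ?thesis using 2 3 by linarith
  qed
  have s_le: "s z \<le> D * D" if z: "z \<in> P1" for z
  proof -
    let ?L = "{l \<in> Q1. inc z l}"
    have "J z \<subseteq> (\<Union>l\<in>?L. {p \<in> P. inc p l})" using P1 by (auto simp: J_def)
    then have "card (J z) \<le> card (\<Union>l\<in>?L. {p \<in> P. inc p l})" using fin Q1 by (intro card_mono) auto
    also have "\<dots> \<le> (\<Sum>l\<in>?L. k P l)" unfolding k_def using Q1 by (intro card_UN_le) auto
    finally have "s z \<le> (\<Sum>l\<in>?L. real (k P l))" unfolding s_def by (simp only: of_nat_sum[symmetric] of_nat_le_iff)
    also have "\<dots> \<le> card ?L * D" by (intro sum_bounded_above) (use Q1 in auto)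
    also have "\<dots> \<le> D * D" using z D by (intro mult_right_mono) (auto simp: P1_def deg_def)
    finally show ?thesis .
  qed
  define good where "good z t \<longleftrightarrow> fst t \<in> J z \<and> snd t \<in> J z \<and> x (fst t) \<noteq> x (snd t) \<and>
      \<not> (\<exists>l\<in>Q1. inc z l \<and> inc (fst t) l \<and> inc (snd t) l)" for z t
  have good: "(s z)\<^sup>2 - 2 * D * s z \<le> card {t \<in> P1 \<times> P1. good z t}" if z: "z \<in> P1" for z
  proof -
    \<comment> \<open>The partners of p that are not admissible. Those with the abscissa of p number
      at most one per line through z, and those on the line zp at most the size of that line. Each
      kind is bounded by D.\<close>
    define B where "B p = {q \<in> J z. x p = x q \<or> (\<exists>l\<in>Q1. inc z l \<and> inc p l \<and> inc q l)}" for p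
    have fB: "finite (B p)" for p using fJ by (simp add: B_def)
    have cB: "real (card (B p)) \<le> 2 * D" if p: "p \<in> J z" for p
    proof -
      obtain l where l: "l \<in> Q1" "inc z l" "inc p l" "z \<noteq> p" "p \<in> P1" using p by (auto simp: J_def)
      let ?X = "{q \<in> J z. x p = x q}" and ?L = "{l \<in> Q1. inc z l}"
      define line where "line q = (SOME l. l \<in> Q1 \<and> inc z l \<and> inc q l)" for q
      have line: "line q \<in> Q1 \<and> inc z (line q) \<and> inc q (line q)" if "q \<in> J z" for q
        unfolding line_def by (rule someI_ex) (use that in \<open>auto simp: J_def\<close>)
      have "inj_on line ?X"
      proof (rule inj_onI)
        fix q q' assume q: "q \<in> ?X" "q' \<in> ?X" "line q = line q'"
        then show "q = q'" using x[of q q' "line q"] line[of q] line[of q'] Q1(1) P1(1) by (auto simp: J_def)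
      qed
      then have "card ?X \<le> card ?L" using line Q1 by (intro card_inj_on_le) auto
      moreover have "real (card ?L) \<le> D" using z by (simp add: P1_def deg_def)
      ultimately have cX: "real (card ?X) \<le> D" by linarith
      have "B p \<subseteq> ?X \<union> {q \<in> P. inc q l}"
      proof
        fix q assume q: "q \<in> B p"
        show "q \<in> ?X \<union> {q \<in> P. inc q l}"
        proof (cases "x p = x q")
          case True
          then show ?thesis using q by (auto simp: B_def)
        next
          case False
          then obtain l' where l': "l' \<in> Q1" "inc z l'" "inc p l'" "inc q l'" using q by (auto simp: B_def)
          then have "l' = l" using two[of z p l' l] l z P1(1) Q1(1) by auto
          then show ?thesis using l' q P1(1) by (auto simp: B_def J_def)
        qed
      qed
      then have "card (B p) \<le> card (?X \<union> {q \<in> P. inc q l})" using fJ fin by (intro card_mono) auto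
      also have "\<dots> \<le> card ?X + k P l" unfolding k_def by (rule card_Un_le)
      finally show ?thesis using cX Q1(3)[OF l(1)] by linarith
    qed
    have "J z \<times> J z \<subseteq> {t \<in> P1 \<times> P1. good z t} \<union> (SIGMA p:J z. B p)"
      by (auto simp: good_def B_def J_def)
    then have "card (J z \<times> J z) \<le> card ({t \<in> P1 \<times> P1. good z t} \<union> (SIGMA p:J z. B p))"
      using P1 fJ fB by (intro card_mono) auto
    also have "\<dots> \<le> card {t \<in> P1 \<times> P1. good z t} + card (SIGMA p:J z. B p)" by (rule card_Un_le)
    also have "card (SIGMA p:J z. B p) = (\<Sum>p\<in>J z. card (B p))" using fJ fB by (simp add: card_SigmaI)
    finally have "real (card (J z \<times> J z)) \<le> real (card {t \<in> P1 \<times> P1. good z t} + (\<Sum>p\<in>J z. card (B p)))"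
      by (simp only: of_nat_le_iff)
    then have "(s z)\<^sup>2 \<le> card {t \<in> P1 \<times> P1. good z t} + (\<Sum>p\<in>J z. real (card (B p)))"
      by (simp add: s_def card_cartesian_product power2_eq_square)
    also have "(\<Sum>p\<in>J z. real (card (B p))) \<le> card (J z) * (2 * D)" by (intro sum_bounded_above) (use cB in auto)
    finally show ?thesis by (simp add: s_def mult_ac)
  qed
  have "(\<Sum>z\<in>P1. s z)\<^sup>2 \<le> card P1 * (\<Sum>z\<in>P1. (s z)\<^sup>2)" using P1 by (intro sum_square_le_card_mult)
  also have "\<dots> \<le> N\<^sup>2 * (\<Sum>z\<in>P1. (s z)\<^sup>2)" using cP1 by (intro mult_right_mono sum_nonneg) auto
  finally have s2: "(\<Sum>z\<in>P1. s z)\<^sup>2 / N\<^sup>2 \<le> (\<Sum>z\<in>P1. (s z)\<^sup>2)" using Npos by (simp add: field_simps)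
  have "(128 * (N ^ 4 / M\<^sup>2))\<^sup>2 / N\<^sup>2 \<le> (\<Sum>z\<in>P1. s z)\<^sup>2 / N\<^sup>2"
    using sum_s Npos by (intro divide_right_mono power_mono) auto
  moreover have "(128 * (N ^ 4 / M\<^sup>2))\<^sup>2 / N\<^sup>2 = 16384 * (N ^ 6 / M ^ 4)"
    using Npos Mpos by (simp add: field_simps eval_nat_numeral)
  ultimately have s2': "16384 * (N ^ 6 / M ^ 4) \<le> (\<Sum>z\<in>P1. (s z)\<^sup>2)" using s2 by linarith
  \<comment> \<open>The non-admissible pairs are at most 2 N^5 M^3, and M^7 <= N brings this down to
    2 N^6 / M^4, far below the main term.\<close>
  have "(\<Sum>z\<in>P1. s z) \<le> card P1 * (D * D)" by (intro sum_bounded_above) (use s_le in auto)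
  also have "\<dots> \<le> N\<^sup>2 * (D * D)" using cP1 D by (intro mult_right_mono) auto
  finally have "2 * D * (\<Sum>z\<in>P1. s z) \<le> 2 * D * (N\<^sup>2 * (D * D))" using D by (intro mult_left_mono) auto
  also have "\<dots> = 2 * (N ^ 5 / M ^ 4 * M ^ 7)" using Mpos by (simp add: D_def field_simps eval_nat_numeral)
  also have "\<dots> \<le> 2 * (N ^ 5 / M ^ 4 * N)" using MN[of 7] Npos Mpos by (intro mult_left_mono) auto
  also have "\<dots> = 2 * (N ^ 6 / M ^ 4)" by (simp add: eval_nat_numeral)
  finally have sD: "2 * D * (\<Sum>z\<in>P1. s z) \<le> 2 * (N ^ 6 / M ^ 4)" .
  have pos: "0 < N ^ 6 / M ^ 4" using Npos Mpos by simp
  have "N ^ 6 / M ^ 4 \<le> (\<Sum>z\<in>P1. (s z)\<^sup>2) - 2 * D * (\<Sum>z\<in>P1. s z)" using s2' sD pos by linarith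
  also have "\<dots> = (\<Sum>z\<in>P1. (s z)\<^sup>2 - 2 * D * s z)" by (simp add: sum_subtractf sum_distrib_left)
  also have "\<dots> \<le> (\<Sum>z\<in>P1. real (card {t \<in> P1 \<times> P1. good z t}))" by (intro sum_mono good)
  also have "\<dots> = (\<Sum>t\<in>P1 \<times> P1. real (card {z \<in> P1. good z t}))"
    using sum_card_swap[of P1 "P1 \<times> P1" good] P1 by (simp only: of_nat_sum[symmetric]) auto
  finally have avg: "N ^ 6 / M ^ 4 \<le> (\<Sum>t\<in>P1 \<times> P1. real (card {z \<in> P1. good z t}))" .
  have fPP: "finite (P1 \<times> P1)" using P1 by simp
  have "real (card P1) * real (card P1) \<le> N\<^sup>2 * N\<^sup>2" using cP1 by (intro mult_mono) auto
  then have cPP: "real (card (P1 \<times> P1)) \<le> N ^ 4" by (simp add: card_cartesian_product flip: power_add)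
  obtain t where t: "t \<in> P1 \<times> P1" "N ^ 6 / M ^ 4 / N ^ 4 \<le> card {z \<in> P1. good z t}"
    using exists_ge_average[OF fPP cPP pos avg] by blast
  obtain p1 p2 where p: "t = (p1, p2)" by (cases t)
  define Z where "Z = {z \<in> P1. good z (p1, p2)}"
  have "N ^ 6 / M ^ 4 / N ^ 4 = N\<^sup>2 / M ^ 4" using Npos by (simp add: field_simps eval_nat_numeral)
  then have cZ: "N\<^sup>2 / M ^ 4 \<le> card Z" using t p by (simp add: Z_def)
  moreover have "0 < N\<^sup>2 / M ^ 4" using Npos Mpos by simp
  ultimately have "card Z \<noteq> 0" by auto
  then obtain z where z: "z \<in> Z" by (metis card.empty ex_in_conv)
  have pP: "p1 \<in> P1" "p2 \<in> P1" using t p by auto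
  show ?thesis
  proof (rule that[of p1 p2 Q1 Z])
    show "p1 \<in> P" "p2 \<in> P" using pP P1 by auto
    show "x p1 \<noteq> x p2" using z by (simp add: Z_def good_def)
    show "card {l \<in> Q1. inc p1 l} \<le> N * M" "card {l \<in> Q1. inc p2 l} \<le> N * M"
      using pP by (simp_all add: P1_def deg_def D_def)
    show "Q1 \<subseteq> Q" "Z \<subseteq> P" "N\<^sup>2 / M ^ 4 \<le> card Z" using Q1 P1 cZ by (auto simp: Z_def)
    fix z assume "z \<in> Z"
    then show "8 * N / M \<le> card {l \<in> Q1. inc z l}" by (simp add: Z_def P1_def deg_def)
    from \<open>z \<in> Z\<close> have "p1 \<in> J z" "p2 \<in> J z" and nl: "\<not> (\<exists>l\<in>Q1. inc z l \<and> inc p1 l \<and> inc p2 l)"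
      by (simp_all add: Z_def good_def)
    then obtain l1 l2 where "l1 \<in> Q1" "inc z l1" "inc p1 l1" "l2 \<in> Q1" "inc z l2" "inc p2 l2" "z \<noteq> p1" "z \<noteq> p2"
      by (auto simp: J_def)
    with nl show "z \<noteq> p1 \<and> z \<noteq> p2 \<and>
       (\<exists>l1\<in>Q1. \<exists>l2\<in>Q1. l1 \<noteq> l2 \<and> inc z l1 \<and> inc p1 l1 \<and> inc z l2 \<and> inc p2 l2)" by metis
  qed
qed

section \<open>Projective normalisation of two pencils\<close>

context field
begin

lemma eq_mult_inv_iff:
  assumes "a \<in> carrier R" "b \<in> carrier R" "c \<in> carrier R" "b \<noteq> \<zero>"
  shows "a \<otimes> inv b = c \<longleftrightarrow> a = c \<otimes> b"
proof -
  have i: "inv b \<in> carrier R" "b \<otimes> inv b = \<one>" using assms by auto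
  have "a \<otimes> inv b \<otimes> b = a \<otimes> (b \<otimes> inv b)" "c \<otimes> b \<otimes> inv b = c \<otimes> (b \<otimes> inv b)" using assms i(1) by algebra+
  then show ?thesis using assms i by (metis r_one)
qed

lemma points_determine_line:
  assumes cl: "x \<in> carrier R" "x' \<in> carrier R" "m \<in> carrier R" "k \<in> carrier R" "m' \<in> carrier R" "k' \<in> carrier R"
    and x: "x \<noteq> x'" and e: "m \<otimes> x \<oplus> k = m' \<otimes> x \<oplus> k'" "m \<otimes> x' \<oplus> k = m' \<otimes> x' \<oplus> k'"
  shows "m = m' \<and> k = k'"
proof -
  have 1: "(m \<ominus> m') \<otimes> (x \<ominus> x') = ((m \<otimes> x \<oplus> k) \<ominus> (m \<otimes> x' \<oplus> k)) \<ominus> ((m' \<otimes> x \<oplus> k') \<ominus> (m' \<otimes> x' \<oplus> k'))"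
    using cl by algebra
  have "(m \<ominus> m') \<otimes> (x \<ominus> x') = \<zero>" unfolding 1 e using cl by algebra
  then have m: "m = m'" using x cl by (auto simp: integral_iff minus_eq_zero_iff)
  have "k = (m \<otimes> x \<oplus> k) \<ominus> m \<otimes> x" using cl by algebra
  also have "\<dots> = k'" unfolding e unfolding m using cl by algebra
  finally show ?thesis using m by simp
qed

lemma two_points_one_line:
  assumes "p \<in> carrier R \<times> carrier R" "p' \<in> carrier R \<times> carrier R" "l \<in> carrier R \<times> carrier R" "l' \<in> carrier R \<times> carrier R"
    and ne: "p \<noteq> p'" and e: "snd p = fst l \<otimes> fst p \<oplus> snd l" "snd p' = fst l \<otimes> fst p' \<oplus> snd l"
      "snd p = fst l' \<otimes> fst p \<oplus> snd l'" "snd p' = fst l' \<otimes> fst p' \<oplus> snd l'"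
  shows "l = l'"
proof -
  have "fst p \<noteq> fst p'" using ne e(1,2) by (auto simp: prod_eq_iff)
  then have "fst l = fst l' \<and> snd l = snd l'"
    by (rule points_determine_line[of "fst p" "fst p'", rotated 6]) (use assms(1-4) e in auto)
  then show ?thesis by (simp add: prod_eq_iff)
qed

text \<open>The projective map sending \<open>p1\<close> and \<open>p2\<close> to the points at infinity of the two axes
  turns the two pencils into the columns and rows of a grid.\<close>

theorem rich_incidences_subfield:
  fixes M N :: real
  assumes fin: "finite (carrier R)" and M: "4096 \<le> M" and N: "M ^ 5000 \<le> N"
    and PQ: "P \<subseteq> carrier R \<times> carrier R" "Q \<subseteq> carrier R \<times> carrier R" "card P \<le> N\<^sup>2" "card Q \<le> N\<^sup>2"
    and I: "40 * N ^ 3 / M \<le> (\<Sum>l\<in>Q. card {p \<in> P. snd p = fst l \<otimes> fst p \<oplus> snd l})"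
  obtains G \<Lambda> \<alpha> \<beta> \<gamma> where "subfield G R" "card G \<le> N * M ^ 2000" "\<Lambda> \<subseteq> G" "N / M ^ 55 \<le> card \<Lambda>"
    "\<alpha> \<in> carrier R" "\<alpha> \<noteq> \<zero>" "\<beta> \<in> carrier R" "\<gamma> \<in> carrier R"
    "\<And>g. g \<in> \<Lambda> \<Longrightarrow> \<beta> \<noteq> g \<and> \<gamma> \<oplus> \<alpha> \<otimes> inv (\<beta> \<ominus> g) \<in> fst ` P"
proof -
  have Mpos: "M > 0" and M1: "M \<ge> 1" using M by auto
  have MN: "M ^ k \<le> N" if "k \<le> 5000" for k using power_increasing[OF that M1] N by linarith
  have Npos: "N > 0" using N Mpos by (intro less_le_trans[OF zero_less_power N])
  have fP: "finite P" "finite Q" using PQ fin finite_subset by blast+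
  define inc where "inc = (\<lambda>p l. snd p = fst l \<otimes> fst p \<oplus> snd l)"
  have two: "l = l'" if "p \<in> P" "p' \<in> P" "p \<noteq> p'" "l \<in> Q" "l' \<in> Q" "inc p l" "inc p' l" "inc p l'" "inc p' l'" for p p' l l'
    using two_points_one_line[of p p' l l'] that PQ(1,2) unfolding inc_def by blast
  have x: "p = p'" if "inc p l" "inc p' l" "fst p = fst p'" for p p' l
    using that by (simp add: inc_def prod_eq_iff)
  have M8: "M ^ 8 \<le> N" using MN by simp
  have I': "40 * N ^ 3 / M \<le> (\<Sum>l\<in>Q. card {p \<in> P. inc p l})" using I by (simp add: inc_def)
  obtain p1 p2 Q1 Z where p: "p1 \<in> P" "p2 \<in> P" "fst p1 \<noteq> fst p2" and Q1: "Q1 \<subseteq> Q" and Z: "Z \<subseteq> P" "N\<^sup>2 / M ^ 4 \<le> card Z"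
    and deg: "card {l \<in> Q1. inc p1 l} \<le> N * M" "card {l \<in> Q1. inc p2 l} \<le> N * M"
    and degZ: "\<And>z. z \<in> Z \<Longrightarrow> 8 * N / M \<le> card {l \<in> Q1. inc z l}"
    and ZJ: "\<And>z. z \<in> Z \<Longrightarrow> z \<noteq> p1 \<and> z \<noteq> p2 \<and>
       (\<exists>l1\<in>Q1. \<exists>l2\<in>Q1. l1 \<noteq> l2 \<and> inc z l1 \<and> inc p1 l1 \<and> inc z l2 \<and> inc p2 l2)"
  proof (rule two_rich_pencils[OF fP PQ(3,4) _ _ M M8 I', where x = fst])
    show "\<And>p p' l l'. \<lbrakk>p \<in> P; p' \<in> P; p \<noteq> p'; l \<in> Q; l' \<in> Q; inc p l; inc p' l; inc p l'; inc p' l'\<rbrakk> \<Longrightarrow> l = l'"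
      by (fact two)
    show "\<And>p p' l. \<lbrakk>p \<in> P; p' \<in> P; l \<in> Q; inc p l; inc p' l; fst p = fst p'\<rbrakk> \<Longrightarrow> p = p'"
      by (rule x)
  qed (rule that)
  have fQ1: "finite Q1" using Q1 fP finite_subset by blast
  define a1 b1 a2 b2 where "a1 = fst p1" and "b1 = snd p1" and "a2 = fst p2" and "b2 = snd p2"
  have ab: "a1 \<in> carrier R" "b1 \<in> carrier R" "a2 \<in> carrier R" "b2 \<in> carrier R"
    using p(1,2) PQ(1) by (auto simp: a1_def b1_def a2_def b2_def)
  define d where "d = a2 \<ominus> a1"
  have d: "d \<in> carrier R" "d \<noteq> \<zero>" using ab p(3) by (auto simp: d_def minus_eq_zero_iff a1_def a2_def)
  \<comment> \<open>Affine coordinates with p1 at (0, 0) and p2 at (1, 0): u runs along the line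
    p1p2 and w is the vertical height above it. The heights of a line l over p1 and p2 are e1 and
    e2, so on l one has w = e1 + (e2 - e1)u.\<close>
  define u where "u z = (fst z \<ominus> a1) \<otimes> inv d" for z :: "'a \<times> 'a"
  define w where "w z = snd z \<ominus> b1 \<ominus> (b2 \<ominus> b1) \<otimes> u z" for z
  define e1 where "e1 l = fst l \<otimes> a1 \<oplus> snd l \<ominus> b1" for l
  define e2 where "e2 l = fst l \<otimes> a2 \<oplus> snd l \<ominus> b2" for l
  have Zc: "fst z \<in> carrier R" "snd z \<in> carrier R" if "z \<in> Z" for z using that Z PQ(1) by auto
  have lc: "fst l \<in> carrier R" "snd l \<in> carrier R" if "l \<in> Q1" for l using that Q1 PQ(2) by auto
  have uc: "u z \<in> carrier R" "fst z = a1 \<oplus> d \<otimes> u z" if "z \<in> Z" for z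
  proof -
    have id: "inv d \<in> carrier R" "d \<otimes> inv d = \<one>" using d by auto
    show "u z \<in> carrier R" using Zc[OF that] id ab by (simp add: u_def)
    have "a1 \<oplus> d \<otimes> u z = a1 \<oplus> (d \<otimes> inv d) \<otimes> (fst z \<ominus> a1)" unfolding u_def using Zc[OF that] id(1) ab d(1) by algebra
    also have "\<dots> = fst z" unfolding id(2) using Zc[OF that] ab by algebra
    finally show "fst z = a1 \<oplus> d \<otimes> u z" by simp
  qed
  have wc: "w z \<in> carrier R" if "z \<in> Z" for z using uc Zc that ab by (simp add: w_def)
  have ec: "e1 l \<in> carrier R" "e2 l \<in> carrier R" if "l \<in> Q1" for l using lc[OF that] ab by (simp_all add: e1_def e2_def)
  have w_line: "w z = e1 l \<oplus> (e2 l \<ominus> e1 l) \<otimes> u z" if "z \<in> Z" "l \<in> Q1" "inc z l" for z l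
  proof -
    have s: "snd z = fst l \<otimes> (a1 \<oplus> d \<otimes> u z) \<oplus> snd l" using that uc by (simp add: inc_def)
    show ?thesis unfolding w_def s d_def e1_def e2_def using lc[OF that(2)] ab uc(1)[OF that(1)] by algebra
  qed
  have inc1: "inc p1 l \<longleftrightarrow> e1 l = \<zero>" and inc2: "inc p2 l \<longleftrightarrow> e2 l = \<zero>" if "l \<in> Q1" for l
    using lc[OF that] ab by (auto simp: inc_def e1_def e2_def minus_eq_zero_iff a1_def b1_def a2_def b2_def)
  have u0: "u z \<noteq> \<zero>" and w0: "w z \<noteq> \<zero>" and X_z: "\<exists>l\<in>Q1. inc p1 l \<and> e2 l \<noteq> \<zero> \<and> u z \<otimes> inv (w z) = inv (e2 l)"
    and Y_z: "\<exists>l\<in>Q1. inc p2 l \<and> e1 l \<noteq> \<zero> \<and> (u z \<ominus> \<one>) \<otimes> inv (w z) = \<ominus> (inv (e1 l))" if z: "z \<in> Z" for z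
  proof -
    obtain l1 l2 where l: "l1 \<in> Q1" "l2 \<in> Q1" "l1 \<noteq> l2" "inc z l1" "inc p1 l1" "inc z l2" "inc p2 l2" "z \<noteq> p1" "z \<noteq> p2"
      using ZJ[OF z] by blast
    have ne: "fst z \<noteq> a1" "fst z \<noteq> a2" using x[OF l(4,5)] x[OF l(6,7)] l(8,9) unfolding a1_def a2_def by blast+
    show u: "u z \<noteq> \<zero>"
    proof
      assume "u z = \<zero>"
      then show False using uc(2)[OF z] ne ab d by simp
    qed
    have u1: "\<one> \<ominus> u z \<noteq> \<zero>"
    proof
      assume "\<one> \<ominus> u z = \<zero>"
      then have "u z = \<one>" using uc[OF z] by (simp add: minus_eq_zero_iff)
      then have "fst z = a1 \<oplus> (a2 \<ominus> a1) \<otimes> \<one>" using uc(2)[OF z] by (simp add: d_def)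
      also have "\<dots> = a2" using ab by algebra
      finally show False using ne by simp
    qed
    have e1l: "e1 l1 = \<zero>" "e2 l2 = \<zero>" using inc1 inc2 l by auto
    have w1: "w z = e2 l1 \<otimes> u z" using w_line[OF z l(1,4)] ec[OF l(1)] uc[OF z] by (simp add: e1l a_minus_def)
    have w2: "w z = e1 l2 \<otimes> (\<one> \<ominus> u z)"
      unfolding w_line[OF z l(2,6)] e1l using ec[OF l(2)] uc[OF z] by algebra
    \<comment> \<open>If both vanished, l1 and l2 would each pass through p1 and p2 and coincide. So
      z is off the line p1p2 and w(z) is invertible.\<close>
    have "e2 l1 \<noteq> \<zero> \<or> e1 l2 \<noteq> \<zero>"
    proof (rule ccontr)
      assume "\<not> ?thesis"
      then have "inc p2 l1" "inc p1 l2" using inc1 inc2 l by auto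
      then show False using two[of p1 p2 l1 l2] p l Q1 by auto
    qed
    then show w: "w z \<noteq> \<zero>"
      using w1 w2 u u1 ec[OF l(1)] ec[OF l(2)] uc[OF z] by (metis integral minus_closed one_closed)
    then have e: "e2 l1 \<noteq> \<zero>" "e1 l2 \<noteq> \<zero>" using w1 w2 uc[OF z] by auto
    have ie: "inv (e2 l1) \<in> carrier R" "inv (e2 l1) \<otimes> e2 l1 = \<one>" "inv (e1 l2) \<in> carrier R" "inv (e1 l2) \<otimes> e1 l2 = \<one>"
      using e ec[OF l(1)] ec[OF l(2)] by auto
    have "inv (e2 l1) \<otimes> w z = (inv (e2 l1) \<otimes> e2 l1) \<otimes> u z" unfolding w1 using ie(1) ec[OF l(1)] uc(1)[OF z] by algebra
    then have "u z \<otimes> inv (w z) = inv (e2 l1)" using eq_mult_inv_iff w wc[OF z] ie uc[OF z] by simp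
    then show "\<exists>l\<in>Q1. inc p1 l \<and> e2 l \<noteq> \<zero> \<and> u z \<otimes> inv (w z) = inv (e2 l)" using l e by blast
    have "\<ominus> (inv (e1 l2)) \<otimes> w z = (inv (e1 l2) \<otimes> e1 l2) \<otimes> (u z \<ominus> \<one>)" unfolding w2 using ie(3) ec[OF l(2)] uc(1)[OF z] by algebra
    then have "(u z \<ominus> \<one>) \<otimes> inv (w z) = \<ominus> (inv (e1 l2))" using eq_mult_inv_iff w wc[OF z] ie uc[OF z] by simp
    then show "\<exists>l\<in>Q1. inc p2 l \<and> e1 l \<noteq> \<zero> \<and> (u z \<ominus> \<one>) \<otimes> inv (w z) = \<ominus> (inv (e1 l))" using l e by blast
  qed
  define X where "X = (\<lambda>l. inv (e2 l)) ` {l \<in> Q1. inc p1 l \<and> e2 l \<noteq> \<zero>}"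
  define Y where "Y = (\<lambda>l. \<ominus> (inv (e1 l))) ` {l \<in> Q1. inc p2 l \<and> e1 l \<noteq> \<zero>}"
  \<comment> \<open>The map (u/w, (u-1)/w) sends w = 0 to infinity. On a line through p1 the
    relation w = e2 u makes the first coordinate constant; on a line through p2, w = e1 (1-u) makes
    the second constant. Any line with e2 nonzero becomes X = (e1/e2) Y + 1/e2. The difference of
    the coordinates is 1/w, which recovers z.\<close>
  define \<phi> where "\<phi> z = (u z \<otimes> inv (w z), (u z \<ominus> \<one>) \<otimes> inv (w z))" for z
  define L where "L = (\<lambda>l. (e1 l \<otimes> inv (e2 l), inv (e2 l))) ` {l \<in> Q1. e2 l \<noteq> \<zero>}"
  have XY: "X \<subseteq> carrier R" "Y \<subseteq> carrier R" using ec by (auto simp: X_def Y_def)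
  have "card X \<le> card {l \<in> Q1. inc p1 l \<and> e2 l \<noteq> \<zero>}" "card Y \<le> card {l \<in> Q1. inc p2 l \<and> e1 l \<noteq> \<zero>}"
    unfolding X_def Y_def using fQ1 by (auto intro: card_image_le)
  moreover have "card {l \<in> Q1. inc p1 l \<and> e2 l \<noteq> \<zero>} \<le> card {l \<in> Q1. inc p1 l}"
    "card {l \<in> Q1. inc p2 l \<and> e1 l \<noteq> \<zero>} \<le> card {l \<in> Q1. inc p2 l}"
    using fQ1 by (auto intro: card_mono)
  ultimately have cXY: "card X \<le> N * M" "card Y \<le> N * M" using deg by linarith+
  have ZXY: "\<phi> ` Z \<subseteq> X \<times> Y"
  proof
    fix q assume "q \<in> \<phi> ` Z"
    then obtain z where z: "z \<in> Z" "q = \<phi> z" by blast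
    then show "q \<in> X \<times> Y" using X_z[OF z(1)] Y_z[OF z(1)] by (auto simp: \<phi>_def X_def Y_def)
  qed
  have \<phi>_diff: "fst (\<phi> z) \<ominus> snd (\<phi> z) = inv (w z)" if "z \<in> Z" for z
  proof -
    have "inv (w z) \<in> carrier R" using w0 wc that by simp
    then show ?thesis unfolding \<phi>_def fst_conv snd_conv using uc(1)[OF that] by algebra
  qed
  have \<phi>_u: "u z = fst (\<phi> z) \<otimes> w z" if "z \<in> Z" for z
  proof -
    have i: "inv (w z) \<in> carrier R" "inv (w z) \<otimes> w z = \<one>" using w0 wc that by auto
    have "fst (\<phi> z) \<otimes> w z = u z \<otimes> (inv (w z) \<otimes> w z)" unfolding \<phi>_def fst_conv using i(1) uc(1)[OF that] wc[OF that] by algebra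
    then show ?thesis using i uc[OF that] by simp
  qed
  have "inj_on \<phi> Z"
  proof (rule inj_onI)
    fix z z' assume z: "z \<in> Z" "z' \<in> Z" "\<phi> z = \<phi> z'"
    have i: "inv (w z) \<in> carrier R" "w z \<otimes> inv (w z) = \<one>" "inv (w z') \<in> carrier R" "w z' \<otimes> inv (w z') = \<one>"
      using w0 wc z by auto
    have ie: "inv (w z) = inv (w z')" using \<phi>_diff[OF z(1)] \<phi>_diff[OF z(2)] z(3) by simp
    have "w z = w z \<otimes> (w z' \<otimes> inv (w z'))" using i wc z by simp
    also have "\<dots> = w z' \<otimes> (w z \<otimes> inv (w z'))" using i(3) wc[OF z(1)] wc[OF z(2)] by algebra
    also have "\<dots> = w z'" using i wc[OF z(2)] unfolding ie[symmetric] by simp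
    finally have ww: "w z = w z'" .
    then have uu: "u z = u z'" using \<phi>_u[OF z(1)] \<phi>_u[OF z(2)] z(3) by simp
    have "snd z = w z \<oplus> b1 \<oplus> (b2 \<ominus> b1) \<otimes> u z" unfolding w_def using Zc[OF z(1)] uc(1)[OF z(1)] ab by algebra
    moreover have "snd z' = w z' \<oplus> b1 \<oplus> (b2 \<ominus> b1) \<otimes> u z'" unfolding w_def using Zc[OF z(2)] uc(1)[OF z(2)] ab by algebra
    ultimately show "z = z'" using ww uu uc(2)[OF z(1)] uc(2)[OF z(2)] by (simp add: prod_eq_iff)
  qed
  then have c\<phi>: "N\<^sup>2 / M ^ 4 \<le> card (\<phi> ` Z)" using Z(2) by (simp add: card_image)
  have Lc: "L \<subseteq> carrier R \<times> carrier R" using ec by (auto simp: L_def)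
  have "card L \<le> card {l \<in> Q1. e2 l \<noteq> \<zero>}" unfolding L_def using fQ1 by (auto intro: card_image_le)
  also have "\<dots> \<le> card Q" using fP Q1 by (intro card_mono) auto
  finally have cL: "card L \<le> N\<^sup>2" using PQ(4) by linarith
  have inj: "inj_on (\<lambda>l. (e1 l \<otimes> inv (e2 l), inv (e2 l))) {l \<in> Q1. e2 l \<noteq> \<zero>}"
  proof (rule inj_onI)
    fix l l' assume l: "l \<in> {l \<in> Q1. e2 l \<noteq> \<zero>}" "l' \<in> {l \<in> Q1. e2 l \<noteq> \<zero>}"
      "(e1 l \<otimes> inv (e2 l), inv (e2 l)) = (e1 l' \<otimes> inv (e2 l'), inv (e2 l'))"
    then have q: "l \<in> Q1" "l' \<in> Q1" "e2 l \<noteq> \<zero>" "e2 l' \<noteq> \<zero>" by auto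
    have i: "inv (e2 l) \<in> carrier R" "inv (e2 l) \<noteq> \<zero>" "e2 l \<otimes> inv (e2 l) = \<one>" "e2 l' \<otimes> inv (e2 l') = \<one>"
      using q ec inv_nonzero by auto
    have e: "e2 l \<otimes> inv (e2 l) = e2 l' \<otimes> inv (e2 l)" "e1 l \<otimes> inv (e2 l) = e1 l' \<otimes> inv (e2 l)"
    proof -
      have j: "inv (e2 l) = inv (e2 l')" "e1 l \<otimes> inv (e2 l) = e1 l' \<otimes> inv (e2 l')"
        using l(3) by (metis Pair_inject)+
      show "e2 l \<otimes> inv (e2 l) = e2 l' \<otimes> inv (e2 l)" using i(3,4) unfolding j(1) by metis
      show "e1 l \<otimes> inv (e2 l) = e1 l' \<otimes> inv (e2 l)" using j by metis
    qed
    then have ee: "e2 l = e2 l'" "e1 l = e1 l'"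
      using m_rcancel[OF i(2,1) ec(2)[OF q(1)] ec(2)[OF q(2)]] m_rcancel[OF i(2,1) ec(1)[OF q(1)] ec(1)[OF q(2)]] by blast+
    have 1: "fst l'' \<otimes> a1 \<oplus> snd l'' = e1 l'' \<oplus> b1" "fst l'' \<otimes> a2 \<oplus> snd l'' = e2 l'' \<oplus> b2" if "l'' \<in> Q1" for l''
      unfolding e1_def e2_def using lc[OF that] ab by algebra+
    show "l = l'"
      using points_determine_line[of a1 a2 "fst l" "snd l" "fst l'" "snd l'"] 1[OF q(1)] 1[OF q(2)] ee ab lc q p(3)
      by (auto simp: prod_eq_iff a1_def a2_def)
  qed
  have degL: "N / M \<le> card {l \<in> L. fst q = fst l \<otimes> snd q \<oplus> snd l}" if q: "q \<in> \<phi> ` Z" for q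
  proof -
    obtain z where z: "z \<in> Z" "q = \<phi> z" using q by blast
    let ?S = "{l \<in> Q1. inc z l \<and> e2 l \<noteq> \<zero>}"
    have "(\<lambda>l. (e1 l \<otimes> inv (e2 l), inv (e2 l))) ` ?S \<subseteq> {l \<in> L. fst q = fst l \<otimes> snd q \<oplus> snd l}"
    proof
      fix l' assume "l' \<in> (\<lambda>l. (e1 l \<otimes> inv (e2 l), inv (e2 l))) ` ?S"
      then obtain l where l: "l \<in> Q1" "inc z l" "e2 l \<noteq> \<zero>" and l': "l' = (e1 l \<otimes> inv (e2 l), inv (e2 l))"
        by blast
      have i: "inv (e2 l) \<in> carrier R" "e2 l \<otimes> inv (e2 l) = \<one>" "inv (w z) \<in> carrier R" "w z \<otimes> inv (w z) = \<one>"
        using l ec w0 wc z by auto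
      have cl: "e1 l \<in> carrier R" "e2 l \<in> carrier R" "u z \<in> carrier R" "w z \<in> carrier R" using l ec uc wc z by auto
      have "e1 l \<otimes> inv (e2 l) \<otimes> snd q \<oplus> inv (e2 l)
          = inv (e2 l) \<otimes> inv (w z) \<otimes> (e1 l \<otimes> (u z \<ominus> \<one>) \<oplus> w z) \<oplus> inv (e2 l) \<otimes> (\<one> \<ominus> w z \<otimes> inv (w z))"
        unfolding z(2) \<phi>_def snd_conv using cl i(1,3) by algebra
      also have "\<dots> = inv (e2 l) \<otimes> inv (w z) \<otimes> (e1 l \<otimes> (u z \<ominus> \<one>) \<oplus> w z)"
        unfolding i(4) using cl i(1,3) by algebra
      also have "e1 l \<otimes> (u z \<ominus> \<one>) \<oplus> w z = e2 l \<otimes> u z"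
        unfolding w_line[OF z(1) l(1,2)] using cl by algebra
      also have "inv (e2 l) \<otimes> inv (w z) \<otimes> (e2 l \<otimes> u z) = (e2 l \<otimes> inv (e2 l)) \<otimes> (u z \<otimes> inv (w z))"
        using cl i(1,3) by algebra
      also have "\<dots> = fst q" unfolding i(2) using cl i(3) by (simp add: z(2) \<phi>_def)
      finally have "fst q = e1 l \<otimes> inv (e2 l) \<otimes> snd q \<oplus> inv (e2 l)" by simp
      moreover have "l' \<in> L" using l unfolding L_def l' by blast
      ultimately show "l' \<in> {l \<in> L. fst q = fst l \<otimes> snd q \<oplus> snd l}" by (simp add: l')
    qed
    then have "card ((\<lambda>l. (e1 l \<otimes> inv (e2 l), inv (e2 l))) ` ?S) \<le> card {l \<in> L. fst q = fst l \<otimes> snd q \<oplus> snd l}"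
      using fQ1 by (intro card_mono) (auto simp: L_def)
    moreover have "card ((\<lambda>l. (e1 l \<otimes> inv (e2 l), inv (e2 l))) ` ?S) = card ?S"
      by (intro card_image inj_on_subset[OF inj]) auto
    \<comment> \<open>Only a line through p2 has no equation of the required form. There is at most
      one through z, a loss covered by the surplus in 8N/M.\<close>
    moreover have "card {l \<in> Q1. inc z l} \<le> card ?S + 1"
    proof -
      have "card {l \<in> Q1. inc z l \<and> inc p2 l} \<le> Suc 0"
      proof (subst card_le_Suc0_iff_eq)
        have "z \<in> P" "z \<noteq> p2" using ZJ[OF z(1)] z(1) Z(1) by auto
        then show "\<forall>l\<in>{l \<in> Q1. inc z l \<and> inc p2 l}. \<forall>l'\<in>{l \<in> Q1. inc z l \<and> inc p2 l}. l = l'"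
          using two p(2) Q1 by blast
      qed (use fQ1 in simp)
      moreover have "{l \<in> Q1. inc z l} \<subseteq> ?S \<union> {l \<in> Q1. inc z l \<and> inc p2 l}" using inc2 by auto
      then have "card {l \<in> Q1. inc z l} \<le> card (?S \<union> {l \<in> Q1. inc z l \<and> inc p2 l})" using fQ1 by (intro card_mono) auto
      then have "card {l \<in> Q1. inc z l} \<le> card ?S + card {l \<in> Q1. inc z l \<and> inc p2 l}"
        using card_Un_le order_trans by blast
      ultimately show ?thesis by linarith
    qed
    moreover have "1 \<le> N / M" using MN[of 1] Mpos by simp
    moreover have "8 * N / M = 8 * (N / M)" by simp
    ultimately show ?thesis using degZ[OF z(1)] by linarith
  qed
  obtain G x0 y0 e \<Lambda> where G: "subfield G R" "card G \<le> N * M ^ 2000" "\<Lambda> \<subseteq> G" "N / M ^ 55 \<le> card \<Lambda>"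
    "y0 \<in> carrier R" "e \<in> carrier R" "e \<noteq> \<zero>" "\<And>g. g \<in> \<Lambda> \<Longrightarrow> (x0, y0 \<oplus> e \<otimes> g) \<in> \<phi> ` Z"
    by (rule grid_incidences[OF fin M N XY cXY ZXY c\<phi> Lc cL degL], assumption, rule that)
  have "0 < N / M ^ 55" using Npos Mpos by simp
  then have "card \<Lambda> \<noteq> 0" using G(4) by auto
  then obtain g0 where g0: "g0 \<in> \<Lambda>" by (metis card.empty ex_in_conv)
  have Gc: "G \<subseteq> carrier R" using G(1) subfieldE(3) by blast
  have x0c: "x0 \<in> carrier R" using G(8)[OF g0] ZXY XY by auto
  have x0: "x0 \<noteq> \<zero>"
  proof
    assume "x0 = \<zero>"
    obtain z where "z \<in> Z" "\<phi> z = (x0, y0 \<oplus> e \<otimes> g0)" using G(8)[OF g0] by force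
    then show False using \<phi>_u[of z] u0[of z] wc[of z] \<open>x0 = \<zero>\<close> by simp
  qed
  \<comment> \<open>On the column X = x0 the row Y = y0 + eg satisfies 1/w = X - Y = e(\<beta> - g).
    Since u = x0 w, the original abscissa a1 + du equals a1 + \<alpha> / (\<beta> - g): the Moebius
    image of g.\<close>
  define \<alpha> where "\<alpha> = d \<otimes> x0 \<otimes> inv e"
  define \<beta> where "\<beta> = (x0 \<ominus> y0) \<otimes> inv e"
  have ie: "inv e \<in> carrier R" "e \<otimes> inv e = \<one>" using G by auto
  have \<alpha>: "\<alpha> \<in> carrier R" "\<alpha> \<noteq> \<zero>" using d x0 x0c G(6,7) inv_nonzero by (auto simp: \<alpha>_def integral_iff)
  have \<beta>: "\<beta> \<in> carrier R" using x0c G(5) ie by (simp add: \<beta>_def)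
  have e\<beta>: "e \<otimes> \<beta> = x0 \<ominus> y0"
  proof -
    have "e \<otimes> \<beta> = (e \<otimes> inv e) \<otimes> (x0 \<ominus> y0)" unfolding \<beta>_def using x0c G(5,6) ie(1) by algebra
    then show ?thesis using ie x0c G(5) by simp
  qed
  have e\<alpha>: "e \<otimes> \<alpha> = d \<otimes> x0"
  proof -
    have "e \<otimes> \<alpha> = (e \<otimes> inv e) \<otimes> (d \<otimes> x0)" unfolding \<alpha>_def using x0c d(1) G(6) ie(1) by algebra
    then show ?thesis using ie x0c d by simp
  qed
  have "\<beta> \<noteq> g \<and> a1 \<oplus> \<alpha> \<otimes> inv (\<beta> \<ominus> g) \<in> fst ` P" if g: "g \<in> \<Lambda>" for g
  proof -
    have gc: "g \<in> carrier R" using g G(3) Gc by auto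
    obtain z where z: "z \<in> Z" "\<phi> z = (x0, y0 \<oplus> e \<otimes> g)" using G(8)[OF g] by force
    have iw: "inv (w z) \<in> carrier R" "w z \<otimes> inv (w z) = \<one>" "inv (w z) \<noteq> \<zero>" using z wc w0 inv_nonzero by auto
    have "inv (w z) = x0 \<ominus> (y0 \<oplus> e \<otimes> g)" using \<phi>_diff[OF z(1)] z(2) by simp
    also have "\<dots> = (x0 \<ominus> y0) \<ominus> e \<otimes> g" using x0c gc G(5,6) by algebra
    also have "\<dots> = e \<otimes> (\<beta> \<ominus> g)" unfolding e\<beta>[symmetric] using \<beta> gc G(6) by algebra
    finally have w: "inv (w z) = e \<otimes> (\<beta> \<ominus> g)" .
    have nz: "\<beta> \<ominus> g \<noteq> \<zero>" using w iw G(6) by auto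
    have "\<alpha> = \<alpha> \<otimes> (w z \<otimes> inv (w z))" using iw \<alpha> by simp
    also have "\<dots> = (e \<otimes> \<alpha>) \<otimes> w z \<otimes> (\<beta> \<ominus> g)" unfolding w using wc[OF z(1)] \<alpha>(1) \<beta> gc G(6) by algebra
    also have "\<dots> = d \<otimes> (x0 \<otimes> w z) \<otimes> (\<beta> \<ominus> g)" unfolding e\<alpha> using wc[OF z(1)] \<beta> gc d(1) x0c by algebra
    also have "x0 \<otimes> w z = u z" using \<phi>_u[OF z(1)] z(2) by simp
    finally have "\<alpha> \<otimes> inv (\<beta> \<ominus> g) = d \<otimes> u z"
      using eq_mult_inv_iff[of \<alpha> "\<beta> \<ominus> g" "d \<otimes> u z"] \<alpha> \<beta> gc nz d uc[OF z(1)] by simp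
    then have "a1 \<oplus> \<alpha> \<otimes> inv (\<beta> \<ominus> g) = fst z" using uc(2)[OF z(1)] by simp
    moreover have "fst z \<in> fst ` P" using z Z by auto
    moreover have "\<beta> \<noteq> g" using nz gc \<beta> by (auto simp: minus_eq_zero_iff)
    ultimately show ?thesis by simp
  qed
  then show ?thesis using that[of G \<Lambda> \<alpha> \<beta> a1] G \<alpha> \<beta> ab by blast
qed

section \<open>Subfields, cosets and Moebius images\<close>

lemma subfield_closed:
  assumes K: "subfield K R"
  shows "K \<subseteq> carrier R" "\<zero> \<in> K" "\<one> \<in> K" "a \<in> K \<Longrightarrow> b \<in> K \<Longrightarrow> a \<oplus> b \<in> K" "a \<in> K \<Longrightarrow> b \<in> K \<Longrightarrow> a \<ominus> b \<in> K"
    "a \<in> K \<Longrightarrow> b \<in> K \<Longrightarrow> a \<otimes> b \<in> K" "a \<in> K \<Longrightarrow> a \<noteq> \<zero> \<Longrightarrow> inv a \<in> K"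
proof -
  note E = subringE[OF subfieldE(1)[OF K]]
  show "K \<subseteq> carrier R" "\<zero> \<in> K" "\<one> \<in> K" by (fact E)+
  show "a \<in> K \<Longrightarrow> b \<in> K \<Longrightarrow> a \<oplus> b \<in> K" "a \<in> K \<Longrightarrow> b \<in> K \<Longrightarrow> a \<otimes> b \<in> K" by (rule E; assumption)+
  show "a \<in> K \<Longrightarrow> b \<in> K \<Longrightarrow> a \<ominus> b \<in> K" unfolding a_minus_def by (intro E)
  show "a \<in> K \<Longrightarrow> a \<noteq> \<zero> \<Longrightarrow> inv a \<in> K" using subfield_m_inv(1)[OF K, of a] by blast
qed

lemma subfield_mult_cancel:
  assumes K: "subfield K R" and a: "a \<in> K" "a \<noteq> \<zero>" and b: "b \<in> carrier R" and ab: "a \<otimes> b \<in> K"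
  shows "b \<in> K"
  using subfield_m_inv_simprule[OF K _ b ab] a by blast

text \<open>Lagrange in the additive group gives |G| = p^i with i <= 4; in the multiplicative group
  it gives p^i - 1 | p^4 - 1. For i = 3 the remainder p - 1 would be divisible by p^3 - 1.\<close>

lemma card_subfield_prime_power:
  assumes p: "prime p" and fin: "card (carrier R) = p ^ 4" and G: "subfield G R"
  shows "card G \<le> p \<or> card G = p\<^sup>2 \<or> card G = p ^ 4"
proof -
  have fR: "finite (carrier R)" using fin p by (metis card_gt_0_iff prime_gt_0_nat zero_less_power)
  note Gc = subfield_closed[OF G]
  have "subgroup G (add_monoid R)"
    using subring.axioms(1)[OF subfieldE(1)[OF G]] .
  then have "card G dvd order (add_monoid R)" using add.lagrange by (metis dvd_triv_right)
  then have "card G dvd p ^ 4" using fin by (simp add: order_def)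
  then obtain i where i: "i \<le> 4" "card G = p ^ i" using divides_primepow_nat[OF p] by blast
  interpret M: group "mult_of R" by (rule field_mult_group)
  have "subgroup (G - {\<zero>}) (mult_of R)"
  proof (rule M.subgroupI)
    show "inv\<^bsub>mult_of R\<^esub> a \<in> G - {\<zero>}" if "a \<in> G - {\<zero>}" for a
      using that Gc(1) m_inv_mult_of[of a] subfield_m_inv(1)[OF G that] by auto
    show "G - {\<zero>} \<noteq> {}" using Gc(3) by auto
  qed (use Gc(1,6) in \<open>auto simp: integral_iff subset_iff\<close>)
  then have "card (G - {\<zero>}) dvd order (mult_of R)" using M.lagrange by (metis dvd_triv_right)
  then have d: "p ^ i - 1 dvd p ^ 4 - 1" using i(2) Gc(2) order_mult_of[OF fR] fin
    by (simp add: order_def card_Diff_singleton_if)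
  have p2: "2 \<le> p" using p by (rule prime_ge_2_nat)
  have "i \<noteq> 3"
  proof
    assume "i = 3"
    then have "p ^ 3 - 1 dvd p ^ 4 - 1" using d by simp
    moreover have "p ^ 4 - 1 = p * (p ^ 3 - 1) + (p - 1)"
      using p2 by (simp add: diff_mult_distrib2 eval_nat_numeral)
    ultimately have "p ^ 3 - 1 dvd p - 1" by (metis dvd_add_right_iff dvd_triv_right)
    then have "p ^ 3 - 1 \<le> p - 1" using p2 by (intro dvd_imp_le) auto
    moreover have "p < p ^ 3" using p2 by (metis one_less_numeral_iff power_one_right power_strict_increasing_iff semiring_norm(77) One_nat_def Suc_le_eq numeral_2_eq_2)
    ultimately show False using p2 by arith
  qed
  then have "i = 0 \<or> i = 1 \<or> i = 2 \<or> i = 4" using i(1) by linarith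
  then show ?thesis using i(2) p2 by auto
qed

text \<open>With k the common order, the nonzero elements of either subfield are roots of x^(k-1) =
  1. There are at most k - 1 roots, so both sets are the full root set.\<close>

lemma subfields_eq:
  assumes fin: "finite (carrier R)" and G: "subfield G R" and K: "subfield K R" and c: "card G = card K"
  shows "G = K"
proof -
  have pow: "x [^] (card H - 1) = \<one>" if H: "subfield H R" and x: "x \<in> H - {\<zero>}" for H x
  proof -
    have fH: "finite H" using subfieldE(3)[OF H] fin finite_subset by blast
    interpret H: field "R\<lparr>carrier := H\<rparr>" by (rule subfield_iff(2)[OF H])
    interpret HM: group "mult_of (R\<lparr>carrier := H\<rparr>)" by (rule H.field_mult_group)
    have "x [^]\<^bsub>mult_of (R\<lparr>carrier := H\<rparr>)\<^esub> order (mult_of (R\<lparr>carrier := H\<rparr>)) = \<one>\<^bsub>mult_of (R\<lparr>carrier := H\<rparr>)\<^esub>"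
      by (rule HM.pow_order_eq_1) (use x in auto)
    then show ?thesis using H.order_mult_of fH
      by (simp add: nat_pow_mult_of order_def) (simp add: nat_pow_def)
  qed
  have fG: "finite G" "finite K" using subfield_closed(1)[OF G] subfield_closed(1)[OF K] fin finite_subset by blast+
  let ?S = "{x \<in> carrier R. x [^] (card K - 1) = \<one>}"
  have "card {\<zero>, \<one>} \<le> card K" using subfield_closed(2,3)[OF K] fG by (intro card_mono) auto
  then have k: "card K - 1 \<noteq> 0" by auto
  have cS: "card ?S \<le> card K - 1" by (rule num_roots_le_deg[OF fin k])
  have sub: "G - {\<zero>} \<subseteq> ?S" "K - {\<zero>} \<subseteq> ?S"
    using pow[OF G] pow[OF K] c subfield_closed(1)[OF G] subfield_closed(1)[OF K] by auto
  have "finite ?S" using fin by auto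
  moreover have "card (G - {\<zero>}) = card K - 1" "card (K - {\<zero>}) = card K - 1"
    using c fG subfield_closed(2)[OF G] subfield_closed(2)[OF K] by (simp_all add: card_Diff_singleton_if)
  ultimately have "G - {\<zero>} = ?S" "K - {\<zero>} = ?S" using sub cS by (metis (no_types, lifting) card_seteq)+
  then show ?thesis using subfield_closed(2)[OF G] subfield_closed(2)[OF K] by blast
qed

text \<open>With h_i = \<beta> - g_i, the difference f(g1) - f(g_i) is (g1 - g_i) \<alpha> / (h1
  h_i). So q2 = \<alpha> / (h1 h2) and q3 = \<alpha> / (h1 h3) lie in K. The relations q2 h2 = q3 h3
  and h3 - h2 = g2 - g3 determine h2 over K, which gives \<beta>, and then \<alpha> = q2 h1
  h2.\<close>

lemma moebius_coset:
  assumes K: "subfield K R" and cl: "\<alpha> \<in> carrier R" "\<alpha> \<noteq> \<zero>" "\<beta> \<in> carrier R" "\<gamma> \<in> carrier R"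
    and g: "g1 \<in> K" "g2 \<in> K" "g3 \<in> K" "g1 \<noteq> g2" "g1 \<noteq> g3" "g2 \<noteq> g3" "\<beta> \<noteq> g1" "\<beta> \<noteq> g2" "\<beta> \<noteq> g3"
    and f: "\<And>g. f g = \<gamma> \<oplus> \<alpha> \<otimes> inv (\<beta> \<ominus> g)" and d: "f g1 \<ominus> f g2 \<in> K" "f g1 \<ominus> f g3 \<in> K"
  shows "\<alpha> \<in> K \<and> \<beta> \<in> K"
proof -
  note Kc = subfield_closed[OF K]
  have gc: "g1 \<in> carrier R" "g2 \<in> carrier R" "g3 \<in> carrier R" using g Kc(1) by auto
  have quot: "\<alpha> \<otimes> inv (\<beta> \<ominus> g1) \<otimes> inv (\<beta> \<ominus> g) \<in> K" if "g \<in> K" "g1 \<noteq> g" "\<beta> \<noteq> g" "f g1 \<ominus> f g \<in> K" for g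
  proof -
    have gc': "g \<in> carrier R" using that Kc(1) by auto
    have nz: "\<beta> \<ominus> g1 \<noteq> \<zero>" "\<beta> \<ominus> g \<noteq> \<zero>" "g1 \<ominus> g \<noteq> \<zero>" using that g cl gc gc' by (auto simp: minus_eq_zero_iff)
    have i: "inv (\<beta> \<ominus> g1) \<in> carrier R" "inv (\<beta> \<ominus> g) \<in> carrier R" "(\<beta> \<ominus> g1) \<otimes> inv (\<beta> \<ominus> g1) = \<one>" "(\<beta> \<ominus> g) \<otimes> inv (\<beta> \<ominus> g) = \<one>"
      using nz cl gc gc' by auto
    have "(g1 \<ominus> g) \<otimes> (\<alpha> \<otimes> inv (\<beta> \<ominus> g1) \<otimes> inv (\<beta> \<ominus> g))
        = \<alpha> \<otimes> inv (\<beta> \<ominus> g1) \<otimes> ((\<beta> \<ominus> g) \<otimes> inv (\<beta> \<ominus> g)) \<ominus> \<alpha> \<otimes> inv (\<beta> \<ominus> g) \<otimes> ((\<beta> \<ominus> g1) \<otimes> inv (\<beta> \<ominus> g1))"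
      using i(1,2) gc gc' cl by algebra
    also have "\<dots> = f g1 \<ominus> f g" unfolding i(3,4) f using i(1,2) cl by algebra
    finally have "(g1 \<ominus> g) \<otimes> (\<alpha> \<otimes> inv (\<beta> \<ominus> g1) \<otimes> inv (\<beta> \<ominus> g)) \<in> K" using that by simp
    then show ?thesis
      by (rule subfield_mult_cancel[OF K, rotated 3]) (use that g nz i cl Kc in auto)
  qed
  let ?h1 = "\<beta> \<ominus> g1" and ?h2 = "\<beta> \<ominus> g2" and ?h3 = "\<beta> \<ominus> g3"
  have hc: "?h1 \<in> carrier R" "?h2 \<in> carrier R" "?h3 \<in> carrier R" using cl gc by auto
  have nz: "?h1 \<noteq> \<zero>" "?h2 \<noteq> \<zero>" "?h3 \<noteq> \<zero>" "g2 \<ominus> g3 \<noteq> \<zero>" using g cl gc by (auto simp: minus_eq_zero_iff)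
  have i: "inv ?h1 \<in> carrier R" "inv ?h2 \<in> carrier R" "inv ?h3 \<in> carrier R"
    "?h1 \<otimes> inv ?h1 = \<one>" "?h2 \<otimes> inv ?h2 = \<one>" "?h3 \<otimes> inv ?h3 = \<one>" using nz hc by auto
  define q2 q3 where "q2 = \<alpha> \<otimes> inv ?h1 \<otimes> inv ?h2" and "q3 = \<alpha> \<otimes> inv ?h1 \<otimes> inv ?h3"
  have q: "q2 \<in> K" "q3 \<in> K" using quot g d by (auto simp: q2_def q3_def)
  have qnz: "q3 \<noteq> \<zero>" "q2 \<noteq> \<zero>" using i(1-3) nz cl hc inv_nonzero by (simp_all add: q2_def q3_def integral_iff)
  have "q2 \<otimes> ?h2 = \<alpha> \<otimes> inv ?h1 \<otimes> (?h2 \<otimes> inv ?h2)" "q3 \<otimes> ?h3 = \<alpha> \<otimes> inv ?h1 \<otimes> (?h3 \<otimes> inv ?h3)"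
    unfolding q2_def q3_def using i(1-3) cl gc by algebra+
  then have e: "q2 \<otimes> ?h2 = q3 \<otimes> ?h3" using i by simp
  have qc: "q2 \<in> carrier R" "q3 \<in> carrier R" using q Kc by auto
  have "(q2 \<ominus> q3) \<otimes> ?h2 = q2 \<otimes> ?h2 \<ominus> q3 \<otimes> ?h3 \<oplus> q3 \<otimes> (?h3 \<ominus> ?h2)" using qc cl gc by algebra
  also have "\<dots> = q3 \<otimes> (g2 \<ominus> g3)" unfolding e using qc cl gc by algebra
  finally have e2: "(q2 \<ominus> q3) \<otimes> ?h2 = q3 \<otimes> (g2 \<ominus> g3)" .
  have "q3 \<otimes> (g2 \<ominus> g3) \<noteq> \<zero>" using qnz nz qc gc by (simp add: integral_iff)
  then have "q2 \<ominus> q3 \<noteq> \<zero>" using e2 hc by auto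
  moreover have "(q2 \<ominus> q3) \<otimes> ?h2 \<in> K" unfolding e2 using q g Kc by auto
  ultimately have h2: "?h2 \<in> K" using subfield_mult_cancel[OF K Kc(5)[OF q] _ hc(2)] by blast
  have "\<beta> = ?h2 \<oplus> g2" using cl gc by algebra
  then have \<beta>: "\<beta> \<in> K" using Kc(4)[OF h2 g(2)] by simp
  have "\<alpha> = \<alpha> \<otimes> (?h1 \<otimes> inv ?h1) \<otimes> (?h2 \<otimes> inv ?h2)" unfolding i using cl by simp
  also have "\<dots> = q2 \<otimes> (?h1 \<otimes> ?h2)" unfolding q2_def using i(1,2) cl gc by algebra
  finally have "\<alpha> = q2 \<otimes> (?h1 \<otimes> ?h2)" .
  moreover have "q2 \<otimes> (?h1 \<otimes> ?h2) \<in> K" using Kc(6)[OF q(1) Kc(6)[OF Kc(5)[OF \<beta> g(1)] h2]] .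
  ultimately show ?thesis using \<beta> by simp
qed

text \<open>If \<alpha> and \<beta> lie in K, all images lie in the one coset of \<gamma>; as t is
  not in K, different j give different cosets, so a single As j contains all images. Otherwise three
  images in one As j would contradict \<open>moebius_coset\<close>, so there are at most 2
  |J|.\<close>

lemma card_moebius_preimage:
  fixes B :: real
  assumes fin: "finite (carrier R)" and K: "subfield K R" and t: "t \<in> carrier R" "t \<notin> K"
    and cl: "\<alpha> \<in> carrier R" "\<alpha> \<noteq> \<zero>" "\<beta> \<in> carrier R" "\<gamma> \<in> carrier R"
    and \<Lambda>: "\<Lambda> \<subseteq> K" "\<And>g. g \<in> \<Lambda> \<Longrightarrow> \<beta> \<noteq> g \<and> \<gamma> \<oplus> \<alpha> \<otimes> inv (\<beta> \<ominus> g) \<in> (\<Union>j\<in>J. As j)"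
    and J: "J \<subseteq> K" "card J \<le> B" and As: "\<And>j. j \<in> J \<Longrightarrow> As j \<subseteq> K +> (j \<otimes> t) \<and> card (As j) \<le> B"
  shows "card \<Lambda> \<le> 2 * B"
proof -
  note Kc = subfield_closed[OF K]
  have fK: "finite K" using Kc(1) fin finite_subset by blast
  have fJ: "finite J" "finite \<Lambda>" using J \<Lambda> fK finite_subset by blast+
  have B: "0 \<le> B" using J(2) by linarith
  define f where "f g = \<gamma> \<oplus> \<alpha> \<otimes> inv (\<beta> \<ominus> g)" for g
  have \<Lambda>c: "g \<in> carrier R" if "g \<in> \<Lambda>" for g using that \<Lambda> Kc by auto
  have h: "\<beta> \<ominus> g \<noteq> \<zero>" "inv (\<beta> \<ominus> g) \<in> carrier R" "(\<beta> \<ominus> g) \<otimes> inv (\<beta> \<ominus> g) = \<one>" if "g \<in> \<Lambda>" for g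
    using \<Lambda>(2)[OF that] \<Lambda>c[OF that] cl by (auto simp: minus_eq_zero_iff)
  have fc: "f g \<in> carrier R" if "g \<in> \<Lambda>" for g using h[OF that] cl by (simp add: f_def)
  have inj: "inj_on f \<Lambda>"
  proof (rule inj_onI)
    fix g g' assume g: "g \<in> \<Lambda>" "g' \<in> \<Lambda>" "f g = f g'"
    have "\<alpha> \<otimes> inv (\<beta> \<ominus> g) = \<alpha> \<otimes> inv (\<beta> \<ominus> g')" using g h cl by (simp add: f_def)
    then have ie: "inv (\<beta> \<ominus> g) = inv (\<beta> \<ominus> g')" using m_lcancel[OF cl(2,1)] h g by blast
    have "\<beta> \<ominus> g = (\<beta> \<ominus> g) \<otimes> ((\<beta> \<ominus> g') \<otimes> inv (\<beta> \<ominus> g'))" using h[OF g(2)] \<Lambda>c[OF g(1)] cl by simp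
    also have "\<dots> = (\<beta> \<ominus> g') \<otimes> ((\<beta> \<ominus> g) \<otimes> inv (\<beta> \<ominus> g'))" using h(2)[OF g(2)] \<Lambda>c[OF g(1)] \<Lambda>c[OF g(2)] cl by algebra
    also have "\<dots> = \<beta> \<ominus> g'" using h(3)[OF g(1)] \<Lambda>c[OF g(2)] cl unfolding ie by simp
    finally have e: "\<beta> \<ominus> g = \<beta> \<ominus> g'" .
    have "g = \<beta> \<ominus> (\<beta> \<ominus> g)" "g' = \<beta> \<ominus> (\<beta> \<ominus> g')" using \<Lambda>c[OF g(1)] \<Lambda>c[OF g(2)] cl by algebra+
    then show "g = g'" using e by simp
  qed
  have jc: "j \<in> carrier R" if "j \<in> J" for j using that J Kc by auto
  have coset: "\<exists>k\<in>K. x = k \<oplus> j \<otimes> t" if "j \<in> J" "x \<in> As j" for j x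
    using As[OF that(1)] that(2) by (auto simp: a_r_coset_def')
  have same: "f g \<ominus> f g' \<in> K" if g: "g \<in> \<Lambda>" "g' \<in> \<Lambda>" and j: "j \<in> J" "f g \<in> As j" "f g' \<in> As j" for g g' j
  proof -
    obtain k k' where k: "k \<in> K" "f g = k \<oplus> j \<otimes> t" "k' \<in> K" "f g' = k' \<oplus> j \<otimes> t" using coset j by metis
    have "k \<in> carrier R" "k' \<in> carrier R" using k Kc by auto
    then have "f g \<ominus> f g' = k \<ominus> k'" unfolding k using jc[OF j(1)] t by algebra
    then show ?thesis using k Kc by auto
  qed
  define S where "S j = {g \<in> \<Lambda>. f g \<in> As j}" for j
  have fS: "finite (S j)" for j using fJ by (simp add: S_def)
  have cover: "\<exists>j\<in>J. f g \<in> As j" if "g \<in> \<Lambda>" for g using \<Lambda>(2)[OF that] by (simp add: f_def)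
  then have \<Lambda>S: "\<Lambda> = (\<Union>j\<in>J. S j)" by (auto simp: S_def)
  show ?thesis
  proof (cases "\<alpha> \<in> K \<and> \<beta> \<in> K")
    case True
    show ?thesis
    proof (cases "\<Lambda> = {}")
      case False
      then obtain g0 j0 where g0: "g0 \<in> \<Lambda>" "j0 \<in> J" "f g0 \<in> As j0" using cover by blast
      have "f g \<in> As j0" if g: "g \<in> \<Lambda>" for g
      proof -
        obtain j where j: "j \<in> J" "f g \<in> As j" using cover[OF g] by blast
        obtain k k0 where k: "k \<in> K" "f g = k \<oplus> j \<otimes> t" "k0 \<in> K" "f g0 = k0 \<oplus> j0 \<otimes> t" using coset j g0 by metis
        have "inv (\<beta> \<ominus> g) \<in> K" "inv (\<beta> \<ominus> g0) \<in> K"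
          using True h(1)[OF g] h(1)[OF g0(1)] \<Lambda>(1) g g0 Kc by auto
        then have *: "\<alpha> \<otimes> inv (\<beta> \<ominus> g) \<ominus> \<alpha> \<otimes> inv (\<beta> \<ominus> g0) \<ominus> (k \<ominus> k0) \<in> K" using True k Kc by auto
        have cc: "k \<in> carrier R" "k0 \<in> carrier R" using k Kc by auto
        have "(j \<ominus> j0) \<otimes> t = (k \<oplus> j \<otimes> t) \<ominus> (k0 \<oplus> j0 \<otimes> t) \<ominus> (k \<ominus> k0)"
          using cc jc[OF j(1)] jc[OF g0(2)] t by algebra
        also have "\<dots> = \<alpha> \<otimes> inv (\<beta> \<ominus> g) \<ominus> \<alpha> \<otimes> inv (\<beta> \<ominus> g0) \<ominus> (k \<ominus> k0)"
          unfolding k(2,4)[symmetric] f_def using cc h(2)[OF g] h(2)[OF g0(1)] cl by algebra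
        finally have "(j \<ominus> j0) \<otimes> t \<in> K" using * by simp
        moreover have "j \<ominus> j0 \<in> K" using Kc(5)[of j j0] j(1) g0(2) J(1) by blast
        ultimately have "j \<ominus> j0 = \<zero>" using subfield_mult_cancel[OF K _ _ t(1)] t(2) by blast
        then have "j = j0" using jc j g0 by (simp add: minus_eq_zero_iff)
        then show ?thesis using j by simp
      qed
      then have "f ` \<Lambda> \<subseteq> As j0" by auto
      moreover have "K +> (j0 \<otimes> t) \<subseteq> carrier R" using jc[OF g0(2)] t Kc(1) by (auto simp: a_r_coset_def')
      then have "finite (As j0)" using As[OF g0(2)] fin finite_subset by (metis subset_trans)
      ultimately have "card \<Lambda> \<le> card (As j0)" using inj by (metis card_image card_mono)
      then show ?thesis using As[OF g0(2)] B by linarith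
    qed (use B in simp)
  next
    case False
    have S2: "card (S j) \<le> 2" if j: "j \<in> J" for j
    proof (rule ccontr)
      assume "\<not> ?thesis"
      then have "3 \<le> card (S j)" by simp
      then obtain T where "T \<subseteq> S j" "card T = 3" by (metis obtain_subset_with_card_n)
      then obtain g1 g2 g3 where T: "g1 \<in> S j" "g2 \<in> S j" "g3 \<in> S j" "g1 \<noteq> g2" "g1 \<noteq> g3" "g2 \<noteq> g3"
        by (auto simp: card_3_iff)
      then have g: "g1 \<in> \<Lambda>" "g2 \<in> \<Lambda>" "g3 \<in> \<Lambda>" "f g1 \<in> As j" "f g2 \<in> As j" "f g3 \<in> As j" by (auto simp: S_def)
      have "\<alpha> \<in> K \<and> \<beta> \<in> K"
        by (rule moebius_coset[OF K cl, of g1 g2 g3 f])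
          (use g T(4-6) \<Lambda> same[OF g(1) g(2) j] same[OF g(1) g(3) j] f_def in auto)
      with False show False by simp
    qed
    have "card \<Lambda> \<le> (\<Sum>j\<in>J. card (S j))" by (subst \<Lambda>S) (use fJ in \<open>intro card_UN_le\<close>)
    also have "\<dots> \<le> card J * 2" using S2 sum_bounded_above[of J "\<lambda>j. card (S j)" 2] by simp
    finally have "real (card \<Lambda>) \<le> real (card J) * 2" by (metis of_nat_le_iff of_nat_mult of_nat_numeral)
    then show ?thesis using J(2) by linarith
  qed
qed

section \<open>The incidence bound\<close>

text \<open>A point lies on at most one vertical line, so vertical lines cost at most |P|. The
  others are encoded injectively by slope and intercept.\<close>

lemma incidences_le_nonvertical:
  assumes fin: "finite (carrier R)" and P: "P \<subseteq> carrier R \<times> carrier R" and L: "\<And>l. l \<in> L \<Longrightarrow> is_line R l"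
  obtains Q where "Q \<subseteq> carrier R \<times> carrier R" "card Q \<le> card L"
    "incidences P L \<le> (\<Sum>l\<in>Q. card {p \<in> P. snd p = fst l \<otimes> fst p \<oplus> snd l}) + card P"
proof -
  define line where "line l = {(x, y) \<in> carrier R \<times> carrier R. y = fst l \<otimes> x \<oplus> snd l}" for l
  define Q where "Q = {l \<in> carrier R \<times> carrier R. line l \<in> L}"
  have Q: "Q \<subseteq> carrier R \<times> carrier R" by (auto simp: Q_def)
  have fP: "finite P" using P fin finite_subset by blast
  have fQ: "finite Q" using Q fin finite_subset by blast
  have "L \<subseteq> Pow (carrier R \<times> carrier R)" using L by (force simp: is_line_def)
  then have fL: "finite L" using fin finite_subset by blast
  have inj: "inj_on line (carrier R \<times> carrier R)"
  proof (rule inj_onI)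
    fix l l' assume l: "l \<in> carrier R \<times> carrier R" "l' \<in> carrier R \<times> carrier R" "line l = line l'"
    let ?p = "(\<zero>, fst l \<otimes> \<zero> \<oplus> snd l)" and ?q = "(\<one>, fst l \<otimes> \<one> \<oplus> snd l)"
    have "?p \<in> line l" "?q \<in> line l" using l(1) by (auto simp: line_def)
    then have "?p \<in> line l'" "?q \<in> line l'" unfolding l(3) by this+
    then show "l = l'" by (intro two_points_one_line[of ?p ?q l l']) (use l(1,2) in \<open>auto simp: line_def\<close>)
  qed
  have cQ: "card Q \<le> card L"
    using fL by (intro card_inj_on_le[of line]) (auto simp: Q_def intro: inj_on_subset[OF inj])
  let ?A = "SIGMA l:Q. {p \<in> P. snd p = fst l \<otimes> fst p \<oplus> snd l}"
  let ?I = "{(q, l) \<in> P \<times> L. q \<in> l}"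
  have vert: "\<exists>c\<in>carrier R. l = {(x, y) \<in> carrier R \<times> carrier R. x = c}" if l: "l \<in> L" "l \<notin> line ` Q" for l
  proof -
    obtain a b c where abc: "a \<in> carrier R" "b \<in> carrier R" "c \<in> carrier R" "(a, b) \<noteq> (\<zero>, \<zero>)"
      "l = {(x, y) \<in> carrier R \<times> carrier R. a \<otimes> x \<oplus> b \<otimes> y = c}"
      using L[OF l(1)] by (auto simp: is_line_def)
    have "b = \<zero>"
    proof (rule ccontr)
      assume b: "b \<noteq> \<zero>"
      have ib: "inv b \<in> carrier R" "b \<otimes> inv b = \<one>" using b abc by auto
      let ?l = "(\<ominus> a \<otimes> inv b, c \<otimes> inv b)"
      have "l = line ?l"
      proof -
        have "a \<otimes> x \<oplus> b \<otimes> y = c \<longleftrightarrow> y = \<ominus> a \<otimes> inv b \<otimes> x \<oplus> c \<otimes> inv b" if xy: "x \<in> carrier R" "y \<in> carrier R" for x y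
        proof
          assume e: "a \<otimes> x \<oplus> b \<otimes> y = c"
          have "\<ominus> a \<otimes> inv b \<otimes> x \<oplus> c \<otimes> inv b = (b \<otimes> inv b) \<otimes> y"
            unfolding e[symmetric] using abc(1,2) ib(1) xy by algebra
          then show "y = \<ominus> a \<otimes> inv b \<otimes> x \<oplus> c \<otimes> inv b" using ib xy by simp
        next
          assume e: "y = \<ominus> a \<otimes> inv b \<otimes> x \<oplus> c \<otimes> inv b"
          have "a \<otimes> x \<oplus> b \<otimes> y = a \<otimes> x \<ominus> (b \<otimes> inv b) \<otimes> (a \<otimes> x) \<oplus> (b \<otimes> inv b) \<otimes> c"
            unfolding e using abc(1-3) ib(1) xy by algebra
          also have "\<dots> = c" unfolding ib(2) using abc(1-3) xy by algebra
          finally show "a \<otimes> x \<oplus> b \<otimes> y = c" .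
        qed
        then show ?thesis unfolding abc(5) line_def by auto
      qed
      moreover have "?l \<in> carrier R \<times> carrier R" using abc ib by auto
      ultimately have "l \<in> line ` Q" using l(1) by (auto simp: Q_def)
      with l(2) show False by simp
    qed
    then have a: "a \<noteq> \<zero>" using abc by auto
    have "a \<otimes> x \<oplus> b \<otimes> y = c \<longleftrightarrow> x = c \<otimes> inv a" if "x \<in> carrier R" "y \<in> carrier R" for x y
      using eq_mult_inv_iff[OF abc(3,1) that(1) a] that abc \<open>b = \<zero>\<close> by (auto simp: m_comm)
    then have "l = {(x, y) \<in> carrier R \<times> carrier R. x = c \<otimes> inv a}" unfolding abc(5) by auto
    moreover have "c \<otimes> inv a \<in> carrier R" using abc a by auto
    ultimately show ?thesis by blast
  qed
  define B where "B = {(q, l) \<in> P \<times> L. q \<in> l \<and> l \<notin> line ` Q}"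
  have "inj_on fst B"
  proof (rule inj_onI)
    fix u v assume uv: "u \<in> B" "v \<in> B" "fst u = fst v"
    obtain q l l' where e: "u = (q, l)" "v = (q, l')" using uv(3) by (metis prod.collapse)
    have l: "l \<in> L" "l \<notin> line ` Q" "q \<in> l" "l' \<in> L" "l' \<notin> line ` Q" "q \<in> l'" using uv by (auto simp: B_def e)
    from vert[OF l(1,2)] vert[OF l(4,5)] l(3,6) show "u = v" unfolding e by auto
  qed
  then have cB: "card B \<le> card P" using fP by (intro card_inj_on_le) (auto simp: B_def)
  have fA: "finite ?A" using fQ fP by (intro finite_SigmaI) auto
  have fB: "finite B" by (rule finite_subset[of _ "P \<times> L"]) (use fP fL in \<open>auto simp: B_def\<close>)
  have "?I \<subseteq> (\<lambda>(l, p). (p, line l)) ` ?A \<union> B"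
  proof
    fix v assume "v \<in> ?I"
    then obtain q l where v: "v = (q, l)" "q \<in> P" "l \<in> L" "q \<in> l" by auto
    show "v \<in> (\<lambda>(l, p). (p, line l)) ` ?A \<union> B"
    proof (cases "l \<in> line ` Q")
      case True
      then obtain l0 where l0: "l0 \<in> Q" "l = line l0" by auto
      then have "(l0, q) \<in> ?A" using v by (auto simp: line_def)
      then show ?thesis using v l0 by force
    qed (use v in \<open>auto simp: B_def\<close>)
  qed
  then have "incidences P L \<le> card ((\<lambda>(l, p). (p, line l)) ` ?A \<union> B)"
    unfolding incidences_def using fA fB by (intro card_mono) auto
  also have "\<dots> \<le> card ?A + card P"
    using card_Un_le[of "(\<lambda>(l, p). (p, line l)) ` ?A" B] card_image_le[OF fA, of "\<lambda>(l, p). (p, line l)"] cB by linarith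
  also have "card ?A = (\<Sum>l\<in>Q. card {p \<in> P. snd p = fst l \<otimes> fst p \<oplus> snd l})"
    using fQ fP by (simp add: card_SigmaI)
  finally show ?thesis using that[of Q] Q cQ by simp
qed

text \<open>Lines with at least 2N points carry at most 2|P| incidences by
  \<open>heavy_blocks\<close>; each of the others has fewer than 2N points.\<close>

lemma nonvertical_incidences_trivial:
  fixes N :: real
  assumes fin: "finite (carrier R)" and PQ: "P \<subseteq> carrier R \<times> carrier R" "Q \<subseteq> carrier R \<times> carrier R"
    and card: "card P \<le> N\<^sup>2" "card Q \<le> N\<^sup>2" and N: "1 \<le> N"
  shows "(\<Sum>l\<in>Q. card {p \<in> P. snd p = fst l \<otimes> fst p \<oplus> snd l}) \<le> 4 * N ^ 3"
proof -
  define k where "k l = card {p \<in> P. snd p = fst l \<otimes> fst p \<oplus> snd l}" for l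
  have fP: "finite P" "finite Q" using PQ fin finite_subset by blast+
  define H where "H = {l \<in> Q. 2 * N \<le> k l}"
  have "(\<Sum>l\<in>H. k l) \<le> 2 * card P" unfolding k_def
  proof (rule heavy_blocks[where D = "2 * N"])
    show "l = l'" if "p \<in> P" "p' \<in> P" "p \<noteq> p'" "l \<in> H" "l' \<in> H"
      "snd p = fst l \<otimes> fst p \<oplus> snd l" "snd p' = fst l \<otimes> fst p' \<oplus> snd l"
      "snd p = fst l' \<otimes> fst p \<oplus> snd l'" "snd p' = fst l' \<otimes> fst p' \<oplus> snd l'" for p p' l l'
      by (rule two_points_one_line[of p p']) (use that PQ in \<open>auto simp: H_def\<close>)
    show "real (2 * card P) \<le> (2 * N)\<^sup>2" using card(1) zero_le_power2[of N] by (simp add: power_mult_distrib)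
  qed (use fP N in \<open>auto simp: H_def k_def\<close>)
  then have "real (\<Sum>l\<in>H. k l) \<le> real (2 * card P)" by (simp only: of_nat_le_iff)
  then have 1: "(\<Sum>l\<in>H. real (k l)) \<le> 2 * N\<^sup>2" using card(1) by simp
  have "(\<Sum>l\<in>Q - H. real (k l)) \<le> card (Q - H) * (2 * N)" by (intro sum_bounded_above) (auto simp: H_def)
  also have "\<dots> \<le> N\<^sup>2 * (2 * N)"
  proof (rule mult_right_mono)
    have "card (Q - H) \<le> card Q" using fP by (intro card_mono) auto
    then show "real (card (Q - H)) \<le> N\<^sup>2" using card(2) by linarith
  qed (use N in auto)
  finally have 2: "(\<Sum>l\<in>Q - H. real (k l)) \<le> 2 * N ^ 3" by (simp add: power2_eq_square power3_eq_cube)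
  have "N\<^sup>2 \<le> N ^ 3" using N by (intro power_increasing) auto
  moreover have "(\<Sum>l\<in>Q. real (k l)) = (\<Sum>l\<in>Q - H. real (k l)) + (\<Sum>l\<in>H. real (k l))"
    using fP by (intro sum.subset_diff) (auto simp: H_def)
  ultimately show ?thesis using 1 2 by (simp add: k_def)
qed

lemma defining_element_not_in_subfield:
  assumes "subfield K R" "defining_element R K t" "K \<noteq> carrier R"
  shows "t \<in> carrier R" "t \<notin> K"
proof -
  show "t \<in> carrier R" using assms by (simp add: defining_element_def)
  show "t \<notin> K"
  proof
    assume "t \<in> K"
    then have "insert t K = K" by auto
    then have "carrier R = generate_field R K" using assms(2) by (simp add: defining_element_def)
    also have "\<dots> \<subseteq> K" using assms(1) subfieldE(3) by (intro generate_field_min_subfield1) auto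
    finally show False using assms subfieldE(3) by blast
  qed
qed

text \<open>Here \<open>N = n powr (1 / 2)\<close> and \<open>\<nu> = n powr (1 / 12838)\<close>, so that \<open>\<nu> ^ 5120\<close>
  is the \<open>n powr (2560 / 6419)\<close> of the theorem.\<close>

lemma incidence_bound:
  fixes c \<theta> \<nu> N :: real
  assumes c: "0 < c" and \<theta>: "(1 + 2 * c) * (1 + c) < \<theta>" and p: "prime p" and cR: "card (carrier R) = p ^ 4"
    and K: "subfield K R" "card K = p ^ 2" and P: "P \<subseteq> carrier R \<times> carrier R"
    and N: "N\<^sup>2 = card P" "1 \<le> N" and \<nu>: "0 < \<nu>" "\<nu> ^ 6419 = N" and p_le: "p \<le> (1 + c) * \<nu> ^ 5120"
    and t: "defining_element R K t" and A: "card (fst ` P) \<le> c * p ^ 2" "fst ` P = (\<Union>j\<in>J. As j)"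
    and J: "J \<subseteq> K" "card J \<le> c * (1 + c) * \<nu> ^ 5120"
    and As: "\<And>j. j \<in> J \<Longrightarrow> As j \<subseteq> K +> (j \<otimes> t) \<and> card (As j) \<le> c * (1 + c) * \<nu> ^ 5120"
    and L: "\<And>l. l \<in> L \<Longrightarrow> is_line R l" "card L = card P"
  shows "incidences P L \<le> (1 + 20480 * \<theta>) * (N ^ 3 / \<nu>)"
proof (rule ccontr)
  assume "\<not> ?thesis"
  then have I: "(1 + 20480 * \<theta>) * (N ^ 3 / \<nu>) < incidences P L" by simp
  have \<theta>1: "1 \<le> \<theta>" "1 + c \<le> \<theta>"
  proof -
    have "1 + c \<le> (1 + 2 * c) * (1 + c)" using mult_right_mono[of 1 "1 + 2 * c" "1 + c"] c by simp
    then show "1 + c \<le> \<theta>" by (rule order_trans[OF _ less_imp_le[OF \<theta>]])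
    then show "1 \<le> \<theta>" using c by linarith
  qed
  have p2: "2 \<le> p" using p by (rule prime_ge_2_nat)
  have fin: "finite (carrier R)" using cR p2 by (metis card_gt_0_iff not_numeral_le_zero zero_less_power gr0I)
  have \<nu>1: "1 \<le> \<nu>"
  proof (rule ccontr)
    assume "\<not> 1 \<le> \<nu>"
    then have "\<nu> ^ 6419 < \<nu> ^ 0" using \<nu>(1) by (intro power_strict_decreasing) auto
    then show False using \<nu> N by simp
  qed
  have \<nu>N: "\<nu> \<le> N" using power_increasing[of 1 6419 \<nu>] \<nu>1 \<nu>(2) by simp
  obtain Q where Q: "Q \<subseteq> carrier R \<times> carrier R" "card Q \<le> card L"
    "incidences P L \<le> (\<Sum>l\<in>Q. card {p \<in> P. snd p = fst l \<otimes> fst p \<oplus> snd l}) + card P"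
    using incidences_le_nonvertical[OF fin P L(1)] by blast
  define S where "S = real (\<Sum>l\<in>Q. card {p \<in> P. snd p = fst l \<otimes> fst p \<oplus> snd l})"
  have cP: "card P \<le> N\<^sup>2" "card Q \<le> N\<^sup>2" using N Q L(2) by auto
  have IS: "incidences P L \<le> S + N\<^sup>2" unfolding S_def using Q(3) N(1) by linarith
  have "S \<le> 4 * N ^ 3" unfolding S_def by (rule nonvertical_incidences_trivial[OF fin P Q(1) cP N(2)])
  moreover have "N\<^sup>2 \<le> N ^ 3" using N by (intro power_increasing) auto
  ultimately have "(1 + 20480 * \<theta>) * (N ^ 3 / \<nu>) < 5 * N ^ 3" using I IS by linarith
  then have "(1 + 20480 * \<theta>) * N ^ 3 < (5 * \<nu>) * N ^ 3" using \<nu>(1) by (simp add: field_simps)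
  \<comment> \<open>The trivial bound 5 N^3 would beat the claim if \<nu> were small, so \<nu> >
    4096 \<theta>. This is the origin of 20480 = 5 * 4096 and gives M >= 4096.\<close>
  then have big: "1 + 20480 * \<theta> < 5 * \<nu>" using N(2) by (simp add: mult_less_cancel_right)
  define M where "M = \<nu> / \<theta>"
  have M: "4096 \<le> M" using big \<theta>1 by (simp add: M_def field_simps)
  have \<nu>M: "\<nu> = M * \<theta>" using \<theta>1 by (simp add: M_def)
  have M1: "1 \<le> M" using M by simp
  have Mk: "M ^ k * \<theta> \<le> M ^ k * \<theta> ^ k" if "1 \<le> k" for k
    using M1 \<theta>1 power_increasing[of 1 k \<theta>] that by (intro mult_left_mono) auto
  have MN: "M ^ 6419 * \<theta> ^ 6419 = N" using \<nu>(2) by (simp add: \<nu>M power_mult_distrib)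
  have N5000: "M ^ 5000 \<le> N"
  proof -
    have "M ^ 5000 \<le> M ^ 6419" using M1 by (intro power_increasing) auto
    also have "\<dots> \<le> M ^ 6419 * \<theta> ^ 6419" using M1 \<theta>1 by simp
    finally show ?thesis using MN by simp
  qed
  have "N\<^sup>2 * \<nu> \<le> N\<^sup>2 * N" using \<nu>N by (intro mult_left_mono) auto
  also have "\<dots> = N ^ 3" by (simp add: power2_eq_square power3_eq_cube)
  finally have "N\<^sup>2 \<le> N ^ 3 / \<nu>" using \<nu>(1) by (simp add: pos_le_divide_eq)
  moreover have "20480 * \<theta> * (N ^ 3 / \<nu>) = 20480 * (N ^ 3 / M)" using \<theta>1 M1 by (simp add: \<nu>M)
  moreover have "(1 + 20480 * \<theta>) * (N ^ 3 / \<nu>) = N ^ 3 / \<nu> + 20480 * \<theta> * (N ^ 3 / \<nu>)"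
    by (simp only: distrib_right mult_1)
  ultimately have "20480 * (N ^ 3 / M) \<le> S" using I IS by linarith
  moreover have "0 \<le> N ^ 3 / M" using N M1 by simp
  moreover have "40 * N ^ 3 / M = 40 * (N ^ 3 / M)" by simp
  ultimately have S: "40 * N ^ 3 / M \<le> real (\<Sum>l\<in>Q. card {p \<in> P. snd p = fst l \<otimes> fst p \<oplus> snd l})"
    unfolding S_def by linarith
  obtain G \<Lambda> \<alpha> \<beta> \<gamma> where G: "subfield G R" "card G \<le> N * M ^ 2000" "\<Lambda> \<subseteq> G" "N / M ^ 55 \<le> card \<Lambda>"
    "\<alpha> \<in> carrier R" "\<alpha> \<noteq> \<zero>" "\<beta> \<in> carrier R" "\<gamma> \<in> carrier R"
    "\<And>g. g \<in> \<Lambda> \<Longrightarrow> \<beta> \<noteq> g \<and> \<gamma> \<oplus> \<alpha> \<otimes> inv (\<beta> \<ominus> g) \<in> fst ` P"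
    by (rule rich_incidences_subfield[OF fin M N5000 P Q(1) cP S], rule that)
  have fG: "finite G" using subfieldE(3)[OF G(1)] fin finite_subset by blast
  \<comment> \<open>After division by \<nu>^5120 the bound N / M^55 leaves \<nu>^1299 / M^55. A
    single factor \<theta> out of \<theta>^1299 already dominates (1 + 2c)(1 + c).\<close>
  have \<Lambda>_big: "(1 + 2 * c) * (1 + c) * \<nu> ^ 5120 < card \<Lambda>"
  proof -
    have "(1 + 2 * c) * (1 + c) * \<nu> ^ 5120 * M ^ 55 < \<theta> * \<nu> ^ 5120 * M ^ 55"
      using \<theta> \<nu>(1) M1 by simp
    also have "\<dots> \<le> \<theta> * \<nu> ^ 5120 * M ^ 1299"
      using \<theta>1 \<nu> M1 by (intro mult_left_mono power_increasing) auto
    also have "\<dots> \<le> \<nu> ^ 5120 * (M ^ 1299 * \<theta> ^ 1299)"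
      using mult_left_mono[OF Mk[of 1299], of "\<nu> ^ 5120"] \<nu>(1) by (simp add: mult_ac)
    also have "\<dots> = \<nu> ^ 5120 * \<nu> ^ 1299" by (simp add: \<nu>M power_mult_distrib)
    also have "\<dots> = N" using \<nu>(2) by (simp flip: power_add)
    finally have "(1 + 2 * c) * (1 + c) * \<nu> ^ 5120 < N / M ^ 55" using M1 by (simp add: pos_less_divide_eq)
    then show ?thesis using G(4) by linarith
  qed
  have \<Lambda>G: "card \<Lambda> \<le> card G" using G(3) fG by (rule card_mono[rotated])
  have pos: "0 \<le> \<nu> ^ 5120" using \<nu> by simp
  consider "card G \<le> p" | "card G = p\<^sup>2" | "card G = p ^ 4"
    using card_subfield_prime_power[OF p cR G(1)] by blast
  then show False
  proof cases
    case 1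
    then have "real (card \<Lambda>) \<le> (1 + c) * \<nu> ^ 5120" using \<Lambda>G p_le by linarith
    also have "\<dots> = 1 * (1 + c) * \<nu> ^ 5120" by simp
    also have "\<dots> \<le> (1 + 2 * c) * (1 + c) * \<nu> ^ 5120" using c pos by (intro mult_right_mono) auto
    finally show False using \<Lambda>_big by linarith
  next
    case 2
    then have GK: "G = K" using subfields_eq[OF fin G(1) K(1)] K(2) by simp
    have "K \<noteq> carrier R"
    proof
      assume "K = carrier R"
      then have "p ^ 2 = p ^ 4" using K(2) cR by simp
      then show False using p2 by simp
    qed
    note t' = defining_element_not_in_subfield[OF K(1) t this]
    have "card \<Lambda> \<le> 2 * (c * (1 + c) * \<nu> ^ 5120)"
      by (rule card_moebius_preimage[OF fin K(1) t' G(5-8) _ _ J As]) (use G(3,9) GK A(2) in auto)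
    also have "\<dots> = (2 * c) * (1 + c) * \<nu> ^ 5120" by simp
    also have "\<dots> \<le> (1 + 2 * c) * (1 + c) * \<nu> ^ 5120" using c pos by (intro mult_right_mono) auto
    finally show False using \<Lambda>_big by linarith
  next
    case 3
    \<comment> \<open>When G is everything, |P| <= |A| p^4 gives N^2 <= c p^6, while p^4 <= N
      M^2000. Eliminating p yields N <= c^2 M^6000, which is impossible because N = M^6419
      \<theta>^6419 and \<theta> > c.\<close>
    have "P \<subseteq> fst ` P \<times> carrier R" using P by force
    then have "card P \<le> card (fst ` P \<times> carrier R)"
      using P fin by (intro card_mono) (auto intro!: finite_cartesian_product finite_imageI intro: finite_subset)
    then have "card P \<le> card (fst ` P) * p ^ 4" using cR by (simp add: card_cartesian_product)
    then have "N\<^sup>2 \<le> real (card (fst ` P)) * real p ^ 4" unfolding N(1) by (metis of_nat_le_iff of_nat_mult of_nat_power)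
    also have "\<dots> \<le> (c * p ^ 2) * real p ^ 4" using A(1) by (intro mult_right_mono) auto
    also have "\<dots> = c * real p ^ 6" by (simp flip: power_add)
    finally have "(N\<^sup>2)\<^sup>2 \<le> (c * real p ^ 6)\<^sup>2" by (intro power_mono) auto
    also have "\<dots> = c\<^sup>2 * (real p ^ 4) ^ 3" by (simp add: power_mult_distrib flip: power_mult)
    also have "\<dots> \<le> c\<^sup>2 * (N * M ^ 2000) ^ 3"
      using G(2) 3 by (intro mult_left_mono power_mono) auto
    also have "\<dots> = (c\<^sup>2 * M ^ 6000) * N ^ 3" by (simp add: power_mult_distrib flip: power_mult)
    finally have "N * N ^ 3 \<le> (c\<^sup>2 * M ^ 6000) * N ^ 3" by (simp flip: power_mult power_Suc)
    then have "N \<le> c\<^sup>2 * M ^ 6000" using N(2) by (simp only: mult_le_cancel_right) auto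
    also have "\<dots> \<le> c\<^sup>2 * M ^ 6419" using M1 by (intro mult_left_mono power_increasing) auto
    finally have "M ^ 6419 * \<theta> ^ 6419 \<le> M ^ 6419 * c\<^sup>2" using MN by (simp add: mult.commute)
    then have "\<theta> ^ 6419 \<le> c\<^sup>2" using M1 by simp
    moreover have "c\<^sup>2 < \<theta>\<^sup>2" using c \<theta>1 by (intro power_strict_mono) auto
    moreover have "\<theta>\<^sup>2 \<le> \<theta> ^ 6419" using \<theta>1 by (intro power_increasing) auto
    ultimately show False by linarith
  qed
qed

end

theorem corollary4:
  fixes c :: real
  assumes "c > 0"
  shows "\<exists>C>0. \<forall>(p :: nat) (n :: nat) (F :: 'a ring) K t P A J As.
    prime p \<longrightarrow>
    field F \<longrightarrow> card (carrier F) = p ^ 4 \<longrightarrow>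
    subfield K F \<longrightarrow> card K = p ^ 2 \<longrightarrow>
    P \<subseteq> carrier F \<times> carrier F \<longrightarrow> card P = n \<longrightarrow>
    real p powr (6419 / 2560) \<le> c * real n \<longrightarrow>
    A = {x. \<exists>y. (x, y) \<in> P} \<longrightarrow>
    defining_element F K t \<longrightarrow>
    real (card A) \<le> c * real p ^ 2 \<longrightarrow>
    A = (\<Union>j\<in>J. As j) \<longrightarrow>
    J \<subseteq> K \<longrightarrow>
    real (card J) \<le> c * max (real p) (real n powr (2560 / 6419)) \<longrightarrow>
    (\<forall>j\<in>J. As j \<subseteq> K +>\<^bsub>F\<^esub> (j \<otimes>\<^bsub>F\<^esub> t) \<and>
       real (card (As j)) \<le> c * max (real p) (real n powr (2560 / 6419))) \<longrightarrow>
    (\<forall>L. (\<forall>l\<in>L. is_line F l) \<and> card L = n \<longrightarrow>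
       real (incidences P L) \<le> C * real n powr (3 / 2 - 1 / 12838))"
proof -
  \<comment> \<open>Any number above (1 + 2c)(1 + c) would do. Since \<theta> depends on c alone, so
    does the constant 1 + 20480 \<theta>.\<close>
  define \<theta> where "\<theta> = (1 + 2 * c) * (1 + c) + 1"
  have \<theta>: "(1 + 2 * c) * (1 + c) < \<theta>" by (simp add: \<theta>_def)
  have \<theta>0: "0 < 1 + 20480 * \<theta>" using assms by (simp add: \<theta>_def add_pos_pos)
  show ?thesis
  proof (intro exI[of _ "1 + 20480 * \<theta>"] conjI allI impI, fact \<theta>0, elim conjE)
    fix p n :: nat and F :: "'a ring" and K t P A J As L
    assume p: "prime p" and F: "field F" and cF: "card (carrier F) = p ^ 4" and K: "subfield K F" "card K = p ^ 2"
      and P: "P \<subseteq> carrier F \<times> carrier F" "card P = n" and pn: "real p powr (6419 / 2560) \<le> c * real n"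
      and A: "A = {x. \<exists>y. (x, y) \<in> P}" and t: "defining_element F K t" and cA: "real (card A) \<le> c * real p ^ 2"
      and AJ: "A = (\<Union>j\<in>J. As j)" and J: "J \<subseteq> K" "real (card J) \<le> c * max (real p) (real n powr (2560 / 6419))"
      and As: "\<forall>j\<in>J. As j \<subseteq> K +>\<^bsub>F\<^esub> (j \<otimes>\<^bsub>F\<^esub> t) \<and>
       real (card (As j)) \<le> c * max (real p) (real n powr (2560 / 6419))"
      and L: "\<forall>l\<in>L. is_line F l" "card L = n"
    interpret field F by (rule F)
    have p0: "0 < real p" using p prime_gt_0_nat by simp
    then have "0 < real p powr (6419 / 2560)" by simp
    then have "0 < c * real n" using pn by linarith
    then have n: "0 < n" using assms by (simp add: zero_less_mult_iff)
    define N where "N = real n powr (1 / 2)"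
    define \<nu> where "\<nu> = real n powr (1 / 12838)"
    have N2: "N\<^sup>2 = card P" using n P(2) by (simp add: N_def powr_half_sqrt)
    have N1: "1 \<le> N" using n by (simp add: N_def ge_one_powr_ge_zero)
    have \<nu>0: "0 < \<nu>" using n by (simp add: \<nu>_def)
    have \<nu>N: "\<nu> ^ 6419 = N" using n by (simp add: \<nu>_def N_def powr_power)
    have \<nu>5120: "\<nu> ^ 5120 = real n powr (2560 / 6419)" using n by (simp add: \<nu>_def powr_power)
    \<comment> \<open>Raising the hypothesis on p to the power 2560/6419 gives p <= c^(2560/6419)
      n^(2560/6419), and the power of c is at most 1 + c. Both entries of the maximum are thereby
      bounded by (1 + c) \<nu>^5120.\<close>
    have p_le: "real p \<le> (1 + c) * \<nu> ^ 5120"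
    proof -
      have "real p = (real p powr (6419 / 2560)) powr (2560 / 6419)" using p0 by (simp add: powr_powr)
      also have "\<dots> \<le> (c * real n) powr (2560 / 6419)" using pn by (intro powr_mono2) auto
      also have "\<dots> = c powr (2560 / 6419) * \<nu> ^ 5120" using assms by (simp add: powr_mult \<nu>5120)
      also have "\<dots> \<le> (1 + c) * \<nu> ^ 5120"
      proof (rule mult_right_mono)
        have "c powr (2560 / 6419) \<le> (1 + c) powr (2560 / 6419)" using assms by (intro powr_mono2) auto
        also have "\<dots> \<le> (1 + c) powr 1" using assms by (intro powr_mono) auto
        finally show "c powr (2560 / 6419) \<le> 1 + c" using assms by simp
      qed (use \<nu>0 in auto)
      finally show ?thesis .
    qed
    have "1 * \<nu> ^ 5120 \<le> (1 + c) * \<nu> ^ 5120" using assms \<nu>0 by (intro mult_right_mono) auto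
    then have "max (real p) (real n powr (2560 / 6419)) \<le> (1 + c) * \<nu> ^ 5120" using p_le \<nu>5120 by simp
    then have mx: "c * max (real p) (real n powr (2560 / 6419)) \<le> c * (1 + c) * \<nu> ^ 5120"
      using assms mult_left_mono[of "max (real p) (real n powr (2560 / 6419))" "(1 + c) * \<nu> ^ 5120" c] by (simp add: mult.assoc)
    have fstP: "fst ` P = A" unfolding A by force
    have "real (incidences P L) \<le> (1 + 20480 * \<theta>) * (N ^ 3 / \<nu>)"
    proof (rule incidence_bound[OF assms \<theta> p cF K P(1) N2 N1 \<nu>0 \<nu>N p_le t])
      show "real (card (fst ` P)) \<le> c * (real p)\<^sup>2" "fst ` P = (\<Union>j\<in>J. As j)" using cA AJ fstP by simp_all
      show "real (card J) \<le> c * (1 + c) * \<nu> ^ 5120" using J mx by linarith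
      show "As j \<subseteq> K +>\<^bsub>F\<^esub> (j \<otimes>\<^bsub>F\<^esub> t) \<and> real (card (As j)) \<le> c * (1 + c) * \<nu> ^ 5120" if "j \<in> J" for j
        using As that mx by force
    qed (use J L P in auto)
    also have "N ^ 3 / \<nu> = real n powr (3 / 2 - 1 / 12838)"
      using n by (simp add: N_def \<nu>_def powr_power flip: powr_diff)
    finally show "real (incidences P L) \<le> (1 + 20480 * \<theta>) * real n powr (3 / 2 - 1 / 12838)" .
  qed
qed

end
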